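(* Let $d\ge2$, $s_\mu,s_\nu\in(0,d]$, and let $\mu,\nu$ be compactly supported Borel measures on $\mathbb{R}^d$ with $\mu(B(x,r))\le C_1r^{s_\mu}$ and $\nu(B(x,r))\le C_1r^{s_\nu}$ for all $x\in\mathbb{R}^d$, $r>0$. Let $A_tf=\sigma_t*(f\mu)$. When $2\le p<\infty$, for every fixed $t>0$, $$\|A_tf\|_{L^p(\nu)}\le C(t)\|f\|_{L^p(\mu)}\ \text{ for all } f\in L^p(\mu),\quad\text{if}\quad \frac{s_\mu}{p'}+\frac{s_\nu}{p}>d-\frac{d-1}{p}.$$ When $1\le p\le2$, for every fixed $t>0$, $$\|A_tf\|_{L^p(\nu)}\le C(t)\|f\|_{L^p(\mu)}\ \text{ for all } f\in L^p(\mu),\quad\text{if}\quad \frac{s_\mu}{p'}+\frac{s_\nu}{p}>1+\frac{d-1}{p}.$$ Here $C(t)$ may depend on $t,p,d,\mu,\nu$ but not on $f$.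
   Context: $\frac1p+\frac1{p'}=1$. $\sigma$ is the surface measure on the unit sphere $S^{d-1}$ and $\sigma_t$ is the measure on the sphere of radius $t$ given by $\widehat{\sigma_t}(\xi)=\widehat\sigma(t\xi)$ (push-forward of $\sigma$ under $y\mapsto ty$). $f\mu$ is the measure with density $f$ with respect to $\mu$. Since $A_tf$ is a priori only a measure, the bounds are understood as follows: for a fixed nonnegative radial $\rho\in C_0^\infty(\mathbb{R}^d)$ with $\int\rho=1$ and $\rho_\epsilon(x)=\epsilon^{-d}\rho(x/\epsilon)$, one has $\|\rho_\epsilon*A_tf\|_{L^p(\nu)}\le C(t)\|f\|_{L^p(\mu)}$ with $C(t)$ independent of $\epsilon\in(0,1)$ and $f$. *)

theory Defs
  imports "HOL-Analysis.Analysis"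
begin

(* Polar coordinates: sigma(E) = d * |{r w : 0 < r <= 1, w in E}| for Borel E in the unit sphere,
   extended by zero to a Borel measure on the whole space. It is not normalised; its total mass is
   the surface area d * |B(0,1)|. Here sgn x = x / |x|. *)
definition sphere_measure :: "'a::euclidean_space measure" where
  "sphere_measure =
     distr (scale_measure (ennreal (real DIM('a))) (restrict_space lborel (cball 0 1 - {0})))
       borel sgn"

(* Push-forward under dilation, so the total mass does not depend on t. *)
definition sphere_measure_at :: "real \<Rightarrow> 'a::euclidean_space measure" where
  "sphere_measure_at t = distr sphere_measure borel (\<lambda>y. t *\<^sub>R y)"

definition measure_support :: "'a::topological_space measure \<Rightarrow> 'a set" where
  "measure_support M = {x. \<forall>U. open U \<longrightarrow> x \<in> U \<longrightarrow> emeasure M U > 0}"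

definition compactly_supported_borel :: "'a::topological_space measure \<Rightarrow> bool" where
  "compactly_supported_borel M \<longleftrightarrow> sets M = sets borel \<and> compact (measure_support M)"

definition ball_growth :: "real \<Rightarrow> real \<Rightarrow> 'a::metric_space measure \<Rightarrow> bool" where
  "ball_growth C s M \<longleftrightarrow> (\<forall>x. \<forall>r>0. emeasure M (ball x r) \<le> ennreal (C * r powr s))"

definition in_Lp :: "real \<Rightarrow> 'a measure \<Rightarrow> ('a \<Rightarrow> complex) \<Rightarrow> bool" where
  "in_Lp p M f \<longleftrightarrow> f \<in> borel_measurable M \<and> integrable M (\<lambda>x. cmod (f x) powr p)"

definition Lp_norm :: "real \<Rightarrow> 'a measure \<Rightarrow> ('a \<Rightarrow> complex) \<Rightarrow> real" where
  "Lp_norm p M f = (\<integral>x. cmod (f x) powr p \<partial>M) powr (1 / p)"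

(* In finite dimensions: f is k times continuously differentiable iff it is differentiable and all
   its directional derivatives are k - 1 times continuously differentiable. *)
primrec Ck :: "nat \<Rightarrow> ('a::euclidean_space \<Rightarrow> 'b::real_normed_vector) \<Rightarrow> bool" where
  "Ck 0 f \<longleftrightarrow> continuous_on UNIV f"
| "Ck (Suc k) f \<longleftrightarrow> (\<forall>x. f differentiable at x) \<and> (\<forall>v. Ck k (\<lambda>x. frechet_derivative f (at x) v))"

definition radial_mollifier :: "('a::euclidean_space \<Rightarrow> real) \<Rightarrow> bool" where
  "radial_mollifier \<rho> \<longleftrightarrow>
     (\<forall>k. Ck k \<rho>) \<and> compact (closure {x. \<rho> x \<noteq> 0}) \<and>
     (\<forall>x. 0 \<le> \<rho> x) \<and> (\<forall>x y. norm x = norm y \<longrightarrow> \<rho> x = \<rho> y) \<and>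
     (\<integral>x. \<rho> x \<partial>lborel) = 1"

definition dilate :: "('a::euclidean_space \<Rightarrow> real) \<Rightarrow> real \<Rightarrow> 'a \<Rightarrow> real" where
  "dilate \<rho> \<epsilon> x = \<rho> (x /\<^sub>R \<epsilon>) / \<epsilon> ^ DIM('a)"

(* The complex measure A_t f = sigma_t * (f mu), represented by its action on test functions g:
   the integral of g against A_t f is the integral of g(y + z) f(z) over sigma_t(dy) mu(dz).
   For f >= 0, spherical_conv_eq_integral compares it with an honest measure: the push-forward of
   the product of sigma_t and f mu under addition. *)
definition spherical_conv ::
    "real \<Rightarrow> 'a::euclidean_space measure \<Rightarrow> ('a \<Rightarrow> complex) \<Rightarrow> ('a \<Rightarrow> complex) \<Rightarrow> complex" where
  "spherical_conv t \<mu> f g = (\<integral>(y, z). g (y + z) * f z \<partial>(sphere_measure_at t \<Otimes>\<^sub>M \<mu>))"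

lemma finite_sphere_measure_at: "finite_measure (sphere_measure_at t :: 'a::euclidean_space measure)"
proof -
  have m: "(sgn :: 'a \<Rightarrow> 'a) \<in> borel_measurable borel"
    unfolding sgn_div_norm by measurable
  have "emeasure lborel (cball (0::'a) 1 - {0}) \<le> emeasure lborel (cball (0::'a) 1)"
    by (intro emeasure_mono) auto
  also have "\<dots> < \<infinity>"
    by (rule emeasure_lborel_cball_finite)
  finally have f: "emeasure lborel (cball (0::'a) 1 - {0}) < \<infinity>" .
  let ?R = "scale_measure (ennreal (real DIM('a))) (restrict_space lborel (cball (0::'a) 1 - {0}))"
  have "finite_measure ?R"
  proof
    show "emeasure ?R (space ?R) \<noteq> \<infinity>"
      using f by (auto simp: space_restrict_space emeasure_restrict_space space_scale_measure
          ennreal_mult_eq_top_iff)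
  qed
  moreover have "(sgn :: 'a \<Rightarrow> 'a) \<in> measurable ?R borel"
  proof -
    have "sgn \<in> measurable (restrict_space lborel (cball (0::'a) 1 - {0})) borel"
      by (rule measurable_restrict_space1) (use m in simp)
    then show ?thesis
      by (simp cong: measurable_cong_sets)
  qed
  ultimately have "finite_measure (sphere_measure :: 'a measure)"
    unfolding sphere_measure_def by (rule finite_measure.finite_measure_distr)
  then show ?thesis
    unfolding sphere_measure_at_def
    by (rule finite_measure.finite_measure_distr) (simp add: sphere_measure_def)
qed

lemma spherical_conv_eq_integral:
  fixes \<mu> :: "'a::euclidean_space measure" and f :: "'a \<Rightarrow> real"
  assumes \<mu>: "finite_measure \<mu>" "sets \<mu> = sets borel"
    and f: "integrable \<mu> f" "\<And>x. 0 \<le> f x"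
    and g: "g \<in> borel_measurable borel"
  shows "spherical_conv t \<mu> (\<lambda>x. complex_of_real (f x)) g =
    (\<integral>x. g x \<partial>distr (sphere_measure_at t \<Otimes>\<^sub>M density \<mu> (\<lambda>x. ennreal (f x))) borel (\<lambda>(y, z). y + z))"
proof -
  note [measurable] = g borel_measurable_integrable[OF f(1)]
  note [measurable_cong] = \<mu>(2)
  let ?S = "sphere_measure_at t :: 'a measure"
  have sS[measurable_cong]: "sets ?S = sets borel"
    by (simp add: sphere_measure_at_def)
  have fm[measurable]: "f \<in> borel_measurable borel"
    using borel_measurable_integrable[OF f(1)] \<mu>(2) by (simp cong: measurable_cong_sets)
  interpret S: finite_measure ?S
    by (rule finite_sphere_measure_at)
  interpret M: finite_measure \<mu>
    by fact
  interpret D: finite_measure "density \<mu> (\<lambda>x. ennreal (f x))"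
  proof
    show "emeasure (density \<mu> (\<lambda>x. ennreal (f x))) (space (density \<mu> (\<lambda>x. ennreal (f x)))) \<noteq> \<infinity>"
      using f by (simp add: emeasure_density nn_integral_eq_integral cong: nn_integral_cong)
  qed
  have S1: "density ?S (\<lambda>_. 1) = ?S"
    by (rule density_1)
  have d: "?S \<Otimes>\<^sub>M density \<mu> (\<lambda>x. ennreal (f x)) =
      density (?S \<Otimes>\<^sub>M \<mu>) (\<lambda>x. ennreal (f (snd x)))"
    using pair_measure_density[of "\<lambda>_. 1" ?S "\<lambda>x. ennreal (f x)" \<mu>]
      M.sigma_finite_measure_axioms D.sigma_finite_measure_axioms
    by (simp add: S1 case_prod_beta')
  show ?thesis
    unfolding spherical_conv_def d
    by (subst integral_distr, measurable, subst integral_density)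
      (use f in \<open>auto simp: case_prod_beta' scaleR_conv_of_real mult.commute\<close>)
qed

definition mollified_conv ::
    "('a::euclidean_space \<Rightarrow> real) \<Rightarrow> real \<Rightarrow> real \<Rightarrow> 'a measure \<Rightarrow> ('a \<Rightarrow> complex) \<Rightarrow> 'a \<Rightarrow> complex" where
  "mollified_conv \<rho> \<epsilon> t \<mu> f x = spherical_conv t \<mu> f (\<lambda>w. complex_of_real (dilate \<rho> \<epsilon> (x - w)))"

(* The a priori meaning of ||A_t f||_{L^p(nu)} <= C(t) ||f||_{L^p(mu)}: C bounds all the mollified
   averages, uniformly in eps in (0,1) and f. *)
definition spherical_Lp_bound ::
    "('a::euclidean_space \<Rightarrow> real) \<Rightarrow> real \<Rightarrow> real \<Rightarrow> 'a measure \<Rightarrow> 'a measure \<Rightarrow> real \<Rightarrow> bool" where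
  "spherical_Lp_bound \<rho> p t \<mu> \<nu> C \<longleftrightarrow>
     (\<forall>\<epsilon>\<in>{0<..<1}. \<forall>f. in_Lp p \<mu> f \<longrightarrow>
        in_Lp p \<nu> (mollified_conv \<rho> \<epsilon> t \<mu> f) \<and>
        Lp_norm p \<nu> (mollified_conv \<rho> \<epsilon> t \<mu> f) \<le> C * Lp_norm p \<mu> f)"

end

theory Submission
  imports Defs "HOL-Probability.Characteristic_Functions" "HOL-Real_Asymp.Real_Asymp"
begin

text \<open>
  For p at least 2 the kernel \<sigma>_t * \<rho>_\<epsilon> is cut into dyadic frequency pieces. At frequency 1 / sqrt s, a piece is a
  combination of Gaussian regularisations at scale s. Gaussian averages of \<mu> are O(s powr (s_\<mu> / 2)) by ball growth,
  so the piece maps bounded functions to bounded functions with norm O(s powr ((s_\<mu> - d) / 2)). The Fourier decay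
  |\<xi>| powr (- (d - 1) / 2) of \<sigma>, with Schur's test on both sides, gives the L2 norm
  O(s powr ((d - 1) / 4 - (d - s_\<mu>) / 4 - (d - s_\<nu>) / 4)). Interpolation gives an Lp norm
  that is a positive power of s exactly under the stated hypothesis, and the pieces are summed geometrically.
  No constant depends on \<epsilon>, because \<rho>_\<epsilon> has Fourier transform at most 1. The case p < 2 follows by duality, the
  kernel being even; p = 1 is excluded by its own hypothesis.

  The decay of the Fourier transform of \<sigma> comes from an energy estimate for the Bessel equation that it satisfies.
\<close>

section \<open>Rotations and the surface measure\<close>

text \<open>Gaussians serve as cutoffs because they are explicit and positive on both sides of the
  Fourier transform: ball growth acts on them directly, and Fubini replaces any inversion theorem.
  The price is paid at low frequencies. A difference of two Gaussians vanishes only like s |\<xi>|^2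
  at the origin, whereas exploiting the decay of \<sigma> requires vanishing like (s |\<xi>|^2) powr
  ((d - 1) / 4), out of reach for d > 5. Hence the binomial combination \<open>flat_cutoff\<close>,
  taken with N = d.

  Uniformity in \<epsilon> is obtained by fixing every constant for the whole class
  \<open>decaying M A\<close> before a measure in it is chosen. The regularised kernel is a finite
  telescoping sum of pieces, and the regularisation is removed only after the bound holds for all
  finite sums.

  The p-th power of the Lp norm of a piece is controlled by the square of its L2 norm times the (p -
  2)-th power of its norm on bounded functions. The resulting power of s is half of d - 1 - p d + (p
  - 1) s_\<mu> + s_\<nu>; dividing by p turns its positivity into the hypothesis.\<close>

lemma borel_measurable_orthogonal_transformation:
  fixes R :: "'a::euclidean_space \<Rightarrow> 'a"
  assumes "orthogonal_transformation R"
  shows "R \<in> borel_measurable borel"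
  using assms linear_continuous_on[of R UNIV] orthogonal_transformation_linear linear_conv_bounded_linear
    borel_measurable_continuous_onI by blast

text \<open>Uniqueness of translation-invariant measures: Fubini compares the image of Lebesgue measure
  with Lebesgue measure itself through the unit ball, which R preserves.\<close>

lemma nn_integral_lborel_orthogonal:
  fixes R :: "'a::euclidean_space \<Rightarrow> 'a"
  assumes R: "orthogonal_transformation R" and f[measurable]: "f \<in> borel_measurable borel"
  shows "(\<integral>\<^sup>+x. f (R x) \<partial>lborel) = (\<integral>\<^sup>+x. f x \<partial>lborel)"
proof -
  define g where "g = (indicator (ball (0::'a) 1) :: 'a \<Rightarrow> ennreal)"
  have g[measurable]: "g \<in> borel_measurable borel" unfolding g_def by (rule borel_measurable_indicator) simp
  have lin: "linear R" using R by (rule orthogonal_transformation_linear)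
  note Rm[measurable] = borel_measurable_orthogonal_transformation[OF R]
  have surj: "surj R" using R by (rule orthogonal_transformation_surj)
  have tr: "(\<integral>\<^sup>+x. h (c + x) \<partial>lborel) = (\<integral>\<^sup>+x. h x \<partial>lborel)"
    if [measurable]: "h \<in> borel_measurable borel" for h and c :: 'a
    by (subst (2) lborel_distr_plus[of c, symmetric]) (simp add: nn_integral_distr)
  have rf: "(\<integral>\<^sup>+x. h (- x) \<partial>lborel) = (\<integral>\<^sup>+x. h x \<partial>lborel)"
    if [measurable]: "h \<in> borel_measurable borel" for h :: "'a \<Rightarrow> ennreal"
  proof -
    have "(\<integral>\<^sup>+x. h x \<partial>lborel) = (\<integral>\<^sup>+x. h x \<partial>density (distr lborel borel (\<lambda>x::'a. 0 + (-1) *\<^sub>R x)) (\<lambda>_. ennreal (\<bar>-1::real\<bar>^DIM('a))))"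
      by (subst lborel_affine[of "-1" 0, symmetric]) simp_all
    then show ?thesis
      by (simp add: nn_integral_density nn_integral_distr)
  qed
  have gR: "g (R x) = g x" for x
    by (simp add: g_def indicator_def orthogonal_transformation_norm[OF R])
  have "(\<integral>\<^sup>+x. f (R x) \<partial>lborel) * (\<integral>\<^sup>+y. g y \<partial>lborel) = (\<integral>\<^sup>+x. (\<integral>\<^sup>+y. f (R x) * g (R x + y) \<partial>lborel) \<partial>lborel)"
    by (simp add: nn_integral_cmult tr nn_integral_multc)
  also have "\<dots> = (\<integral>\<^sup>+y. (\<integral>\<^sup>+x. f (R x) * g (R x + y) \<partial>lborel) \<partial>lborel)"
    by (rule lborel_pair.Fubini') simp
  also have "\<dots> = (\<integral>\<^sup>+y. (\<integral>\<^sup>+x. f (R x - y) * g (R x) \<partial>lborel) \<partial>lborel)"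
  \<comment> \<open>Writing y as \<open>R z\<close> turns the translation by y outside R into a
    translation by z inside, which Lebesgue measure absorbs.\<close>
  proof (rule nn_integral_cong)
    fix y :: 'a
    obtain z where z: "y = R z" using surj by auto
    have "(\<integral>\<^sup>+x. f (R x) * g (R x + y) \<partial>lborel) = (\<integral>\<^sup>+x. f (R (- z + x)) * g (R (- z + x) + y) \<partial>lborel)"
      by (rule tr[symmetric]) simp
    also have "\<dots> = (\<integral>\<^sup>+x. f (R x - y) * g (R x) \<partial>lborel)"
      by (simp add: z linear_diff[OF lin])
    finally show "(\<integral>\<^sup>+x. f (R x) * g (R x + y) \<partial>lborel) = (\<integral>\<^sup>+x. f (R x - y) * g (R x) \<partial>lborel)" .
  qed
  also have "\<dots> = (\<integral>\<^sup>+x. (\<integral>\<^sup>+y. f (R x - y) * g (R x) \<partial>lborel) \<partial>lborel)"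
    by (rule lborel_pair.Fubini') simp
  also have "\<dots> = (\<integral>\<^sup>+x. (\<integral>\<^sup>+y. f (- (- R x + y)) \<partial>lborel) * g (R x) \<partial>lborel)"
    by (simp add: nn_integral_multc)
  also have "\<dots> = (\<integral>\<^sup>+x. f x \<partial>lborel) * (\<integral>\<^sup>+x. g x \<partial>lborel)"
    by (subst tr, simp, subst rf, simp, simp add: gR nn_integral_cmult)
  finally have "(\<integral>\<^sup>+x. f (R x) \<partial>lborel) * (\<integral>\<^sup>+y. g y \<partial>lborel) = (\<integral>\<^sup>+x. f x \<partial>lborel) * (\<integral>\<^sup>+x. g x \<partial>lborel)" .
  moreover have "(\<integral>\<^sup>+y. g y \<partial>lborel) = emeasure lborel (ball (0::'a) 1)"
    by (simp add: g_def)
  moreover have "emeasure lborel (ball (0::'a) 1) < \<infinity>" by (rule emeasure_lborel_ball_finite)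
  moreover have "emeasure lborel (ball (0::'a) 1) > 0"
    by (simp add: emeasure_ball)
  ultimately show ?thesis
    by (auto simp: ennreal_mult_cancel_left mult.commute[of _ "emeasure lborel _"])
qed

lemma sets_sphere_measure [simp, measurable_cong]: "sets sphere_measure = sets borel"
  by (simp add: sphere_measure_def)

lemma space_sphere_measure [simp]: "space sphere_measure = UNIV"
  by (simp add: sphere_measure_def)

lemma borel_measurable_sgn_euclidean [measurable]: "(sgn :: 'a::euclidean_space \<Rightarrow> 'a) \<in> borel_measurable borel"
  unfolding sgn_div_norm by measurable

lemma emeasure_sphere_measure:
  fixes A :: "'a::euclidean_space set"
  assumes [measurable]: "A \<in> sets borel"
  shows "emeasure sphere_measure A = real DIM('a) * emeasure lborel {x. norm x \<le> 1 \<and> x \<noteq> 0 \<and> sgn x \<in> A}"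
proof -
  have "sgn \<in> measurable (restrict_space lborel (cball (0::'a) 1 - {0})) borel"
    by (rule measurable_restrict_space1) simp
  then have m: "sgn \<in> measurable (scale_measure (ennreal (real DIM('a))) (restrict_space lborel (cball (0::'a) 1 - {0}))) borel"
    by (simp cong: measurable_cong_sets)
  have "sgn -` A \<inter> (cball (0::'a) 1 - {0}) = {x. norm x \<le> 1 \<and> x \<noteq> 0 \<and> sgn x \<in> A}"
    by (auto simp: dist_norm)
  moreover have "emeasure (restrict_space lborel (cball (0::'a) 1 - {0})) {x. norm x \<le> 1 \<and> x \<noteq> 0 \<and> sgn x \<in> A}
      = emeasure lborel {x. norm x \<le> 1 \<and> x \<noteq> 0 \<and> sgn x \<in> A}"
    by (rule emeasure_restrict_space) auto
  ultimately show ?thesis unfolding sphere_measure_def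
    by (subst emeasure_distr[OF m]) (auto simp: space_scale_measure space_restrict_space)
qed

lemma finite_sphere_measure: "finite_measure (sphere_measure :: 'a::euclidean_space measure)"
proof -
  have "emeasure (sphere_measure_at 1 :: 'a measure) UNIV = emeasure (sphere_measure :: 'a measure) UNIV"
    by (simp add: sphere_measure_at_def emeasure_distr)
  moreover have "emeasure (sphere_measure_at 1 :: 'a measure) UNIV \<noteq> \<infinity>"
    using finite_measure.emeasure_finite[OF finite_sphere_measure_at[of 1], of "UNIV :: 'a set"] by simp
  ultimately show ?thesis
    by (intro finite_measureI) (simp add: space_sphere_measure)
qed

text \<open>\<open>sgn\<close> commutes with R and R preserves the norm, so R only permutes the
  truncated cones whose Lebesgue measure defines the sphere measure.\<close>

lemma distr_sphere_measure_orthogonal: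
  fixes R :: "'a::euclidean_space \<Rightarrow> 'a"
  assumes R: "orthogonal_transformation R"
  shows "distr sphere_measure borel R = sphere_measure"
proof (rule measure_eqI)
  fix A assume "A \<in> sets (distr (sphere_measure :: 'a measure) borel R)"
  then have A[measurable]: "A \<in> sets borel" by simp
  have lin: "linear R" using R by (rule orthogonal_transformation_linear)
  note Rm[measurable] = borel_measurable_orthogonal_transformation[OF R]
  have nR: "norm (R x) = norm x" for x using R by (rule orthogonal_transformation_norm)
  have R0: "R x = 0 \<longleftrightarrow> x = 0" for x using nR[of x] by (metis norm_eq_zero)
  have sg: "sgn (R x) = R (sgn x)" for x
    by (simp add: sgn_div_norm nR linear_cmul[OF lin])
  let ?B = "{x. norm x \<le> 1 \<and> x \<noteq> 0 \<and> sgn x \<in> A}"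
  have "emeasure (distr sphere_measure borel R) A = emeasure sphere_measure (R -` A)"
    by (simp add: emeasure_distr)
  also have "\<dots> = real DIM('a) * emeasure lborel {x. norm x \<le> 1 \<and> x \<noteq> 0 \<and> sgn x \<in> R -` A}"
    by (rule emeasure_sphere_measure) (use measurable_sets[OF Rm A] in simp)
  also have "emeasure lborel {x. norm x \<le> 1 \<and> x \<noteq> 0 \<and> sgn x \<in> R -` A} = (\<integral>\<^sup>+x. indicator ?B (R x) \<partial>lborel)"
  proof -
    have "{x. norm x \<le> 1 \<and> x \<noteq> 0 \<and> sgn x \<in> R -` A} \<in> sets lborel"
      using measurable_sets[OF Rm A] by measurable
    from nn_integral_indicator[OF this, symmetric] show ?thesis
      by (auto intro!: nn_integral_cong simp: indicator_def nR R0 sg)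
  qed
  also have "\<dots> = (\<integral>\<^sup>+x. indicator ?B x \<partial>lborel)"
    by (rule nn_integral_lborel_orthogonal[OF R]) measurable
  also have "\<dots> = emeasure lborel ?B" by (simp)
  finally show "emeasure (distr sphere_measure borel R) A = emeasure sphere_measure A"
    by (simp add: emeasure_sphere_measure)
qed simp

lemma integral_sphere_measure_orthogonal:
  fixes R :: "'a::euclidean_space \<Rightarrow> 'a" and f :: "'a \<Rightarrow> 'b::{banach, second_countable_topology}"
  assumes R: "orthogonal_transformation R" and [measurable]: "f \<in> borel_measurable borel"
  shows "(\<integral>x. f (R x) \<partial>sphere_measure) = (\<integral>x. f x \<partial>sphere_measure)"
proof -
  note Rm[measurable] = borel_measurable_orthogonal_transformation[OF R]
  show ?thesis
    by (subst (2) distr_sphere_measure_orthogonal[OF R, symmetric]) (simp add: integral_distr)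
qed

lemma AE_sphere_measure: "AE x in sphere_measure. norm (x :: 'a::euclidean_space) = 1"
proof (rule AE_I)
  show "{x \<in> space sphere_measure. norm x \<noteq> 1} \<subseteq> {x::'a. norm x \<noteq> 1}" by auto
  have *: "{x::'a. norm x \<le> 1 \<and> x \<noteq> 0 \<and> sgn x \<in> {x. norm x \<noteq> 1}} = {}"
    by (auto simp: norm_sgn)
  show "emeasure sphere_measure {x::'a. norm x \<noteq> 1} = 0"
    by (subst emeasure_sphere_measure, simp, simp only: * emeasure_empty mult_zero_right)
qed simp

text \<open>Dominated convergence for difference quotients, which the mean value inequality bounds
  by \<open>B\<close>. The bound on the derivative is asked only almost everywhere because points of
  the sphere measure have norm 1 only almost everywhere.\<close>

lemma has_real_derivative_integral:
  fixes g g' :: "real \<Rightarrow> 'a \<Rightarrow> real"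
  assumes M: "finite_measure M"
    and int: "\<And>t. integrable M (g t)"
    and m: "g' t0 \<in> borel_measurable M"
    and der: "\<And>t x. ((\<lambda>t. g t x) has_real_derivative g' t x) (at t)"
    and bd: "AE x in M. \<forall>t. \<bar>g' t x\<bar> \<le> B"
  shows "((\<lambda>t. \<integral>x. g t x \<partial>M) has_real_derivative (\<integral>x. g' t0 x \<partial>M)) (at t0)"
proof -
  interpret finite_measure M by fact
  have "((\<lambda>h. ((\<integral>x. g (t0 + h) x \<partial>M) - (\<integral>x. g t0 x \<partial>M)) / h) \<longlongrightarrow> (\<integral>x. g' t0 x \<partial>M)) (at 0)"
    unfolding tendsto_at_iff_sequentially
  proof (intro allI impI)
    fix X :: "nat \<Rightarrow> real" assume X: "\<forall>i. X i \<in> UNIV - {0}" "X \<longlonglongrightarrow> 0"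
    have "(\<lambda>i. \<integral>x. (g (t0 + X i) x - g t0 x) / X i \<partial>M) \<longlonglongrightarrow> (\<integral>x. g' t0 x \<partial>M)"
    proof (rule integral_dominated_convergence[where w="\<lambda>_. B"])
      show "AE x in M. (\<lambda>i. (g (t0 + X i) x - g t0 x) / X i) \<longlonglongrightarrow> g' t0 x"
      proof (rule AE_I2)
        fix x
        have "((\<lambda>h. (g (t0 + h) x - g t0 x) / h) \<longlongrightarrow> g' t0 x) (at 0)"
          using der[of x t0] by (simp add: DERIV_def)
        then show "(\<lambda>i. (g (t0 + X i) x - g t0 x) / X i) \<longlonglongrightarrow> g' t0 x"
          using X unfolding tendsto_at_iff_sequentially by (auto simp: o_def)
      qed
      show "AE x in M. norm ((g (t0 + X i) x - g t0 x) / X i) \<le> B" for i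
        using bd
      proof eventually_elim
        case (elim x)
        have "norm (g (t0 + X i) x - g t0 x) \<le> B * norm (t0 + X i - t0)"
          by (rule field_differentiable_bound[of UNIV "\<lambda>t. g t x" "\<lambda>t. g' t x"]) (use elim der in auto)
        then show ?case using X by (auto simp: divide_simps)
      qed
    qed (use int m in \<open>auto intro: borel_measurable_integrable\<close>)
    then show "((\<lambda>h. ((\<integral>x. g (t0 + h) x \<partial>M) - (\<integral>x. g t0 x \<partial>M)) / h) \<circ> X) \<longlonglongrightarrow> (\<integral>x. g' t0 x \<partial>M)"
      using int by (simp add: o_def)
  qed
  then show ?thesis by (simp add: DERIV_def)
qed

text \<open>Rotation by \<theta> in the plane of \<open>e\<close> and \<open>e'\<close>, the
  identity on the orthogonal complement. Writing it as \<open>x\<close> plus a correction avoids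
  choosing a basis of the complement.\<close>

lemma orthogonal_transformation_rotation:
  fixes e e' :: "'a::euclidean_space"
  assumes e: "norm e = 1" "norm e' = 1" "e \<bullet> e' = 0"
  shows "orthogonal_transformation (\<lambda>x. x + ((cos \<theta> - 1) * (e \<bullet> x) - sin \<theta> * (e' \<bullet> x)) *\<^sub>R e
                                       + (sin \<theta> * (e \<bullet> x) + (cos \<theta> - 1) * (e' \<bullet> x)) *\<^sub>R e')"
proof -
  have [simp]: "e \<bullet> e = 1" "e' \<bullet> e' = 1" "e' \<bullet> e = 0" "e \<bullet> e' = 0"
    using e by (simp_all add: norm_eq_1 inner_commute)
  show ?thesis
    unfolding orthogonal_transformation_def
  proof (intro conjI allI)
    show "linear (\<lambda>x. x + ((cos \<theta> - 1) * (e \<bullet> x) - sin \<theta> * (e' \<bullet> x)) *\<^sub>R e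
                        + (sin \<theta> * (e \<bullet> x) + (cos \<theta> - 1) * (e' \<bullet> x)) *\<^sub>R e')"
      by (rule linearI) (simp_all add: algebra_simps inner_add_right)
  next
    fix v w
    define a where "a = e \<bullet> v" define b where "b = e' \<bullet> v"
    define c where "c = e \<bullet> w" define d where "d = e' \<bullet> w"
    define C where "C = cos \<theta>" define S where "S = sin \<theta>"
    have [simp]: "v \<bullet> e = a" "v \<bullet> e' = b" "e \<bullet> w = c" "e' \<bullet> w = d" "e \<bullet> v = a" "e' \<bullet> v = b"
      by (simp_all add: a_def b_def c_def d_def inner_commute)
    have "C\<^sup>2 + S\<^sup>2 = 1" by (simp add: C_def S_def)
    then have "v \<bullet> w + ((C - 1) * c - S * d) * a + (S * c + (C - 1) * d) * b
       + ((C - 1) * a - S * b) * (c + ((C - 1) * c - S * d))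
       + (S * a + (C - 1) * b) * (d + (S * c + (C - 1) * d)) = v \<bullet> w"
      by algebra
    then show "(v + ((cos \<theta> - 1) * (e \<bullet> v) - sin \<theta> * (e' \<bullet> v)) *\<^sub>R e
                        + (sin \<theta> * (e \<bullet> v) + (cos \<theta> - 1) * (e' \<bullet> v)) *\<^sub>R e')
      \<bullet> (w + ((cos \<theta> - 1) * (e \<bullet> w) - sin \<theta> * (e' \<bullet> w)) *\<^sub>R e
                        + (sin \<theta> * (e \<bullet> w) + (cos \<theta> - 1) * (e' \<bullet> w)) *\<^sub>R e') = v \<bullet> w"
      unfolding C_def[symmetric] S_def[symmetric]
      by (simp add: inner_add_left inner_add_right algebra_simps)
  qed
qed

lemma integrable_sphere_measure_bounded:
  fixes f :: "'a::euclidean_space \<Rightarrow> 'b::{banach, second_countable_topology}"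
  assumes "f \<in> borel_measurable borel" "\<And>x. norm x = 1 \<Longrightarrow> norm (f x) \<le> B"
  shows "integrable sphere_measure f"
proof -
  interpret finite_measure "sphere_measure :: 'a measure" by (rule finite_sphere_measure)
  show ?thesis
    by (rule integrable_const_bound[where B=B]) (use AE_sphere_measure assms in auto)
qed

text \<open>The derivative at angle 0 of the statement that rotations in the plane of e and e' preserve the
  integral of (e' \<bullet> w) sin (r (e \<bullet> w)).\<close>

lemma sphere_measure_rotation_derivative:
  fixes e e' :: "'a::euclidean_space"
  assumes e: "norm e = 1" "norm e' = 1" "e \<bullet> e' = 0"
  shows "(\<integral>w. (e \<bullet> w) * sin (r * (e \<bullet> w)) - r * (e' \<bullet> w)\<^sup>2 * cos (r * (e \<bullet> w)) \<partial>sphere_measure) = 0"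
proof -
  have [simp]: "e \<bullet> e = 1" "e' \<bullet> e' = 1" "e' \<bullet> e = 0" "e \<bullet> e' = 0"
    using e by (simp_all add: norm_eq_1 inner_commute)
  \<comment> \<open>These are the coordinates along \<open>e\<close> and \<open>e'\<close> of the
    rotated point, so \<open>g \<theta>\<close> below is \<open>g 0\<close> composed with the
    rotation. In \<theta> the derivative of \<open>?u\<close> is minus \<open>?v\<close>, and that
    of \<open>?v\<close> is \<open>?u\<close>.\<close>
  let ?u = "\<lambda>\<theta> w. cos \<theta> * (e \<bullet> w) - sin \<theta> * (e' \<bullet> w)" and ?v = "\<lambda>\<theta> w. sin \<theta> * (e \<bullet> w) + cos \<theta> * (e' \<bullet> w)"
  define g where "g = (\<lambda>\<theta> w. ?v \<theta> w * sin (r * ?u \<theta> w))"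
  define g' where "g' = (\<lambda>\<theta> w. ?u \<theta> w * sin (r * ?u \<theta> w)
       - r * (?v \<theta> w)\<^sup>2 * cos (r * ?u \<theta> w))"
  have bd: "\<bar>e \<bullet> w\<bar> \<le> 1" "\<bar>e' \<bullet> w\<bar> \<le> 1" if "norm w = 1" for w
    using Cauchy_Schwarz_ineq2[of e w] Cauchy_Schwarz_ineq2[of e' w] e that by auto
  have bd2: "\<bar>?u \<theta> w\<bar> \<le> 2" "\<bar>?v \<theta> w\<bar> \<le> 2"
    if "norm w = 1" for w \<theta>
  proof -
    have *: "\<bar>x * y\<bar> \<le> 1" if "\<bar>x\<bar> \<le> 1" "\<bar>y\<bar> \<le> 1" for x y :: real
      using that by (simp add: abs_mult mult_le_one)
    show "\<bar>?u \<theta> w\<bar> \<le> 2" "\<bar>?v \<theta> w\<bar> \<le> 2"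
      using *[of "cos \<theta>" "e \<bullet> w"] *[of "cos \<theta>" "e' \<bullet> w"] *[of "sin \<theta>" "e \<bullet> w"] *[of "sin \<theta>" "e' \<bullet> w"] bd[OF that]
      by auto
  qed
  have bd3: "\<bar>g \<theta> w\<bar> \<le> 2" "\<bar>g' \<theta> w\<bar> \<le> 2 + \<bar>r\<bar> * 4" if "norm w = 1" for w \<theta>
  proof -
    have *: "\<bar>x * y\<bar> \<le> B" if "\<bar>x\<bar> \<le> B" "\<bar>y\<bar> \<le> 1" for x y B :: real
      using mult_mono[OF that] that by (simp add: abs_mult)
    show "\<bar>g \<theta> w\<bar> \<le> 2" unfolding g_def by (rule *) (use bd2[OF that] in auto)
    have "\<bar>?u \<theta> w * sin (r * ?u \<theta> w)\<bar> \<le> 2"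
      by (rule *) (use bd2[OF that] in auto)
    moreover have "\<bar>r * (?v \<theta> w)\<^sup>2 * cos (r * ?u \<theta> w)\<bar> \<le> \<bar>r\<bar> * 4"
    proof (rule *)
      have "\<bar>?v \<theta> w\<bar>\<^sup>2 \<le> 2\<^sup>2"
        by (rule power_mono) (use bd2[OF that] in auto)
      then show "\<bar>r * (?v \<theta> w)\<^sup>2\<bar> \<le> \<bar>r\<bar> * 4"
        by (auto simp: abs_mult intro!: mult_left_mono)
    qed auto
    ultimately show "\<bar>g' \<theta> w\<bar> \<le> 2 + \<bar>r\<bar> * 4" unfolding g'_def by linarith
  qed
  have gm[measurable]: "g \<theta> \<in> borel_measurable borel" "g' \<theta> \<in> borel_measurable borel" for \<theta>
    by (simp_all add: g_def g'_def)
  have der: "((\<lambda>\<theta>. \<integral>w. g \<theta> w \<partial>sphere_measure) has_real_derivative (\<integral>w. g' 0 w \<partial>sphere_measure)) (at 0)"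
  proof (rule has_real_derivative_integral[OF finite_sphere_measure])
    show "integrable sphere_measure (g \<theta>)" for \<theta>
      by (rule integrable_sphere_measure_bounded) (use bd3 in auto)
    show "((\<lambda>\<theta>. g \<theta> w) has_real_derivative g' \<theta> w) (at \<theta>)" for \<theta> w
      unfolding g_def g'_def
      by (auto intro!: derivative_eq_intros simp: algebra_simps power2_eq_square)
    show "AE w in sphere_measure. \<forall>\<theta>. \<bar>g' \<theta> w\<bar> \<le> 2 + \<bar>r\<bar> * 4"
      using AE_sphere_measure by eventually_elim (use bd3 in auto)
  qed simp
  have const: "(\<integral>w. g \<theta> w \<partial>sphere_measure) = (\<integral>w. g 0 w \<partial>sphere_measure)" for \<theta>
    by (subst integral_sphere_measure_orthogonal[OF orthogonal_transformation_rotation[OF e, of \<theta>], of "g 0", symmetric])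
       (simp_all add: g_def inner_add_right algebra_simps)
  have "(\<integral>w. g' 0 w \<partial>sphere_measure) = 0"
    using der DERIV_unique[OF _ DERIV_const] by (subst (asm) const) blast
  then show ?thesis by (simp add: g'_def)
qed

section \<open>Decay of the Fourier transform of the sphere\<close>

text \<open>The Bessel-type equation r F'' + (d - 1) F' + r F = 0 for the radial profile of the
  Fourier transform. For each unit b orthogonal to \<open>e\<close>, the rotation identity says that
  - F' is r times the integral of (b \<bullet> w)^2 cos (r (e \<bullet> w)). Summing such integrals
  over an orthonormal basis through \<open>e\<close> recovers F because |w| = 1, and the term of
  \<open>e\<close> itself is - F''.\<close>

lemma sphere_measure_fourier_ode:
  fixes e :: "'a::euclidean_space"
  assumes e: "norm e = 1"
  defines "F \<equiv> \<lambda>r. \<integral>w. cos (r * (e \<bullet> w)) \<partial>sphere_measure"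
  obtains F' F'' where
    "\<And>r. (F has_real_derivative F' r) (at r)" "\<And>r. (F' has_real_derivative F'' r) (at r)"
    "\<And>r. real (DIM('a) - 1) * F' r + r * (F r + F'' r) = 0"
    "\<And>r. \<bar>F r\<bar> \<le> measure (sphere_measure :: 'a measure) UNIV"
    "\<And>r. \<bar>F' r\<bar> \<le> measure (sphere_measure :: 'a measure) UNIV"
proof
  let ?\<sigma> = "sphere_measure :: 'a measure"
  interpret finite_measure ?\<sigma> by (rule finite_sphere_measure)
  define F' where "F' = (\<lambda>r. \<integral>w. - (e \<bullet> w) * sin (r * (e \<bullet> w)) \<partial>?\<sigma>)"
  define F'' where "F'' = (\<lambda>r. \<integral>w. - (e \<bullet> w)\<^sup>2 * cos (r * (e \<bullet> w)) \<partial>?\<sigma>)"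
  have bd: "\<bar>e \<bullet> w\<bar> \<le> 1" if "norm w = 1" for w
    using Cauchy_Schwarz_ineq2[of e w] e that by auto
  have bd1: "\<bar>(e \<bullet> w) * sin (r * (e \<bullet> w))\<bar> \<le> 1" if "norm w = 1" for w r
    using bd[OF that] by (simp add: abs_mult mult_le_one)
  have bd2: "\<bar>(e \<bullet> w)\<^sup>2 * cos (r * (e \<bullet> w))\<bar> \<le> 1" if "norm w = 1" for w r
    using bd[OF that] by (simp add: abs_mult mult_le_one abs_square_le_1)
  have i0: "integrable ?\<sigma> (\<lambda>w. cos (r * (e \<bullet> w)))" for r
    by (rule integrable_sphere_measure_bounded[of _ 1]) auto
  have i1: "integrable ?\<sigma> (\<lambda>w. (e \<bullet> w) * sin (r * (e \<bullet> w)))" for r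
    by (rule integrable_sphere_measure_bounded[of _ 1]) (use bd1 in auto)
  have i2: "integrable ?\<sigma> (\<lambda>w. (e \<bullet> w)\<^sup>2 * cos (r * (e \<bullet> w)))" for r
    by (rule integrable_sphere_measure_bounded[of _ 1]) (use bd2 in auto)
  show "(F has_real_derivative F' r) (at r)" for r
    unfolding F_def F'_def
  proof (rule has_real_derivative_integral[OF finite_sphere_measure])
    show "AE w in ?\<sigma>. \<forall>r. \<bar>- (e \<bullet> w) * sin (r * (e \<bullet> w))\<bar> \<le> 1"
      using AE_sphere_measure by eventually_elim (use bd1 in auto)
  qed (auto intro!: derivative_eq_intros i0)
  show "(F' has_real_derivative F'' r) (at r)" for r
    unfolding F''_def F'_def
  proof (rule has_real_derivative_integral[OF finite_sphere_measure])
    show "AE w in ?\<sigma>. \<forall>r. \<bar>- (e \<bullet> w)\<^sup>2 * cos (r * (e \<bullet> w))\<bar> \<le> 1"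
      using AE_sphere_measure by eventually_elim (use bd2 in auto)
    show "integrable ?\<sigma> (\<lambda>w. - (e \<bullet> w) * sin (r * (e \<bullet> w)))" for r using i1[of r] by simp
  qed (auto intro!: derivative_eq_intros simp: power2_eq_square)
  obtain S where S: "e \<in> S" "pairwise orthogonal S" "\<And>x. x \<in> S \<Longrightarrow> norm x = 1"
    "independent S" "card S = DIM('a)" "span S = UNIV"
    using vector_in_orthonormal_basis[OF e] by metis
  have fS: "finite S" using S(4) by (rule independent_imp_finite)
  have sq: "(\<Sum>b\<in>S. (b \<bullet> w)\<^sup>2) = (norm w)\<^sup>2" for w :: 'a
  proof -
    have "w = (\<Sum>b\<in>S. (b \<bullet> w) *\<^sub>R b)"
      using orthonormal_basis_expand[OF S(2,3) _ fS, of w] S(6) by (simp add: inner_commute)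
    then have "w \<bullet> w = (\<Sum>b\<in>S. (b \<bullet> w) *\<^sub>R b) \<bullet> w" by simp
    also have "\<dots> = (\<Sum>b\<in>S. (b \<bullet> w)\<^sup>2)" by (simp add: inner_sum_left power2_eq_square)
    finally show ?thesis by (simp add: power2_norm_eq_inner)
  qed
  show "real (DIM('a) - 1) * F' r + r * (F r + F'' r) = 0" for r
  proof -
    let ?I = "\<lambda>b. (\<integral>w. (b \<bullet> w)\<^sup>2 * cos (r * (e \<bullet> w)) \<partial>?\<sigma>)"
    have iS: "integrable ?\<sigma> (\<lambda>w. (b \<bullet> w)\<^sup>2 * cos (r * (e \<bullet> w)))" if "b \<in> S" for b
    proof (rule integrable_sphere_measure_bounded[of _ 1])
      fix w :: 'a assume "norm w = 1"
      then have "\<bar>b \<bullet> w\<bar> \<le> 1" using Cauchy_Schwarz_ineq2[of b w] S(3)[OF that] by auto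
      then show "norm ((b \<bullet> w)\<^sup>2 * cos (r * (e \<bullet> w))) \<le> 1"
        by (simp add: abs_mult mult_le_one abs_square_le_1)
    qed auto
    have one: "- F' r = r * ?I b" if b: "b \<in> S - {e}" for b
    proof -
      have "e \<bullet> b = 0" using S(1,2) b by (auto simp: pairwise_def orthogonal_def)
      then have "(\<integral>w. (e \<bullet> w) * sin (r * (e \<bullet> w)) - r * (b \<bullet> w)\<^sup>2 * cos (r * (e \<bullet> w)) \<partial>?\<sigma>) = 0"
        using b S(3) e by (intro sphere_measure_rotation_derivative) auto
      moreover have "integrable ?\<sigma> (\<lambda>w. r * ((b \<bullet> w)\<^sup>2 * cos (r * (e \<bullet> w))))"
        by (intro integrable_mult_right iS) (use b in auto)
      ultimately show ?thesis
        using i1[of r] by (simp add: F'_def mult.assoc)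
    qed
    have "F r = (\<Sum>b\<in>S. ?I b)"
    proof -
      have "F r = (\<integral>w. (\<Sum>b\<in>S. (b \<bullet> w)\<^sup>2 * cos (r * (e \<bullet> w))) \<partial>?\<sigma>)"
        unfolding F_def
      proof (rule integral_cong_AE)
        show "AE w in ?\<sigma>. cos (r * (e \<bullet> w)) = (\<Sum>b\<in>S. (b \<bullet> w)\<^sup>2 * cos (r * (e \<bullet> w)))"
          using AE_sphere_measure by eventually_elim (simp add: sum_distrib_right[symmetric] sq)
      qed simp_all
      also have "\<dots> = (\<Sum>b\<in>S. ?I b)" using iS by simp
      finally show ?thesis .
    qed
    also have "\<dots> = ?I e + (\<Sum>b\<in>S - {e}. ?I b)"
      using S(1) fS by (simp add: sum.remove)
    finally have "r * F r = r * ?I e + (\<Sum>b\<in>S - {e}. r * ?I b)"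
      by (simp add: sum_distrib_left distrib_left)
    also have "(\<Sum>b\<in>S - {e}. r * ?I b) = (\<Sum>b\<in>S - {e}. - F' r)"
      using one by (intro sum.cong) auto
    also have "\<dots> = real (DIM('a) - 1) * (- F' r)"
      using S(1,5) fS by (simp add: card_Diff_singleton)
    also have "?I e = - F'' r" by (simp add: F''_def)
    finally show ?thesis by (simp add: algebra_simps)
  qed
  show "\<bar>F r\<bar> \<le> measure ?\<sigma> UNIV" for r
  proof -
    have "\<bar>F r\<bar> \<le> (\<integral>w. 1 \<partial>?\<sigma>)"
      unfolding F_def by (rule order_trans[OF integral_abs_bound integral_mono]) (use i0 in auto)
    then show ?thesis by simp
  qed
  show "\<bar>F' r\<bar> \<le> measure ?\<sigma> UNIV" for r
  proof -
    have "\<bar>F' r\<bar> \<le> (\<integral>w. \<bar>- (e \<bullet> w) * sin (r * (e \<bullet> w))\<bar> \<partial>?\<sigma>)"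
      unfolding F'_def by (rule integral_abs_bound)
    also have "\<dots> \<le> (\<integral>w. 1 \<partial>?\<sigma>)"
    proof (rule integral_mono_AE)
      show "AE w in ?\<sigma>. \<bar>- (e \<bullet> w) * sin (r * (e \<bullet> w))\<bar> \<le> 1"
        using AE_sphere_measure by eventually_elim (use bd1 in auto)
      show "integrable ?\<sigma> (\<lambda>w. \<bar>- (e \<bullet> w) * sin (r * (e \<bullet> w))\<bar>)"
        using i1[of r] by (intro integrable_abs) simp
    qed simp
    finally show ?thesis by simp
  qed
qed

text \<open>The natural energy r^n (F^2 + F'^2) is not monotone: its derivative is n r^(n-1) (F^2 -
  F'^2), of the same order as the energy divided by r. Adding a cross term in F F' cancels this and
  leaves an error smaller by a further factor r, which is integrable at infinity. For r at most n
  the bound is trivial.\<close>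

lemma bessel_ode_decay:
  fixes F F' F'' :: "real \<Rightarrow> real" and n :: nat and m :: real
  assumes F: "\<And>r. (F has_real_derivative F' r) (at r)"
    and F': "\<And>r. (F' has_real_derivative F'' r) (at r)"
    and ode: "\<And>r. real n * F' r + r * (F r + F'' r) = 0"
    and bd: "\<And>r. \<bar>F r\<bar> \<le> m" "\<And>r. \<bar>F' r\<bar> \<le> m"
    and n: "n \<ge> 1" and r: "r \<ge> 0"
  shows "r ^ n * (F r)\<^sup>2 \<le> 6 * exp 1 * real n ^ n * m\<^sup>2"
proof -
  have sq: "(F r)\<^sup>2 \<le> m\<^sup>2" "(F' r)\<^sup>2 \<le> m\<^sup>2" for r
    using power_mono[OF bd(1)[of r], of 2] power_mono[OF bd(2)[of r], of 2] by simp_all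
  show ?thesis
  proof (cases "r \<le> real n")
    case True
    have "r ^ n * (F r)\<^sup>2 \<le> real n ^ n * m\<^sup>2"
      using True r sq(1)[of r] by (intro mult_mono power_mono[OF True]) auto
    also have "\<dots> \<le> (6 * exp 1) * (real n ^ n * m\<^sup>2)"
      using mult_right_mono[of 1 "6 * exp (1::real)" "real n ^ n * m\<^sup>2"] exp_ge_add_one_self[of 1] by simp
    finally show ?thesis by (simp add: mult.assoc)
  next
    case False
    then have rn: "r \<ge> real n" by simp
    have ar1: "A \<le> 2 * (A + B)" if "\<bar>B\<bar> \<le> A / 2" for A B :: real
      using that by (simp add: abs_le_iff)
    have ar2: "A + B \<le> 3 / 2 * A" if "\<bar>B\<bar> \<le> A / 2" for A B :: real
      using that by (simp add: abs_le_iff)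
    \<comment> \<open>By the equation the derivative of \<open>E\<close> is - n r^(n-2) F F'. From r
      = n on, the cross term is at most half of the main term, so \<open>E\<close> is comparable
      with the natural energy.\<close>
    define E where "E = (\<lambda>r. r ^ n * ((F r)\<^sup>2 + (F' r)\<^sup>2) + real n * r ^ (n - 1) * F r * F' r)"
    have half: "r ^ n * ((F r)\<^sup>2 + (F' r)\<^sup>2) \<le> 2 * E r" "\<bar>real n * r ^ (n-1) * F r * F' r\<bar> \<le> r ^ n * ((F r)\<^sup>2 + (F' r)\<^sup>2) / 2"
      if "r \<ge> real n" for r
    proof -
      have r0: "r > 0" using that n by linarith
      have "2 * \<bar>F r * F' r\<bar> \<le> (F r)\<^sup>2 + (F' r)\<^sup>2"
        using sum_squares_bound[of "\<bar>F r\<bar>" "\<bar>F' r\<bar>"] by (simp add: abs_mult)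
      then have "(real n * r ^ (n-1)) * \<bar>F r * F' r\<bar> \<le> (r * r ^ (n-1)) * (((F r)\<^sup>2 + (F' r)\<^sup>2) / 2)"
        using that r0 by (intro mult_mono) auto
      also have "r * r ^ (n-1) = r ^ n" using n by (simp add: power_eq_if)
      also have "(real n * r ^ (n-1)) * \<bar>F r * F' r\<bar> = \<bar>real n * r ^ (n-1) * F r * F' r\<bar>"
        using r0 by (simp add: abs_mult mult.assoc)
      finally show "\<bar>real n * r ^ (n-1) * F r * F' r\<bar> \<le> r ^ n * ((F r)\<^sup>2 + (F' r)\<^sup>2) / 2"
        by simp
      then show "r ^ n * ((F r)\<^sup>2 + (F' r)\<^sup>2) \<le> 2 * E r" unfolding E_def by (rule ar1)
    qed
    \<comment> \<open>The logarithmic derivative of \<open>E\<close> is at most n / r^2, and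
      \<open>exp (real n / r)\<close> is the integrating factor for exactly that rate.\<close>
    define \<Phi> where "\<Phi> = (\<lambda>r. exp (real n / r) * E r)"
    have "\<Phi> r \<le> \<Phi> (real n)"
    proof (rule DERIV_nonpos_imp_nonincreasing[OF rn])
      fix x assume x: "real n \<le> x" "x \<le> r"
      have x0: "x > 0" using x n by linarith
      have pw: "x ^ n = x * x ^ (n-1)" using n by (simp add: power_eq_if)
      \<comment> \<open>The derivative of x^(n-1). Only \<open>Q * x\<close> is ever used, which is
        correct also for n = 1, where the truncated exponent n - 1 - 1 is harmless because its
        coefficient is 0.\<close>
      define Q where "Q = real (n - 1) * x ^ (n - 1 - 1)"
      have Q: "Q * x = real (n-1) * x ^ (n-1)"
        by (cases "n = 1") (auto simp: Q_def power_eq_if)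
      have nn: "real (n-1) = real n - 1" using n by simp
      define D where "D = real n * x ^ (n-1) * ((F x)\<^sup>2 + (F' x)\<^sup>2) + x ^ n * (2 * F x * F' x + 2 * F' x * F'' x)
          + real n * (Q * F x * F' x + x ^ (n-1) * F' x * F' x + x ^ (n-1) * F x * F'' x)"
      have dE: "(E has_real_derivative D) (at x)"
        unfolding E_def D_def Q_def
        by (auto intro!: derivative_eq_intros F F' simp: algebra_simps power2_eq_square)
      have ode': "x * F'' x = - real n * F' x - x * F x" using ode[of x] by (simp add: algebra_simps)
      have "x * D = - real n * x ^ (n-1) * F x * F' x"
      proof -
        have "x * D = real n * x ^ (n-1) * x * ((F x)\<^sup>2 + (F' x)\<^sup>2) + x ^ n * (2 * x * F x * F' x + 2 * F' x * (x * F'' x))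
          + real n * ((Q * x) * F x * F' x + x ^ (n-1) * x * F' x * F' x + x ^ (n-1) * F x * (x * F'' x))"
          by (simp add: D_def algebra_simps)
        also have "\<dots> = - real n * x ^ (n-1) * F x * F' x"
          unfolding ode' Q pw nn by (simp add: algebra_simps power2_eq_square)
        finally show ?thesis .
      qed
      then have D: "D \<le> real n / x\<^sup>2 * E x"
      proof -
        have "2 * \<bar>F x * F' x\<bar> \<le> (F x)\<^sup>2 + (F' x)\<^sup>2"
          using sum_squares_bound[of "\<bar>F x\<bar>" "\<bar>F' x\<bar>"] by (simp add: abs_mult)
        then have "x ^ n * (- (F x * F' x)) \<le> x ^ n * (((F x)\<^sup>2 + (F' x)\<^sup>2) / 2)"
          using x0 by (intro mult_left_mono) auto
        also have "\<dots> \<le> E x" using half(1)[OF x(1)] by simp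
        finally have "real n * (x ^ n * (- (F x * F' x))) \<le> real n * E x"
          by (intro mult_left_mono) auto
        moreover have "x\<^sup>2 * D = real n * (x ^ n * (- (F x * F' x)))"
          using arg_cong[OF \<open>x * D = _\<close>, of "(*) x"] by (simp add: pw power2_eq_square mult_ac)
        ultimately show ?thesis using x0 by (simp add: field_simps)
      qed
      have "(\<Phi> has_real_derivative exp (real n / x) * (D - real n / x\<^sup>2 * E x)) (at x)"
        unfolding \<Phi>_def using x0
        by (auto intro!: derivative_eq_intros dE simp: field_simps power2_eq_square)
      moreover have "exp (real n / x) * (D - real n / x\<^sup>2 * E x) \<le> 0"
        using D by (simp add: mult_le_0_iff)
      ultimately show "\<exists>y. (\<Phi> has_real_derivative y) (at x) \<and> y \<le> 0" by blast
    qed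
    moreover have "E r \<le> \<Phi> r"
    proof -
      have "0 \<le> E r" using half(1)[OF rn] r by (smt (verit) mult_nonneg_nonneg zero_le_power zero_le_power2)
      moreover have "1 \<le> exp (real n / r)" using r by simp
      ultimately show ?thesis unfolding \<Phi>_def using mult_right_mono[of 1 "exp (real n / r)" "E r"] by simp
    qed
    \<comment> \<open>Origin of the constant: at r = n the energy is at most 3/2 times n^n times 2
      m^2, the integrating factor there is e, and passing from \<open>E\<close> back to F^2 costs a
      factor 2.\<close>
    moreover have "\<Phi> (real n) \<le> exp 1 * (3 * real n ^ n * m\<^sup>2)"
    proof -
      have *: "real n ^ n * ((F n)\<^sup>2 + (F' n)\<^sup>2) \<le> real n ^ n * (2 * m\<^sup>2)"
        using sq[of "real n"] by (intro mult_left_mono) auto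
      have "E (real n) \<le> 3 / 2 * (real n ^ n * ((F n)\<^sup>2 + (F' n)\<^sup>2))"
        using ar2[OF half(2)[of "real n"]] unfolding E_def by simp
      then have "E (real n) \<le> 3 * real n ^ n * m\<^sup>2" using * by linarith
      then show ?thesis using n by (simp add: \<Phi>_def)
    qed
    ultimately have "E r \<le> exp 1 * (3 * real n ^ n * m\<^sup>2)" by linarith
    moreover have "r ^ n * (F r)\<^sup>2 \<le> r ^ n * ((F r)\<^sup>2 + (F' r)\<^sup>2)"
      using r by (intro mult_left_mono) auto
    ultimately show ?thesis using half(1)[OF rn] by linarith
  qed
qed

text \<open>Antipodal symmetry kills the sine part.\<close>

lemma integral_sphere_measure_cis:
  fixes \<xi> e :: "'a::euclidean_space"
  shows "(\<integral>w. cis (\<xi> \<bullet> w) \<partial>sphere_measure) = complex_of_real (\<integral>w. cos (\<xi> \<bullet> w) \<partial>sphere_measure)"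
proof -
  let ?\<sigma> = "sphere_measure :: 'a measure"
  have i: "integrable ?\<sigma> (\<lambda>w. cos (\<xi> \<bullet> w))" "integrable ?\<sigma> (\<lambda>w. sin (\<xi> \<bullet> w))"
    by (rule integrable_sphere_measure_bounded[of _ 1]; simp)+
  have "(\<integral>w. sin (\<xi> \<bullet> w) \<partial>?\<sigma>) = (\<integral>w. sin (\<xi> \<bullet> (- w)) \<partial>?\<sigma>)"
    by (rule integral_sphere_measure_orthogonal[symmetric]) (simp_all add: orthogonal_transformation_neg)
  then have "(\<integral>w. sin (\<xi> \<bullet> w) \<partial>?\<sigma>) = 0" using i by simp
  then show ?thesis
    using i by (simp add: cis_conv_exp exp_Euler cos_of_real sin_of_real)
qed

text \<open>The decay is stated as a bound on a product so that it includes \<xi> = 0, where the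
  power of the norm is 0.\<close>

lemma sphere_measure_at_fourier_decay:
  assumes d: "DIM('a::euclidean_space) \<ge> 2" and t: "t > 0"
  obtains A where "A \<ge> 0"
    "\<And>\<xi>::'a. cmod (\<integral>w. cis (\<xi> \<bullet> w) \<partial>sphere_measure_at t) * norm \<xi> powr ((real DIM('a) - 1) / 2) \<le> A"
proof
  let ?\<sigma> = "sphere_measure :: 'a measure"
  define n where "n = DIM('a) - 1"
  define m where "m = measure ?\<sigma> UNIV"
  \<comment> \<open>The square root of the constant in \<open>bessel_ode_decay\<close>; t^n comes
    from evaluating the profile at r = t |\<xi>|.\<close>
  define A where "A = sqrt (6 * exp 1 * real n ^ n * m\<^sup>2 / t ^ n)"
  show "A \<ge> 0" using t by (simp add: A_def)
  fix \<xi> :: 'a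
  show "cmod (\<integral>w. cis (\<xi> \<bullet> w) \<partial>sphere_measure_at t) * norm \<xi> powr ((real DIM('a) - 1) / 2) \<le> A"
  proof (cases "\<xi> = 0")
    case True
    then show ?thesis using \<open>A \<ge> 0\<close> by simp
  next
    case False
    define e where "e = \<xi> /\<^sub>R norm \<xi>"
    define r where "r = t * norm \<xi>"
    have e: "norm e = 1" using False by (simp add: e_def)
    have r: "r > 0" using False t by (simp add: r_def)
    define F where "F = (\<lambda>r. \<integral>w. cos (r * (e \<bullet> w)) \<partial>?\<sigma>)"
    obtain F' F'' where "\<And>r. (F has_real_derivative F' r) (at r)" "\<And>r. (F' has_real_derivative F'' r) (at r)"
      "\<And>r. real n * F' r + r * (F r + F'' r) = 0" "\<And>r. \<bar>F r\<bar> \<le> m" "\<And>r. \<bar>F' r\<bar> \<le> m"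
      using sphere_measure_fourier_ode[OF e] unfolding F_def n_def m_def by blast
    then have "r ^ n * (F r)\<^sup>2 \<le> 6 * exp 1 * real n ^ n * m\<^sup>2"
      using d r by (intro bessel_ode_decay[of F F' F'']) (simp_all add: n_def)
    then have "norm \<xi> ^ n * (F r)\<^sup>2 \<le> 6 * exp 1 * real n ^ n * m\<^sup>2 / t ^ n"
      using t by (simp add: r_def power_mult_distrib field_simps)
    then have "sqrt (norm \<xi> ^ n * (F r)\<^sup>2) \<le> A" unfolding A_def by (rule real_sqrt_le_mono)
    moreover have "sqrt (norm \<xi> ^ n * (F r)\<^sup>2) = \<bar>F r\<bar> * norm \<xi> powr ((real DIM('a) - 1) / 2)"
    proof -
      have "sqrt (norm \<xi> ^ n) = norm \<xi> powr (real n / 2)"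
        using False by (simp add: powr_half_sqrt[symmetric] powr_realpow[symmetric] powr_powr)
      then show ?thesis using d by (simp add: real_sqrt_mult n_def of_nat_diff mult.commute)
    qed
    moreover have "(\<integral>w. cis (\<xi> \<bullet> w) \<partial>sphere_measure_at t) = complex_of_real (F r)"
    proof -
      have "(\<lambda>y. cis (\<xi> \<bullet> y)) \<in> borel_measurable borel"
        by (intro borel_measurable_continuous_onI continuous_intros)
      then have "(\<integral>w. cis (\<xi> \<bullet> w) \<partial>sphere_measure_at t) = (\<integral>w. cis ((t *\<^sub>R \<xi>) \<bullet> w) \<partial>?\<sigma>)"
        unfolding sphere_measure_at_def by (subst integral_distr) auto
      also have "\<dots> = complex_of_real (\<integral>w. cos ((t *\<^sub>R \<xi>) \<bullet> w) \<partial>?\<sigma>)"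
        by (rule integral_sphere_measure_cis)
      also have "(\<integral>w. cos ((t *\<^sub>R \<xi>) \<bullet> w) \<partial>?\<sigma>) = F r"
        unfolding F_def using False by (intro Bochner_Integration.integral_cong) (auto simp: e_def r_def field_simps)
      finally show ?thesis .
    qed
    ultimately show ?thesis by simp
  qed
qed

section \<open>Fourier transforms of Gaussians\<close>

lemma gaussian_fourier_real:
  fixes s a :: real
  assumes s: "s > 0"
  shows "integrable lborel (\<lambda>u. complex_of_real (exp (- s * u\<^sup>2)) * cis (u * a))"
    "(\<integral>u. complex_of_real (exp (- s * u\<^sup>2)) * cis (u * a) \<partial>lborel) = complex_of_real (sqrt (pi / s) * exp (- a\<^sup>2 / (4 * s)))"
proof -
  \<comment> \<open>The dilation that turns exp (- s u^2) into a multiple of the standard normal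
    density, whose characteristic function is known.\<close>
  define c where "c = 1 / sqrt (2 * s)"
  have c: "c > 0" using s by (simp add: c_def)
  have c2: "s * c\<^sup>2 = 1 / 2" using s by (simp add: c_def power_divide)
  let ?f = "\<lambda>u. complex_of_real (exp (- s * u\<^sup>2)) * cis (u * a)"
  have m: "cis \<in> borel_measurable borel" by (intro borel_measurable_continuous_onI continuous_intros)
  note [measurable] = m
  have f: "?f (0 + c * x) = sqrt (2 * pi) *\<^sub>R (std_normal_density x *\<^sub>R iexp ((c * a) * x))" for x
  proof -
    have "s * (c * x)\<^sup>2 = x\<^sup>2 / 2" using c2 by (simp add: power_mult_distrib mult.assoc[symmetric])
    then show ?thesis
      by (simp add: std_normal_density_def cis_conv_exp scaleR_conv_of_real mult_ac)
  qed
  have i: "integrable lborel (\<lambda>x. std_normal_density x *\<^sub>R iexp ((c * a) * x))"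
  proof (rule Bochner_Integration.integrable_bound)
    show "integrable lborel std_normal_density" by simp
  qed (auto simp: cis_conv_exp[symmetric])
  have "integrable lborel (\<lambda>x. ?f (0 + c * x))" unfolding f using i by (rule integrable_scaleR_right)
  then show "integrable lborel ?f" using c by (subst (asm) lborel_integrable_real_affine_iff) simp
  have "(\<integral>u. ?f u \<partial>lborel) = \<bar>c\<bar> *\<^sub>R (\<integral>x. ?f (0 + c * x) \<partial>lborel)"
    using c by (intro lborel_integral_real_affine) simp
  also have "(\<integral>x. ?f (0 + c * x) \<partial>lborel) = sqrt (2 * pi) *\<^sub>R (\<integral>x. std_normal_density x *\<^sub>R iexp ((c * a) * x) \<partial>lborel)"
    unfolding f using i by (intro integral_scaleR_right)
  also have "(\<integral>x. std_normal_density x *\<^sub>R iexp ((c * a) * x) \<partial>lborel) = char std_normal_distribution (c * a)"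
    unfolding char_def by (subst integral_density) auto
  also have "\<dots> = exp (- ((c * a)\<^sup>2) / 2)" by (simp add: char_std_normal_distribution)
  also have "- ((c * a)\<^sup>2) / 2 = - a\<^sup>2 / (4 * s)" using s by (simp add: c_def power_mult_distrib power_divide)
  finally show "(\<integral>u. ?f u \<partial>lborel) = complex_of_real (sqrt (pi / s) * exp (- a\<^sup>2 / (4 * s)))"
    using s by (simp add: scaleR_conv_of_real c_def real_sqrt_mult real_sqrt_divide)
qed

text \<open>The squared norm and the inner product are sums over coordinates, so the integral
  factors into one-dimensional ones over \<open>Basis\<close>.\<close>

lemma gaussian_fourier:
  fixes x :: "'a::euclidean_space"
  assumes s: "s > 0"
  shows "integrable lborel (\<lambda>\<xi>. complex_of_real (exp (- s * (norm \<xi>)\<^sup>2)) * cis (\<xi> \<bullet> x))" (is ?int)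
    "(\<integral>\<xi>. complex_of_real (exp (- s * (norm \<xi>)\<^sup>2)) * cis (\<xi> \<bullet> x) \<partial>lborel)
      = complex_of_real (sqrt (pi / s) ^ DIM('a) * exp (- (norm x)\<^sup>2 / (4 * s)))" (is ?eq)
proof -
  interpret product_sigma_finite "\<lambda>_. lborel :: real measure" ..
  have m: "cis \<in> borel_measurable borel" by (intro borel_measurable_continuous_onI continuous_intros)
  note [measurable] = m
  let ?g = "\<lambda>b u. complex_of_real (exp (- s * u\<^sup>2)) * cis (u * (x \<bullet> b))"
  let ?f = "\<lambda>\<xi>. complex_of_real (exp (- s * (norm \<xi>)\<^sup>2)) * cis (\<xi> \<bullet> x)"
  let ?T = "\<lambda>f. \<Sum>b\<in>(Basis :: 'a set). f b *\<^sub>R b"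
  have nrm: "(norm y)\<^sup>2 = (\<Sum>b\<in>Basis. (y \<bullet> b)\<^sup>2)" for y :: 'a
    by (subst power2_norm_eq_inner, subst euclidean_inner) (simp add: power2_eq_square)
  have cs: "cis (\<Sum>b\<in>B. h b) = (\<Prod>b\<in>B. cis (h b))" if "finite B" for B :: "'a set" and h
    using that by (induction B rule: finite_induct) (auto simp: cis_mult[symmetric])
  have f: "?f (?T u) = (\<Prod>b\<in>Basis. ?g b (u b))" for u
  proof -
    have "(norm (?T u))\<^sup>2 = (\<Sum>b\<in>Basis. (u b)\<^sup>2)" by (simp add: nrm)
    moreover have "?T u \<bullet> x = (\<Sum>b\<in>Basis. u b * (x \<bullet> b))"
      by (simp add: inner_sum_left inner_commute[of x])
    ultimately show ?thesis
      by (simp add: cs prod.distrib exp_sum sum_distrib_left sum_negf[symmetric] del: sum_negf)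
  qed
  have eq: "(lborel :: 'a measure) = distr (\<Pi>\<^sub>M b\<in>Basis. lborel) borel ?T" by (rule lborel_eq)
  have ig: "integrable lborel (?g b)" for b using gaussian_fourier_real(1)[OF s] .
  show ?int
    unfolding eq
    by (subst integrable_distr_eq) (use product_integrable_prod[OF finite_Basis ig] in \<open>simp_all only: f, measurable\<close>)
  have "(\<integral>\<xi>. ?f \<xi> \<partial>lborel) = (\<integral>u. (\<Prod>b\<in>Basis. ?g b (u b)) \<partial>(\<Pi>\<^sub>M b\<in>(Basis::'a set). lborel))"
    unfolding f[symmetric] by (subst eq, rule integral_distr) measurable
  also have "\<dots> = (\<Prod>b\<in>Basis. complex_of_real (sqrt (pi / s) * exp (- (x \<bullet> b)\<^sup>2 / (4 * s))))"
    using product_integral_prod[OF finite_Basis ig] by (simp only: gaussian_fourier_real(2)[OF s])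
  also have "\<dots> = complex_of_real (sqrt (pi / s) ^ DIM('a) * exp (- (norm x)\<^sup>2 / (4 * s)))"
    by (simp add: nrm prod.distrib exp_sum[symmetric] sum_divide_distrib sum_negf flip: of_real_prod)
  finally show ?eq .
qed

lemma integrable_gaussian:
  assumes "s > 0"
  shows "integrable lborel (\<lambda>\<xi>::'a::euclidean_space. exp (- s * (norm \<xi>)\<^sup>2))"
    "(\<integral>\<xi>. exp (- s * (norm (\<xi>::'a))\<^sup>2) \<partial>lborel) = sqrt (pi / s) ^ DIM('a)"
proof -
  have i: "integrable lborel (\<lambda>\<xi>::'a. complex_of_real (exp (- s * (norm \<xi>)\<^sup>2)))"
    using gaussian_fourier(1)[OF assms, of "0::'a"] by simp
  from integrable_norm[OF this] show "integrable lborel (\<lambda>\<xi>::'a. exp (- s * (norm \<xi>)\<^sup>2))"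
    by simp
  show "(\<integral>\<xi>. exp (- s * (norm (\<xi>::'a))\<^sup>2) \<partial>lborel) = sqrt (pi / s) ^ DIM('a)"
    using gaussian_fourier(2)[OF assms, of "0::'a"] by (simp flip: of_real_power add: integral_complex_of_real of_real_eq_iff)
qed

section \<open>The L2 bound\<close>

lemma borel_measurable_cis [measurable]: "cis \<in> borel_measurable borel"
  by (intro borel_measurable_continuous_onI continuous_intros)

lemma borel_measurable_complex_cnj [measurable]: "cnj \<in> borel_measurable borel"
  by (intro borel_measurable_continuous_onI continuous_intros)

text \<open>The multiplication formula: a Fourier transform moves from one factor to the other. The
  parameter \<open>c\<close> carries the sign of the phase, so that a transform and its complex
  conjugate are covered alike.\<close>

lemma integral_cis_Fubini:
  fixes \<Phi> :: "'a::euclidean_space \<Rightarrow> complex" and f :: "'a \<Rightarrow> complex"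
  assumes \<mu>: "finite_measure \<mu>" "sets \<mu> = sets borel"
    and \<Phi>: "integrable lborel \<Phi>" and f: "integrable \<mu> f"
  shows "(\<integral>\<xi>. \<Phi> \<xi> * (\<integral>y. cis (c * (\<xi> \<bullet> y)) * f y \<partial>\<mu>) \<partial>lborel)
    = (\<integral>y. f y * (\<integral>\<xi>. \<Phi> \<xi> * cis (c * (\<xi> \<bullet> y)) \<partial>lborel) \<partial>\<mu>)"
proof -
  interpret M: finite_measure \<mu> by fact
  interpret P: pair_sigma_finite lborel \<mu> ..
  note [measurable_cong] = \<mu>(2)
  have [measurable]: "\<Phi> \<in> borel_measurable borel" using \<Phi> by simp
  have [measurable]: "f \<in> borel_measurable borel" using f \<mu>(2) by (simp cong: measurable_cong_sets add: borel_measurable_integrable)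
  have int: "integrable (lborel \<Otimes>\<^sub>M \<mu>) (\<lambda>(\<xi>, y). \<Phi> \<xi> * (cis (c * (\<xi> \<bullet> y)) * f y))"
  proof (rule P.Fubini_integrable)
    have "integrable lborel (\<lambda>\<xi>. cmod (\<Phi> \<xi>) * (\<integral>y. cmod (f y) \<partial>\<mu>))"
      by (intro integrable_mult_left integrable_norm \<Phi>)
    then show "integrable lborel (\<lambda>\<xi>. \<integral>y. norm (case (\<xi>, y) of (\<xi>, y) \<Rightarrow> \<Phi> \<xi> * (cis (c * (\<xi> \<bullet> y)) * f y)) \<partial>\<mu>)"
      by (simp add: norm_mult)
    have "integrable \<mu> (\<lambda>y. cis (c * (\<xi> \<bullet> y)) * f y)" for \<xi>
      by (rule Bochner_Integration.integrable_bound[OF f]) (auto simp: norm_mult)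
    then show "AE \<xi> in lborel. integrable \<mu> (\<lambda>y. case (\<xi>, y) of (\<xi>, y) \<Rightarrow> \<Phi> \<xi> * (cis (c * (\<xi> \<bullet> y)) * f y))"
      by simp
  qed measurable
  have "(\<integral>\<xi>. \<Phi> \<xi> * (\<integral>y. cis (c * (\<xi> \<bullet> y)) * f y \<partial>\<mu>) \<partial>lborel)
      = (\<integral>\<xi>. (\<integral>y. \<Phi> \<xi> * (cis (c * (\<xi> \<bullet> y)) * f y) \<partial>\<mu>) \<partial>lborel)"
    by simp
  also have "\<dots> = (\<integral>y. (\<integral>\<xi>. \<Phi> \<xi> * (cis (c * (\<xi> \<bullet> y)) * f y) \<partial>lborel) \<partial>\<mu>)"
    by (rule P.Fubini_integral[symmetric]) (use int in simp)
  also have "\<dots> = (\<integral>y. f y * (\<integral>\<xi>. \<Phi> \<xi> * cis (c * (\<xi> \<bullet> y)) \<partial>lborel) \<partial>\<mu>)"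
    by (simp add: mult_ac flip: integral_mult_right_zero)
  finally show ?thesis .
qed

text \<open>The weighted L2 norm of the Fourier transform of f \<mu> is a double integral of f against
  itself with a Gaussian kernel, to which Schur's test applies.\<close>

lemma gaussian_energy_bound:
  fixes f :: "'a::euclidean_space \<Rightarrow> complex"
  assumes \<mu>: "finite_measure \<mu>" "sets \<mu> = sets borel"
    and s: "s > 0" and c: "c = 1 \<or> c = -1"
    and D: "\<And>w. (\<integral>y. exp (- (norm (w - y))\<^sup>2 / (4 * s)) \<partial>\<mu>) \<le> D"
    and f[measurable]: "f \<in> borel_measurable borel" and f1: "integrable \<mu> f" and f2: "integrable \<mu> (\<lambda>y. (cmod (f y))\<^sup>2)"
  defines "F \<equiv> \<lambda>\<xi>. \<integral>y. cis (c * (\<xi> \<bullet> y)) * f y \<partial>\<mu>"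
  shows "integrable lborel (\<lambda>\<xi>. exp (- s * (norm \<xi>)\<^sup>2) * (cmod (F \<xi>))\<^sup>2)"
    "(\<integral>\<xi>. exp (- s * (norm \<xi>)\<^sup>2) * (cmod (F \<xi>))\<^sup>2 \<partial>lborel) \<le> sqrt (pi / s) ^ DIM('a) * D * (\<integral>y. (cmod (f y))\<^sup>2 \<partial>\<mu>)"
proof -
  interpret M: finite_measure \<mu> by fact
  interpret P: pair_sigma_finite \<mu> \<mu> ..
  note [measurable_cong] = \<mu>(2)
  have [measurable]: "F \<in> borel_measurable borel"
    unfolding F_def by measurable
  define g where "g = (\<lambda>\<xi>::'a. exp (- s * (norm \<xi>)\<^sup>2))"
  have [measurable]: "g \<in> borel_measurable borel" unfolding g_def by measurable
  have g0: "g \<xi> \<ge> 0" for \<xi> by (simp add: g_def)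
  have gi: "integrable lborel g" unfolding g_def by (rule integrable_gaussian[OF s])
  define N where "N = (\<integral>y. cmod (f y) \<partial>\<mu>)"
  have FN: "cmod (F \<xi>) \<le> N" for \<xi>
  proof -
    have "cmod (F \<xi>) \<le> (\<integral>y. cmod (cis (c * (\<xi> \<bullet> y)) * f y) \<partial>\<mu>)" unfolding F_def by (rule integral_norm_bound)
    then show ?thesis by (simp add: norm_mult N_def)
  qed
  have cF: "cnj (F \<xi>) = (\<integral>y. cis (- c * (\<xi> \<bullet> y)) * cnj (f y) \<partial>\<mu>)" for \<xi>
  proof -
    have "cnj (F \<xi>) = (\<integral>y. cnj (cis (c * (\<xi> \<bullet> y)) * f y) \<partial>\<mu>)"
      unfolding F_def by (rule Bochner_Integration.integral_cnj[symmetric])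
    also have "\<dots> = (\<integral>y. cis (- c * (\<xi> \<bullet> y)) * cnj (f y) \<partial>\<mu>)"
      by (simp only: complex_cnj_mult cis_cnj mult_minus_left)
    finally show ?thesis .
  qed
  let ?E = "\<lambda>x. exp (- (norm x)\<^sup>2 / (4 * s))"
  define G where "G = sqrt (pi / s) ^ DIM('a)"
  let ?J = "\<lambda>y. f y * (\<integral>y'. cnj (f y') * complex_of_real (G * ?E (y - y')) \<partial>\<mu>)"
  have G: "G \<ge> 0" using s by (simp add: G_def)
  have E1: "?E x \<le> 1" "0 \<le> ?E x" for x :: 'a using s by auto
  have int: "integrable lborel (\<lambda>\<xi>. g \<xi> * (cmod (F \<xi>))\<^sup>2)"
  proof (rule Bochner_Integration.integrable_bound)
    show "integrable lborel (\<lambda>\<xi>. g \<xi> * N\<^sup>2)" using gi by simp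
    show "AE \<xi> in lborel. norm (g \<xi> * (cmod (F \<xi>))\<^sup>2) \<le> norm (g \<xi> * N\<^sup>2)"
      using FN g0 by (auto simp: abs_mult intro!: mult_left_mono power_mono)
  qed measurable
  then show "integrable lborel (\<lambda>\<xi>. exp (- s * (norm \<xi>)\<^sup>2) * (cmod (F \<xi>))\<^sup>2)"
    unfolding g_def .
  have gF: "integrable lborel (\<lambda>\<xi>. g \<xi> * cnj (F \<xi>))"
  proof (rule Bochner_Integration.integrable_bound)
    show "integrable lborel (\<lambda>\<xi>. g \<xi> * N)" using gi by simp
    show "AE \<xi> in lborel. norm (g \<xi> * cnj (F \<xi>)) \<le> norm (g \<xi> * N)"
      using FN g0 by (auto simp: norm_mult abs_mult intro!: mult_left_mono order_trans[OF FN])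
  qed measurable
  have cg: "integrable lborel (\<lambda>\<xi>. g \<xi> * cis (c * (\<xi> \<bullet> y)))" for y
    by (rule Bochner_Integration.integrable_bound[OF gi]) (auto simp: norm_mult)
  have f1': "integrable \<mu> (\<lambda>y. cnj (f y))" using f1 by simp
  \<comment> \<open>The two phases merge into one at plus or minus y - y'. The sign disappears
    because the transformed Gaussian is even.\<close>
  have gauss: "(\<integral>\<xi>. (g \<xi> * cis (c * (\<xi> \<bullet> y))) * cis (- c * (\<xi> \<bullet> y')) \<partial>lborel) = complex_of_real (G * ?E (y - y'))" for y y'
  proof -
    have "(\<integral>\<xi>. (g \<xi> * cis (c * (\<xi> \<bullet> y))) * cis (- c * (\<xi> \<bullet> y')) \<partial>lborel) = (\<integral>\<xi>. complex_of_real (g \<xi>) * cis (\<xi> \<bullet> (c *\<^sub>R (y - y'))) \<partial>lborel)"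
      by (simp add: mult.assoc cis_mult inner_diff_right algebra_simps)
    also have "\<dots> = complex_of_real (G * ?E (c *\<^sub>R (y - y')))"
      unfolding g_def G_def by (rule gaussian_fourier(2)[OF s])
    also have "norm (c *\<^sub>R (y - y')) = norm (y - y')" using c by auto
    finally show ?thesis .
  qed
  have "complex_of_real (\<integral>\<xi>. g \<xi> * (cmod (F \<xi>))\<^sup>2 \<partial>lborel) = (\<integral>\<xi>. (g \<xi> * cnj (F \<xi>)) * F \<xi> \<partial>lborel)"
    by (subst integral_complex_of_real[symmetric], rule Bochner_Integration.integral_cong)
       (simp_all only: of_real_mult complex_norm_square mult_ac)
  also have "\<dots> = (\<integral>y. f y * (\<integral>\<xi>. (g \<xi> * cnj (F \<xi>)) * cis (c * (\<xi> \<bullet> y)) \<partial>lborel) \<partial>\<mu>)"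
    unfolding F_def by (rule integral_cis_Fubini[OF \<mu> gF[unfolded F_def] f1])
  also have "\<dots> = (\<integral>y. f y * (\<integral>\<xi>. (g \<xi> * cis (c * (\<xi> \<bullet> y))) * (\<integral>y'. cis (- c * (\<xi> \<bullet> y')) * cnj (f y') \<partial>\<mu>) \<partial>lborel) \<partial>\<mu>)"
    unfolding cF by (simp add: mult_ac)
  also have "\<dots> = (\<integral>y. ?J y \<partial>\<mu>)"
    unfolding gauss[symmetric] by (subst integral_cis_Fubini[OF \<mu> cg f1']) simp
  finally have eq: "complex_of_real (\<integral>\<xi>. g \<xi> * (cmod (F \<xi>))\<^sup>2 \<partial>lborel) = (\<integral>y. ?J y \<partial>\<mu>)" .
  \<comment> \<open>Schur's test in its symmetric form: |f y| |f y'| is at most half the sum of the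
    squares, so the double integral splits into two halves.\<close>
  let ?h = "\<lambda>y y'. ((cmod (f y))\<^sup>2 * ?E (y - y') + (cmod (f y'))\<^sup>2 * ?E (y - y')) / 2"
  have iE: "integrable \<mu> (\<lambda>y'. ?E (y - y'))" for y
    by (rule M.integrable_const_bound[of _ 1]) (use E1 in auto)
  have ifE: "integrable \<mu> (\<lambda>y'. (cmod (f y'))\<^sup>2 * ?E (y - y'))" for y
    by (rule Bochner_Integration.integrable_bound[OF f2]) (use E1 in \<open>auto simp: abs_mult mult_left_le\<close>)
  have prodint: "integrable (\<mu> \<Otimes>\<^sub>M \<mu>) (\<lambda>(y, y'). (cmod (f y'))\<^sup>2 * ?E (y - y'))"
  proof (rule P.Fubini_integrable)
    show "integrable \<mu> (\<lambda>y. \<integral>y'. norm (case (y, y') of (y, y') \<Rightarrow> (cmod (f y'))\<^sup>2 * ?E (y - y')) \<partial>\<mu>)"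
    proof (rule M.integrable_const_bound[of _ "\<integral>y. (cmod (f y))\<^sup>2 \<partial>\<mu>"])
      show "AE y in \<mu>. norm (\<integral>y'. norm (case (y, y') of (y, y') \<Rightarrow> (cmod (f y'))\<^sup>2 * ?E (y - y')) \<partial>\<mu>) \<le> (\<integral>y. (cmod (f y))\<^sup>2 \<partial>\<mu>)"
        using ifE f2 E1 by (auto simp: abs_mult mult_left_le intro!: integral_mono)
    qed measurable
    show "AE y in \<mu>. integrable \<mu> (\<lambda>y'. case (y, y') of (y, y') \<Rightarrow> (cmod (f y'))\<^sup>2 * ?E (y - y'))"
      using ifE by simp
  qed measurable
  \<comment> \<open>The kernel is symmetric, so the two halves have the same integral, and in each
    the Gaussian is integrated alone and bounded by \<open>D\<close>.\<close>
  have swap: "(\<integral>y. (\<integral>y'. (cmod (f y'))\<^sup>2 * ?E (y - y') \<partial>\<mu>) \<partial>\<mu>) = (\<integral>y. (cmod (f y))\<^sup>2 * (\<integral>y'. ?E (y - y') \<partial>\<mu>) \<partial>\<mu>)"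
    using P.Fubini_integral[OF prodint] by (simp add: norm_minus_commute)
  have iD: "integrable \<mu> (\<lambda>y. (cmod (f y))\<^sup>2 * (\<integral>y'. ?E (y - y') \<partial>\<mu>))"
  proof (rule Bochner_Integration.integrable_bound[of _ "\<lambda>y. (cmod (f y))\<^sup>2 * D"])
    have "\<bar>\<integral>y'. ?E (y - y') \<partial>\<mu>\<bar> \<le> \<bar>D\<bar>" for y
      using D[of y] Bochner_Integration.integral_nonneg[of \<mu> "\<lambda>y'. ?E (y - y')"] by simp
    then show "AE y in \<mu>. norm ((cmod (f y))\<^sup>2 * (\<integral>y'. ?E (y - y') \<partial>\<mu>)) \<le> norm ((cmod (f y))\<^sup>2 * D)"
      by (intro AE_I2) (simp only: real_norm_def abs_mult mult_left_mono abs_ge_zero)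
  qed (use f2 in simp_all)
  have i2: "integrable \<mu> (\<lambda>y. \<integral>y'. (cmod (f y'))\<^sup>2 * ?E (y - y') \<partial>\<mu>)"
    using P.integrable_fst[OF prodint] by simp
  have inner: "cmod (?J y) \<le> G * (\<integral>y'. ?h y y' \<partial>\<mu>)" for y
  proof -
    have "cmod (?J y) \<le> (\<integral>y'. cmod (f y * (cnj (f y') * complex_of_real (G * ?E (y - y')))) \<partial>\<mu>)"
      by (subst integral_mult_right_zero[symmetric]) (rule integral_norm_bound)
    also have "\<dots> \<le> (\<integral>y'. G * ?h y y' \<partial>\<mu>)"
    proof (rule integral_mono')
      show "integrable \<mu> (\<lambda>y'. G * ?h y y')" using iE ifE by simp
      fix y'
      have "cmod (f y) * cmod (f y') \<le> ((cmod (f y))\<^sup>2 + (cmod (f y'))\<^sup>2) / 2"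
        using sum_squares_bound[of "cmod (f y)" "cmod (f y')"] by simp
      from mult_right_mono[OF this, of "G * ?E (y - y')"]
      show "cmod (f y * (cnj (f y') * complex_of_real (G * ?E (y - y')))) \<le> G * ?h y y'"
        using G by (simp add: norm_mult algebra_simps add_divide_distrib)
    qed (use G in \<open>auto\<close>)
    finally show ?thesis by simp
  qed
  have h: "(\<integral>y'. ?h y y' \<partial>\<mu>) = ((cmod (f y))\<^sup>2 * (\<integral>y'. ?E (y - y') \<partial>\<mu>) + (\<integral>y'. (cmod (f y'))\<^sup>2 * ?E (y - y') \<partial>\<mu>)) / 2" for y
    using iE ifE by simp
  have iH: "integrable \<mu> (\<lambda>y. G * (\<integral>y'. ?h y y' \<partial>\<mu>))"
    unfolding h by (intro integrable_mult_right integrable_divide Bochner_Integration.integrable_add iD i2)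
  have "\<bar>\<integral>\<xi>. g \<xi> * (cmod (F \<xi>))\<^sup>2 \<partial>lborel\<bar> = cmod (\<integral>y. ?J y \<partial>\<mu>)"
    unfolding eq[symmetric] by simp
  also have "\<dots> \<le> (\<integral>y. cmod (?J y) \<partial>\<mu>)"
    by (rule integral_norm_bound)
  also have "\<dots> \<le> (\<integral>y. G * (\<integral>y'. ?h y y' \<partial>\<mu>) \<partial>\<mu>)"
    by (rule integral_mono'[OF iH inner order_trans[OF norm_ge_zero inner]])
  also have "\<dots> = G * (\<integral>y. (cmod (f y))\<^sup>2 * (\<integral>y'. ?E (y - y') \<partial>\<mu>) \<partial>\<mu>)"
    unfolding h unfolding integral_mult_right_zero integral_divide_zero Bochner_Integration.integral_add[OF iD i2] swap by simp
  also have "\<dots> \<le> G * (\<integral>y. (cmod (f y))\<^sup>2 * D \<partial>\<mu>)"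
    by (intro mult_left_mono[OF _ G] integral_mono mult_left_mono D iD) (use f2 in auto)
  finally show "(\<integral>\<xi>. exp (- s * (norm \<xi>)\<^sup>2) * (cmod (F \<xi>))\<^sup>2 \<partial>lborel) \<le> sqrt (pi / s) ^ DIM('a) * D * (\<integral>y. (cmod (f y))\<^sup>2 \<partial>\<mu>)"
    by (simp add: g_def G_def mult_ac)
qed

section \<open>Convolution operators with bounded kernels\<close>

definition conv_op :: "('a::euclidean_space \<Rightarrow> complex) \<Rightarrow> 'a measure \<Rightarrow> ('a \<Rightarrow> complex) \<Rightarrow> 'a \<Rightarrow> complex" where
  "conv_op K \<mu> f x = (\<integral>y. K (x - y) * f y \<partial>\<mu>)"

lemma borel_measurable_conv_op [measurable]:
  assumes "finite_measure \<mu>" and s: "sets \<mu> = sets borel"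
    and [measurable]: "K \<in> borel_measurable borel" "f \<in> borel_measurable borel"
  shows "conv_op K \<mu> f \<in> borel_measurable borel"
proof -
  interpret finite_measure \<mu> by fact
  note [measurable_cong] = s
  show ?thesis unfolding conv_op_def by measurable
qed

lemma integrable_conv_op:
  fixes K f :: "'a::euclidean_space \<Rightarrow> complex"
  assumes s: "sets \<mu> = sets borel" and K[measurable]: "K \<in> borel_measurable borel" "\<And>x. cmod (K x) \<le> B"
    and f: "integrable \<mu> f"
  shows "integrable \<mu> (\<lambda>y. K (x - y) * f y)"
proof (rule Bochner_Integration.integrable_bound)
  note [measurable_cong] = s
  show "integrable \<mu> (\<lambda>y. B * cmod (f y))" using f by (intro integrable_mult_right integrable_norm)
  have "(\<lambda>y. x - y) \<in> borel_measurable borel"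
    by measurable
  then have "(\<lambda>y. K (x - y)) \<in> borel_measurable \<mu>" by measurable
  then show "(\<lambda>y. K (x - y) * f y) \<in> borel_measurable \<mu>" using f by simp
  have "0 \<le> B" using K(2)[of 0] norm_ge_zero order_trans by blast
  then show "AE y in \<mu>. norm (K (x - y) * f y) \<le> norm (B * cmod (f y))"
    using K(2) by (auto simp: norm_mult intro!: mult_right_mono)
qed

lemma cmod_conv_op_le:
  assumes s: "sets \<mu> = sets borel" and K: "K \<in> borel_measurable borel" "\<And>x. cmod (K x) \<le> B"
    and f: "integrable \<mu> f"
  shows "cmod (conv_op K \<mu> f x) \<le> B * (\<integral>y. cmod (f y) \<partial>\<mu>)"
proof -
  have "cmod (conv_op K \<mu> f x) \<le> (\<integral>y. cmod (K (x - y) * f y) \<partial>\<mu>)"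
    unfolding conv_op_def by (rule integral_norm_bound)
  also have "\<dots> \<le> (\<integral>y. B * cmod (f y) \<partial>\<mu>)"
    by (intro integral_mono integrable_norm integrable_conv_op[OF s K f] integrable_mult_right f)
       (auto simp: norm_mult intro!: mult_right_mono K)
  finally show ?thesis by simp
qed

text \<open>Pairing T = K * (f \<mu>) with its own conjugate in \<nu> and passing to frequencies
  gives the integral of \<Psi> F H, where F and H are the transforms of f \<mu> and of the conjugate
  of T times \<nu>. The Gaussian majorant of \<Psi> is the weight of both energies, so
  \<open>gaussian_energy_bound\<close> applies on each side. The second energy contains the quantity
  being estimated and is absorbed.\<close>

lemma conv_op_L2_bound:
  fixes f :: "'a::euclidean_space \<Rightarrow> complex"
  assumes \<mu>: "finite_measure \<mu>" "sets \<mu> = sets borel" and \<nu>: "finite_measure \<nu>" "sets \<nu> = sets borel"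
    and s: "s > 0" and S: "S > 0"
    and \<Psi>: "\<Psi> \<in> borel_measurable borel" "\<And>\<xi>. cmod (\<Psi> \<xi>) \<le> S * exp (- s * (norm \<xi>)\<^sup>2)"
    and K: "\<And>x. K x = (\<integral>\<xi>. \<Psi> \<xi> * cis (\<xi> \<bullet> x) \<partial>lborel)"
    and D\<mu>: "\<And>w. (\<integral>y. exp (- (norm (w - y))\<^sup>2 / (4 * s)) \<partial>\<mu>) \<le> D\<mu>"
    and D\<nu>: "D\<nu> > 0" "\<And>w. (\<integral>y. exp (- (norm (w - y))\<^sup>2 / (4 * s)) \<partial>\<nu>) \<le> D\<nu>"
    and f[measurable]: "f \<in> borel_measurable borel" and f1: "integrable \<mu> f" and f2: "integrable \<mu> (\<lambda>y. (cmod (f y))\<^sup>2)"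
  shows "integrable \<nu> (\<lambda>x. (cmod (conv_op K \<mu> f x))\<^sup>2)"
    "(\<integral>x. (cmod (conv_op K \<mu> f x))\<^sup>2 \<partial>\<nu>) \<le> S\<^sup>2 * (sqrt (pi / s) ^ DIM('a))\<^sup>2 * D\<mu> * D\<nu> * (\<integral>y. (cmod (f y))\<^sup>2 \<partial>\<mu>)"
proof -
  interpret M: finite_measure \<mu> by fact
  interpret N: finite_measure \<nu> by fact
  note [measurable_cong] = \<mu>(2) \<nu>(2)
  note [measurable] = \<Psi>(1)
  define g where "g = (\<lambda>\<xi>::'a. exp (- s * (norm \<xi>)\<^sup>2))"
  have g0: "g \<xi> \<ge> 0" for \<xi> by (simp add: g_def)
  have gi: "integrable lborel g" unfolding g_def by (rule integrable_gaussian[OF s])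
  have Sgi: "integrable lborel (\<lambda>\<xi>. S * g \<xi>)" using gi by simp
  have \<Psi>g: "cmod (\<Psi> \<xi>) \<le> S * g \<xi>" for \<xi> using \<Psi>(2) by (simp add: g_def)
  have \<Psi>i: "integrable lborel (\<lambda>\<xi>. \<Psi> \<xi> * cis (\<xi> \<bullet> x))" for x
  proof (rule Bochner_Integration.integrable_bound[OF Sgi])
    show "AE \<xi> in lborel. norm (\<Psi> \<xi> * cis (\<xi> \<bullet> x)) \<le> norm (S * g \<xi>)"
      using \<Psi>g order_trans[OF \<Psi>g abs_ge_self] by (auto simp: norm_mult)
  qed measurable
  have Km[measurable]: "K \<in> borel_measurable borel"
    unfolding K by measurable
  define B where "B = (\<integral>\<xi>. S * g \<xi> \<partial>lborel)"
  have KB: "cmod (K x) \<le> B" for x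
  proof -
    have "cmod (K x) \<le> (\<integral>\<xi>. cmod (\<Psi> \<xi> * cis (\<xi> \<bullet> x)) \<partial>lborel)"
      unfolding K by (rule integral_norm_bound)
    also have "\<dots> \<le> B" unfolding B_def
      by (rule integral_mono[OF integrable_norm[OF \<Psi>i] Sgi]) (simp add: norm_mult \<Psi>g)
    finally show ?thesis .
  qed
  define T where "T = conv_op K \<mu> f"
  have Tm[measurable]: "T \<in> borel_measurable borel"
    unfolding T_def by (rule borel_measurable_conv_op[OF \<mu> Km f])
  define M where "M = B * (\<integral>y. cmod (f y) \<partial>\<mu>)"
  have TM: "cmod (T x) \<le> M" for x
    unfolding T_def M_def by (rule cmod_conv_op_le[OF \<mu>(2) Km KB f1])
  have T1: "integrable \<nu> (\<lambda>x. cnj (T x))"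
    by (rule N.integrable_const_bound[of _ M]) (use TM in auto)
  have "integrable \<nu> (\<lambda>x. (cmod (T x))\<^sup>2)"
    by (rule N.integrable_const_bound[of _ "M\<^sup>2"]) (use TM in \<open>auto intro!: power_mono\<close>)
  then show T2': "integrable \<nu> (\<lambda>x. (cmod (conv_op K \<mu> f x))\<^sup>2)" by (simp add: T_def)
  have T2: "integrable \<nu> (\<lambda>x. (cmod (cnj (T x)))\<^sup>2)" using T2' by (simp add: T_def)
  define F where "F = (\<lambda>\<xi>. \<integral>y. cis (-1 * (\<xi> \<bullet> y)) * f y \<partial>\<mu>)"
  define H where "H = (\<lambda>\<xi>. \<integral>x. cis (1 * (\<xi> \<bullet> x)) * cnj (T x) \<partial>\<nu>)"
  have [measurable]: "F \<in> borel_measurable borel" unfolding F_def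
    by measurable
  have FN: "cmod (F \<xi>) \<le> (\<integral>y. cmod (f y) \<partial>\<mu>)" for \<xi>
  proof -
    have "cmod (F \<xi>) \<le> (\<integral>y. cmod (cis (-1 * (\<xi> \<bullet> y)) * f y) \<partial>\<mu>)" unfolding F_def by (rule integral_norm_bound)
    then show ?thesis by (simp add: norm_mult)
  qed
  have \<Psi>F: "integrable lborel (\<lambda>\<xi>. \<Psi> \<xi> * F \<xi>)"
  proof (rule Bochner_Integration.integrable_bound)
    show "integrable lborel (\<lambda>\<xi>. S * g \<xi> * (\<integral>y. cmod (f y) \<partial>\<mu>))" using gi by simp
    show "AE \<xi> in lborel. norm (\<Psi> \<xi> * F \<xi>) \<le> norm (S * g \<xi> * (\<integral>y. cmod (f y) \<partial>\<mu>))"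
      using \<Psi>g FN g0 S by (auto simp: norm_mult abs_mult intro!: mult_mono)
  qed measurable
  \<comment> \<open>K is the inverse transform of \<Psi>, so T is that of \<Psi> F, up to the
    normalisation contained in \<Psi>.\<close>
  have Teq: "T x = (\<integral>\<xi>. (\<Psi> \<xi> * F \<xi>) * cis (1 * (\<xi> \<bullet> x)) \<partial>lborel)" for x
  proof -
    have "T x = (\<integral>y. f y * (\<integral>\<xi>. (\<Psi> \<xi> * cis (\<xi> \<bullet> x)) * cis (-1 * (\<xi> \<bullet> y)) \<partial>lborel) \<partial>\<mu>)"
      unfolding T_def conv_op_def K
      by (simp add: mult.assoc mult.left_commute mult.commute cis_mult inner_diff_right)
    also have "\<dots> = (\<integral>\<xi>. (\<Psi> \<xi> * cis (\<xi> \<bullet> x)) * F \<xi> \<partial>lborel)"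
      unfolding F_def by (rule integral_cis_Fubini[OF \<mu> \<Psi>i f1, symmetric])
    finally show ?thesis by (simp add: mult_ac)
  qed
  define Q where "Q = (\<integral>x. (cmod (T x))\<^sup>2 \<partial>\<nu>)"
  have "complex_of_real Q = (\<integral>x. cnj (T x) * T x \<partial>\<nu>)"
    unfolding Q_def by (subst integral_complex_of_real[symmetric]) (simp add: complex_norm_square mult.commute del: of_real_power)
  also have "\<dots> = (\<integral>\<xi>. (\<Psi> \<xi> * F \<xi>) * H \<xi> \<partial>lborel)"
    unfolding H_def by (subst (2) Teq) (rule integral_cis_Fubini[OF \<nu> \<Psi>F T1, symmetric])
  finally have Qeq: "complex_of_real Q = (\<integral>\<xi>. (\<Psi> \<xi> * F \<xi>) * H \<xi> \<partial>lborel)" .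
  define G where "G = sqrt (pi / s) ^ DIM('a)"
  have G: "G > 0" using s by (simp add: G_def)
  define X where "X = (\<integral>y. (cmod (f y))\<^sup>2 \<partial>\<mu>)"
  have Fd: "(\<integral>y. cis (-1 * (\<xi> \<bullet> y)) * f y \<partial>\<mu>) = F \<xi>" and Hd: "(\<integral>x. cis (1 * (\<xi> \<bullet> x)) * cnj (T x) \<partial>\<nu>) = H \<xi>" for \<xi>
    by (simp_all add: F_def H_def)
  note EF = gaussian_energy_bound[OF \<mu> s disjI2[OF refl] D\<mu> f f1 f2, unfolded Fd]
  have TcM: "(\<lambda>x. cnj (T x)) \<in> borel_measurable borel" by measurable
  note EH = gaussian_energy_bound[OF \<nu> s disjI1[OF refl] D\<nu>(2) TcM T1 T2, unfolded Hd]
  \<comment> \<open>The weight in |F| |H| \<le> a/2 |F|^2 + 1/(2a) |H|^2, chosen so that the H-term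
    becomes exactly half of \<open>Q\<close>.\<close>
  define a where "a = S * G * D\<nu>"
  have a: "a > 0" using S G D\<nu>(1) by (simp add: a_def)
  have "Q = cmod (complex_of_real Q)" by (simp add: Q_def)
  also have "\<dots> \<le> (\<integral>\<xi>. cmod ((\<Psi> \<xi> * F \<xi>) * H \<xi>) \<partial>lborel)"
    unfolding Qeq by (rule integral_norm_bound)
  also have "\<dots> \<le> (\<integral>\<xi>. S * (a / 2) * (g \<xi> * (cmod (F \<xi>))\<^sup>2) + S / (2 * a) * (g \<xi> * (cmod (H \<xi>))\<^sup>2) \<partial>lborel)"
  proof (rule integral_mono')
    show "integrable lborel (\<lambda>\<xi>. S * (a / 2) * (g \<xi> * (cmod (F \<xi>))\<^sup>2) + S / (2 * a) * (g \<xi> * (cmod (H \<xi>))\<^sup>2))"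
      unfolding g_def by (intro Bochner_Integration.integrable_add integrable_mult_right EF EH)
    fix \<xi>
    let ?u = "cmod (F \<xi>)" and ?v = "cmod (H \<xi>)"
    have "0 \<le> (a * ?u - ?v)\<^sup>2" by simp
    then have "?u * ?v \<le> a / 2 * ?u\<^sup>2 + 1 / (2 * a) * ?v\<^sup>2"
      using a by (simp add: power2_eq_square field_simps)
    then have "S * g \<xi> * (?u * ?v) \<le> S * g \<xi> * (a / 2 * ?u\<^sup>2 + 1 / (2 * a) * ?v\<^sup>2)"
      using S g0 by (intro mult_left_mono) auto
    moreover have "cmod ((\<Psi> \<xi> * F \<xi>) * H \<xi>) \<le> S * g \<xi> * (?u * ?v)"
      using mult_right_mono[OF \<Psi>g[of \<xi>], of "?u * ?v"] by (simp add: norm_mult mult.assoc)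
    ultimately show "cmod ((\<Psi> \<xi> * F \<xi>) * H \<xi>) \<le> S * (a / 2) * (g \<xi> * ?u\<^sup>2) + S / (2 * a) * (g \<xi> * ?v\<^sup>2)"
      by (simp add: algebra_simps)
    show "0 \<le> S * (a / 2) * (g \<xi> * ?u\<^sup>2) + S / (2 * a) * (g \<xi> * ?v\<^sup>2)"
      using S a g0 by simp
  qed
  also have "\<dots> = S * (a / 2) * (\<integral>\<xi>. g \<xi> * (cmod (F \<xi>))\<^sup>2 \<partial>lborel) + S / (2 * a) * (\<integral>\<xi>. g \<xi> * (cmod (H \<xi>))\<^sup>2 \<partial>lborel)"
    unfolding g_def by (subst Bochner_Integration.integral_add) (simp_all only: integrable_mult_right EF EH integral_mult_right_zero simp_thms)
  also have "\<dots> \<le> S * (a / 2) * (G * D\<mu> * X) + S / (2 * a) * (G * D\<nu> * Q)"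
    unfolding g_def G_def X_def Q_def
    by (intro add_mono mult_left_mono EF(2) EH(2)[unfolded complex_mod_cnj]) (use S a in auto)
  also have "\<dots> = S\<^sup>2 * G\<^sup>2 * D\<mu> * D\<nu> * X / 2 + Q / 2"
    using S G D\<nu>(1) by (simp add: a_def field_simps power2_eq_square)
  finally have "Q \<le> S\<^sup>2 * G\<^sup>2 * D\<mu> * D\<nu> * X" by simp
  then show "(\<integral>x. (cmod (conv_op K \<mu> f x))\<^sup>2 \<partial>\<nu>) \<le> S\<^sup>2 * (sqrt (pi / s) ^ DIM('a))\<^sup>2 * D\<mu> * D\<nu> * (\<integral>y. (cmod (f y))\<^sup>2 \<partial>\<mu>)"
    by (simp add: Q_def T_def G_def X_def)
qed

section \<open>Interpolation\<close>

lemma integrable_powr_mono: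
  fixes f :: "'a \<Rightarrow> complex"
  assumes "finite_measure \<mu>" and f[measurable]: "f \<in> borel_measurable \<mu>"
    and fp: "integrable \<mu> (\<lambda>y. cmod (f y) powr p)" and q: "0 \<le> q" "q \<le> p"
  shows "integrable \<mu> (\<lambda>y. cmod (f y) powr q)"
proof -
  interpret finite_measure \<mu> by fact
  show ?thesis
  proof (rule Bochner_Integration.integrable_bound)
    show "integrable \<mu> (\<lambda>y. 1 + cmod (f y) powr p)" using fp by simp
    have "cmod (f y) powr q \<le> 1 + cmod (f y) powr p" for y
    proof (cases "cmod (f y) \<le> 1")
      case True
      then have "cmod (f y) powr q \<le> 1" using q(1) by (intro powr_le1) auto
      then show ?thesis by (simp add: add_increasing2)
    next
      case False
      then have "cmod (f y) powr q \<le> cmod (f y) powr p" using q(2) by (intro powr_mono) auto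
      then show ?thesis by simp
    qed
    then show "AE y in \<mu>. norm (cmod (f y) powr q) \<le> norm (1 + cmod (f y) powr p)"
      by simp
  qed measurable
qed

lemma integrable_of_powr:
  fixes f :: "'a \<Rightarrow> complex"
  assumes "finite_measure \<mu>" and f: "f \<in> borel_measurable \<mu>"
    and fp: "integrable \<mu> (\<lambda>y. cmod (f y) powr p)" and p: "p \<ge> 1"
  shows "integrable \<mu> f"
proof -
  have "integrable \<mu> (\<lambda>y. cmod (f y) powr 1)" by (rule integrable_powr_mono[OF assms(1) f fp]) (use p in auto)
  then show ?thesis using integrable_norm_cancel[OF _ f] by simp
qed

lemma integrable_conv_op_powr:
  fixes K f :: "'a::euclidean_space \<Rightarrow> complex"
  assumes \<mu>: "finite_measure \<mu>" "sets \<mu> = sets borel" and \<nu>: "finite_measure \<nu>" "sets \<nu> = sets borel"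
    and K: "K \<in> borel_measurable borel" "\<And>x. cmod (K x) \<le> B"
    and f: "f \<in> borel_measurable borel" "integrable \<mu> f" and p: "p \<ge> 0"
  shows "integrable \<nu> (\<lambda>x. cmod (conv_op K \<mu> f x) powr p)"
proof -
  interpret finite_measure \<nu> by fact
  note [measurable_cong] = \<nu>(2)
  have [measurable]: "conv_op K \<mu> f \<in> borel_measurable borel"
    by (rule borel_measurable_conv_op[OF \<mu> K(1) f(1)])
  show ?thesis
    by (rule integrable_const_bound[of _ "(B * (\<integral>y. cmod (f y) \<partial>\<mu>)) powr p"])
       (use cmod_conv_op_le[OF \<mu>(2) K f(2)] p in \<open>auto intro!: powr_mono2\<close>)
qed

text \<open>The inequality compares p-th powers, so \<open>C\<close> bounds the p-th power of the
  operator norm. Interpolation, summation and duality then need no roots; one is taken only at the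
  very end.\<close>

definition conv_bounded ::
    "real \<Rightarrow> 'a::euclidean_space measure \<Rightarrow> 'a measure \<Rightarrow> ('a \<Rightarrow> complex) \<Rightarrow> real \<Rightarrow> bool" where
  "conv_bounded p \<mu> \<nu> K C \<longleftrightarrow> (\<forall>f\<in>borel_measurable borel. integrable \<mu> (\<lambda>y. cmod (f y) powr p) \<longrightarrow>
     (\<integral>x. cmod (conv_op K \<mu> f x) powr p \<partial>\<nu>) \<le> C * (\<integral>y. cmod (f y) powr p \<partial>\<mu>))"

lemma conv_boundedI:
  "(\<And>f. f \<in> borel_measurable borel \<Longrightarrow> integrable \<mu> (\<lambda>y. cmod (f y) powr p) \<Longrightarrow>
     (\<integral>x. cmod (conv_op K \<mu> f x) powr p \<partial>\<nu>) \<le> C * (\<integral>y. cmod (f y) powr p \<partial>\<mu>)) \<Longrightarrow> conv_bounded p \<mu> \<nu> K C"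
  by (simp add: conv_bounded_def)

lemma conv_boundedD:
  "conv_bounded p \<mu> \<nu> K C \<Longrightarrow> f \<in> borel_measurable borel \<Longrightarrow> integrable \<mu> (\<lambda>y. cmod (f y) powr p) \<Longrightarrow>
     (\<integral>x. cmod (conv_op K \<mu> f x) powr p \<partial>\<nu>) \<le> C * (\<integral>y. cmod (f y) powr p \<partial>\<mu>)"
  by (simp add: conv_bounded_def)

lemma conv_op_diff:
  fixes K f g :: "'a::euclidean_space \<Rightarrow> complex"
  assumes s: "sets \<mu> = sets borel" and K: "K \<in> borel_measurable borel" "\<And>x. cmod (K x) \<le> B"
    and f: "integrable \<mu> f" and g: "integrable \<mu> g"
  shows "conv_op K \<mu> (\<lambda>y. f y - g y) x = conv_op K \<mu> f x - conv_op K \<mu> g x"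
  unfolding conv_op_def right_diff_distrib
  by (rule Bochner_Integration.integral_diff integrable_conv_op[OF s K] f g)+

text \<open>Real interpolation between the L2 bound and the trivial bound on bounded functions: at height
  \<lambda> = \<tau> powr (1 / (p - 2)), the part of f below \<lambda> / A contributes at most \<lambda> to T f.\<close>

lemma conv_op_Lp_bound:
  fixes K :: "'a::euclidean_space \<Rightarrow> complex"
  assumes \<mu>: "finite_measure \<mu>" "sets \<mu> = sets borel" and \<nu>: "finite_measure \<nu>" "sets \<nu> = sets borel"
    and K: "K \<in> borel_measurable borel" "\<And>x. cmod (K x) \<le> B\<^sub>0"
    and A: "A > 0" "\<And>x. (\<integral>y. cmod (K (x - y)) \<partial>\<mu>) \<le> A"
    and B: "B \<ge> 0" "\<And>g. g \<in> borel_measurable borel \<Longrightarrow> integrable \<mu> g \<Longrightarrow> integrable \<mu> (\<lambda>y. (cmod (g y))\<^sup>2)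
        \<Longrightarrow> (\<integral>x. (cmod (conv_op K \<mu> g x))\<^sup>2 \<partial>\<nu>) \<le> B * (\<integral>y. (cmod (g y))\<^sup>2 \<partial>\<mu>)"
    and p: "p \<ge> 2"
  shows "conv_bounded p \<mu> \<nu> K (2 powr p * B * A powr (p - 2))"
proof (rule conv_boundedI)
  fix f :: "'a \<Rightarrow> complex"
  assume f[measurable]: "f \<in> borel_measurable borel" and fp: "integrable \<mu> (\<lambda>y. cmod (f y) powr p)"
  interpret M: finite_measure \<mu> by fact
  interpret N: finite_measure \<nu> by fact
  interpret P: pair_sigma_finite \<nu> "lborel :: real measure" ..
  interpret P': pair_sigma_finite \<mu> "lborel :: real measure" ..
  note [measurable_cong] = \<mu>(2) \<nu>(2)
  note [measurable] = K(1)
  have f\<mu>: "f \<in> borel_measurable \<mu>" by measurable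
  have sq: "a powr 2 = a\<^sup>2" if "a \<ge> 0" for a :: real
    using that by (cases "a = 0") (simp_all add: powr_numeral)
  have f1: "integrable \<mu> f" by (rule integrable_of_powr[OF \<mu>(1) f\<mu> fp]) (use p in simp)
  have f2: "integrable \<mu> (\<lambda>y. (cmod (f y))\<^sup>2)"
    using integrable_powr_mono[OF \<mu>(1) f\<mu> fp, of 2] p by (simp add: sq)
  define T where "T = conv_op K \<mu> f"
  have T[measurable]: "T \<in> borel_measurable borel"
    unfolding T_def by (rule borel_measurable_conv_op[OF \<mu> K(1) f])
  have Tp: "integrable \<nu> (\<lambda>x. cmod (T x) powr p)"
    unfolding T_def by (rule integrable_conv_op_powr[OF \<mu> \<nu> K f f1]) (use p in simp)
  have "(\<integral>x. cmod (T x) powr p \<partial>\<nu>) \<le> 2 powr p * B * A powr (p - 2) * (\<integral>y. cmod (f y) powr p \<partial>\<mu>)"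
  proof (cases "p = 2")
    case True
    \<comment> \<open>For p = 2 there is nothing to interpolate: \<open>2 powr p\<close> is 4, which
      only weakens the L2 bound.\<close>
    have "0 \<le> (\<integral>y. (cmod (f y))\<^sup>2 \<partial>\<mu>)" by simp
    then have "1 * (B * (\<integral>y. (cmod (f y))\<^sup>2 \<partial>\<mu>)) \<le> 4 * (B * (\<integral>y. (cmod (f y))\<^sup>2 \<partial>\<mu>))"
      using B(1) by (intro mult_right_mono mult_nonneg_nonneg) auto
    with B(2)[OF f f1 f2] show ?thesis
      using A(1) by (simp add: True sq T_def mult.assoc)
  next
    case False
    define q where "q = p - 2"
    have q: "q > 0" using False p by (simp add: q_def)
    define l where "l = (\<lambda>\<tau>::real. \<tau> powr (1 / q))"
    have l: "l \<tau> < b \<longleftrightarrow> \<tau> < b powr q" if "\<tau> > 0" "b \<ge> 0" for \<tau> b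
    proof -
      have "l \<tau> < b \<longleftrightarrow> l \<tau> powr q < b powr q"
        using that q powr_mono2[of q b "l \<tau>"] powr_less_mono2[of q "l \<tau>" b]
        by (cases "l \<tau> < b") (auto simp: l_def not_less)
      also have "l \<tau> powr q = \<tau>" using that q by (simp add: l_def powr_powr)
      finally show ?thesis .
    qed
    \<comment> \<open>The layer-cake formula: b^q is the length of {0<..<b^q}. It turns |T|^p =
      |T|^2 |T|^q into an integral over \<tau> of |T|^2 restricted to a level set, where only the L2
      bound is required.\<close>
    have meas: "(\<integral>\<^sup>+\<tau>. ennreal (c * indicator {0<..<b powr q} \<tau>) \<partial>lborel) = ennreal (c * b powr q)"
      if "c \<ge> 0" for b c :: real
    proof -
      have "(\<integral>\<^sup>+\<tau>. ennreal (c * indicator {0<..<b powr q} \<tau>) \<partial>lborel) = (\<integral>\<^sup>+\<tau>. ennreal c * indicator {0<..<b powr q} \<tau> \<partial>lborel)"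
        by (intro nn_integral_cong) (auto simp: indicator_def)
      also have "\<dots> = ennreal (c * b powr q)"
        using that by (simp add: nn_integral_cmult_indicator ennreal_mult)
      finally show ?thesis .
    qed
    \<comment> \<open>The high part of f. By the choice of threshold the discarded low part is at
      most l \<tau> / A in modulus, so its image is at most l \<tau> everywhere.\<close>
    define f\<^sub>l where "f\<^sub>l = (\<lambda>\<tau> y. if l \<tau> < A * cmod (f y) then f y else 0)"
    have fl[measurable]: "f\<^sub>l \<tau> \<in> borel_measurable borel" for \<tau> unfolding f\<^sub>l_def by measurable
    have fl1: "integrable \<mu> (f\<^sub>l \<tau>)" for \<tau>
      by (rule Bochner_Integration.integrable_bound[OF f1]) (auto simp: f\<^sub>l_def)
    have fl2: "integrable \<mu> (\<lambda>y. (cmod (f\<^sub>l \<tau> y))\<^sup>2)" for \<tau>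
      by (rule Bochner_Integration.integrable_bound[OF f2]) (auto simp: f\<^sub>l_def)
    have low: "cmod (T x - conv_op K \<mu> (f\<^sub>l \<tau>) x) \<le> l \<tau>" for x \<tau>
    proof -
      have i: "integrable \<mu> (\<lambda>y. cmod (K (x - y)))"
        using integrable_conv_op[OF \<mu>(2) K M.integrable_const[of 1]] by simp
      have "T x - conv_op K \<mu> (f\<^sub>l \<tau>) x = conv_op K \<mu> (\<lambda>y. f y - f\<^sub>l \<tau> y) x"
        unfolding T_def by (rule conv_op_diff[OF \<mu>(2) K f1 fl1, symmetric])
      also have "cmod \<dots> \<le> (\<integral>y. cmod (K (x - y) * (f y - f\<^sub>l \<tau> y)) \<partial>\<mu>)"
        unfolding conv_op_def by (rule integral_norm_bound)
      also have "\<dots> \<le> (\<integral>y. cmod (K (x - y)) * (l \<tau> / A) \<partial>\<mu>)"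
      proof (rule integral_mono')
        show "integrable \<mu> (\<lambda>y. cmod (K (x - y)) * (l \<tau> / A))" using i by simp
        have "cmod (f y - f\<^sub>l \<tau> y) \<le> l \<tau> / A" for y
          using A(1) by (auto simp: f\<^sub>l_def l_def field_simps not_less)
        then show "cmod (K (x - y) * (f y - f\<^sub>l \<tau> y)) \<le> cmod (K (x - y)) * (l \<tau> / A)" for y
          unfolding norm_mult by (intro mult_left_mono) auto
        show "0 \<le> cmod (K (x - y)) * (l \<tau> / A)" for y using A(1) by (simp add: l_def)
      qed
      also have "\<dots> = (\<integral>y. cmod (K (x - y)) \<partial>\<mu>) * (l \<tau> / A)" by simp
      also have "\<dots> \<le> A * (l \<tau> / A)" by (intro mult_right_mono A) (use A in \<open>simp add: l_def\<close>)
      finally show ?thesis using A(1) by simp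
    qed
    \<comment> \<open>Where |T| exceeds 2 l \<tau> the low part accounts for less than half of it,
      so the image of the high part is at least |T| / 2; squaring gives the 4.\<close>
    have hi: "(cmod (T x))\<^sup>2 * indicator {0<..<(cmod (T x) / 2) powr q} \<tau> \<le> 4 * (cmod (conv_op K \<mu> (f\<^sub>l \<tau>) x))\<^sup>2" for x \<tau>
    proof (cases "\<tau> \<in> {0<..<(cmod (T x) / 2) powr q}")
      case True
      then have "l \<tau> < cmod (T x) / 2" using l[of \<tau> "cmod (T x) / 2"] by auto
      then have "cmod (T x) \<le> 2 * cmod (conv_op K \<mu> (f\<^sub>l \<tau>) x)"
        using low[of x \<tau>] norm_triangle_ineq2[of "T x" "conv_op K \<mu> (f\<^sub>l \<tau>) x"] by linarith
      then have "(cmod (T x))\<^sup>2 \<le> (2 * cmod (conv_op K \<mu> (f\<^sub>l \<tau>) x))\<^sup>2" by (intro power_mono) auto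
      then show ?thesis using True by (simp add: power_mult_distrib)
    qed simp
    have Tl2: "integrable \<nu> (\<lambda>x. (cmod (conv_op K \<mu> (f\<^sub>l \<tau>) x))\<^sup>2)" for \<tau>
    proof (rule N.integrable_const_bound)
      show "AE x in \<nu>. norm ((cmod (conv_op K \<mu> (f\<^sub>l \<tau>) x))\<^sup>2) \<le> (B\<^sub>0 * (\<integral>y. cmod (f\<^sub>l \<tau> y) \<partial>\<mu>))\<^sup>2"
        using cmod_conv_op_le[OF \<mu>(2) K fl1] by (auto intro!: power_mono)
      show "(\<lambda>x. (cmod (conv_op K \<mu> (f\<^sub>l \<tau>) x))\<^sup>2) \<in> borel_measurable \<nu>"
        using borel_measurable_conv_op[OF \<mu> K(1) fl] by measurable
    qed
    let ?i = "\<lambda>x \<tau>. ennreal ((cmod (T x))\<^sup>2 * indicator {0<..<(cmod (T x) / 2) powr q} \<tau>)"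
      and ?j = "\<lambda>y \<tau>. ennreal (4 * B * (cmod (f y))\<^sup>2 * indicator {0<..<(A * cmod (f y)) powr q} \<tau>)"
    have step: "(\<integral>\<^sup>+x. ?i x \<tau> \<partial>\<nu>)
        \<le> (\<integral>\<^sup>+y. ?j y \<tau> \<partial>\<mu>)" for \<tau>
    proof (cases "\<tau> > 0")
      case True
      have "(\<integral>\<^sup>+x. ?i x \<tau> \<partial>\<nu>)
        \<le> (\<integral>\<^sup>+x. ennreal (4 * (cmod (conv_op K \<mu> (f\<^sub>l \<tau>) x))\<^sup>2) \<partial>\<nu>)"
        by (intro nn_integral_mono ennreal_leI hi)
      also have "\<dots> = ennreal (4 * (\<integral>x. (cmod (conv_op K \<mu> (f\<^sub>l \<tau>) x))\<^sup>2 \<partial>\<nu>))"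
        by (subst nn_integral_eq_integral) (use Tl2 in auto)
      also have "\<dots> \<le> ennreal (4 * (B * (\<integral>y. (cmod (f\<^sub>l \<tau> y))\<^sup>2 \<partial>\<mu>)))"
        by (intro ennreal_leI mult_left_mono B(2) fl fl1 fl2) auto
      also have "\<dots> = (\<integral>\<^sup>+y. ennreal (4 * B * (cmod (f\<^sub>l \<tau> y))\<^sup>2) \<partial>\<mu>)"
        by (subst nn_integral_eq_integral) (use fl2 B(1) in \<open>auto simp: mult.assoc\<close>)
      also have "\<dots> = (\<integral>\<^sup>+y. ?j y \<tau> \<partial>\<mu>)"
        using True l[OF True] A(1) by (intro nn_integral_cong) (auto simp: f\<^sub>l_def indicator_def)
      finally show ?thesis .
    qed simp
    \<comment> \<open>The level set is that of |T| / 2, hence the division by 2 powr q; together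
      with the factor 4 from \<open>hi\<close> this yields the constant
      \<open>2 powr p\<close>.\<close>
    have "ennreal ((\<integral>x. cmod (T x) powr p \<partial>\<nu>) / 2 powr q) = (\<integral>\<^sup>+x. ennreal (cmod (T x) powr p / 2 powr q) \<partial>\<nu>)"
      by (subst nn_integral_eq_integral) (use Tp in auto)
    also have "\<dots> = (\<integral>\<^sup>+x. (\<integral>\<^sup>+\<tau>. ?i x \<tau> \<partial>lborel) \<partial>\<nu>)"
      by (subst meas, simp, intro nn_integral_cong)
         (simp add: powr_divide q_def powr_diff sq divide_simps)
    also have "\<dots> = (\<integral>\<^sup>+\<tau>. (\<integral>\<^sup>+x. ?i x \<tau> \<partial>\<nu>) \<partial>lborel)"
      unfolding indicator_def of_bool_def greaterThanLessThan_iff by (rule P.Fubini'[symmetric]) measurable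
    also have "\<dots> \<le> (\<integral>\<^sup>+\<tau>. (\<integral>\<^sup>+y. ?j y \<tau> \<partial>\<mu>) \<partial>lborel)"
      by (intro nn_integral_mono step)
    also have "\<dots> = (\<integral>\<^sup>+y. (\<integral>\<^sup>+\<tau>. ?j y \<tau> \<partial>lborel) \<partial>\<mu>)"
      unfolding indicator_def of_bool_def greaterThanLessThan_iff by (rule P'.Fubini') measurable
    also have "\<dots> = (\<integral>\<^sup>+y. ennreal (4 * B * A powr q * cmod (f y) powr p) \<partial>\<mu>)"
      by (subst meas, use B(1) in simp, intro nn_integral_cong)
         (use A(1) in \<open>simp add: powr_mult q_def powr_diff sq divide_simps mult.assoc\<close>)
    also have "\<dots> = ennreal (4 * B * A powr q * (\<integral>y. cmod (f y) powr p \<partial>\<mu>))"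
      by (subst nn_integral_eq_integral) (use fp B(1) in auto)
    finally have "(\<integral>x. cmod (T x) powr p \<partial>\<nu>) / 2 powr q \<le> 4 * B * A powr q * (\<integral>y. cmod (f y) powr p \<partial>\<mu>)"
      using B(1) by (subst (asm) ennreal_le_iff) auto
    moreover have "2 powr p = 4 * (2::real) powr q" by (simp add: q_def powr_diff)
    ultimately show ?thesis by (simp add: pos_divide_le_eq mult_ac flip: q_def)
  qed
  then show "(\<integral>x. cmod (conv_op K \<mu> f x) powr p \<partial>\<nu>) \<le> 2 powr p * B * A powr (p - 2) * (\<integral>y. cmod (f y) powr p \<partial>\<mu>)"
    by (simp add: T_def)
qed

section \<open>Gaussian averages\<close>

text \<open>Cut space into shells of width sqrt r about w. On the k-th shell the Gaussian is at most
  exp (- k^2 / 4), and the shell lies in a ball of radius (k + 1) sqrt r. Ball growth then yields r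
  powr (s / 2) times a convergent series.\<close>

lemma gaussian_ball_growth:
  fixes \<mu> :: "'a::euclidean_space measure"
  assumes \<mu>: "finite_measure \<mu>" "sets \<mu> = sets borel" and g: "ball_growth C s \<mu>"
  obtains D where "D > 0"
    "\<And>r w. r > 0 \<Longrightarrow> (\<integral>y. exp (- (norm (w - y))\<^sup>2 / (4 * r)) \<partial>\<mu>) \<le> D * r powr (s / 2)"
proof
  interpret finite_measure \<mu> by fact
  note [measurable_cong] = \<mu>(2)
  define a where "a = (\<lambda>k::nat. exp (- (real k)\<^sup>2 / 4) * (real k + 1) powr s)"
  \<comment> \<open>The sign of \<open>C\<close> is not prescribed by
    \<open>ball_growth\<close>.\<close>
  define C' where "C' = max C 0"
  have a0: "a k \<ge> 0" for k by (simp add: a_def)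
  have sm: "summable a"
  proof (rule summable_comparison_test_ev)
    have "eventually (\<lambda>k. a k \<le> 1 / real k ^ 2) sequentially"
      unfolding a_def by real_asymp
    then show "eventually (\<lambda>k. norm (a k) \<le> 1 / real k ^ 2) sequentially"
      using a0 by simp
    show "summable (\<lambda>k. 1 / real k ^ 2)" using inverse_power_summable[of 2, where 'a=real] by (simp add: field_simps)
  qed
  \<comment> \<open>The summand 1 makes \<open>D\<close> strictly positive even when the series
    contributes nothing; \<open>conv_op_L2_bound\<close> divides by such a constant.\<close>
  define D where "D = 1 + C' * suminf a"
  show "D > 0" unfolding D_def C'_def using suminf_nonneg[OF sm a0] by (simp add: add_pos_nonneg)
  fix r :: real and w :: 'a assume r: "r > 0"
  let ?E = "\<lambda>y. exp (- (norm (w - y))\<^sup>2 / (4 * r))"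
  let ?B = "\<lambda>k::nat. ball w ((real k + 1) * sqrt r)"
  have pt: "ennreal (?E y) \<le> (\<Sum>k. ennreal (exp (- (real k)\<^sup>2 / 4)) * indicator (?B k) y)" for y
  proof -
    define k where "k = nat \<lfloor>norm (w - y) / sqrt r\<rfloor>"
    have k: "real k \<le> norm (w - y) / sqrt r" "norm (w - y) / sqrt r < real k + 1"
      using r by (simp_all add: k_def)
    have "y \<in> ?B k" using k(2) r by (simp add: dist_norm field_simps)
    moreover have "(real k)\<^sup>2 \<le> (norm (w - y) / sqrt r)\<^sup>2" using k(1) by (intro power_mono) auto
    then have "?E y \<le> exp (- (real k)\<^sup>2 / 4)" using r by (simp add: power_divide)
    ultimately have "ennreal (?E y) \<le> ennreal (exp (- (real k)\<^sup>2 / 4)) * indicator (?B k) y"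
      by (simp add: ennreal_leI)
    also have "\<dots> \<le> (\<Sum>k. ennreal (exp (- (real k)\<^sup>2 / 4)) * indicator (?B k) y)"
    proof -
      have "h k \<le> (\<Sum>k. h k)" for h :: "nat \<Rightarrow> ennreal"
        using sum_le_suminf[of h "{k}"] by simp
      then show ?thesis .
    qed
    finally show ?thesis .
  qed
  have "(\<integral>\<^sup>+y. ennreal (?E y) \<partial>\<mu>) \<le> (\<integral>\<^sup>+y. (\<Sum>k. ennreal (exp (- (real k)\<^sup>2 / 4)) * indicator (?B k) y) \<partial>\<mu>)"
    by (intro nn_integral_mono pt)
  also have "\<dots> = (\<Sum>k. ennreal (exp (- (real k)\<^sup>2 / 4)) * emeasure \<mu> (?B k))"
  proof -
    have B: "?B k \<in> sets \<mu>" for k by (simp add: \<mu>(2))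
    then have "(\<lambda>y. ennreal (exp (- (real k)\<^sup>2 / 4)) * indicator (?B k) y) \<in> borel_measurable \<mu>" for k
      by (intro borel_measurable_times_ennreal borel_measurable_indicator) auto
    then show ?thesis
      by (subst nn_integral_suminf) (simp_all only: nn_integral_cmult_indicator[OF B])
  qed
  also have "\<dots> \<le> (\<Sum>k. ennreal (C' * r powr (s / 2) * a k))"
  proof (rule suminf_le)
    fix k
    have "emeasure \<mu> (?B k) \<le> ennreal (C * ((real k + 1) * sqrt r) powr s)"
      using g r unfolding ball_growth_def by (simp add: add_pos_nonneg)
    also have "\<dots> \<le> ennreal (C' * ((real k + 1) * sqrt r) powr s)"
      by (intro ennreal_leI mult_right_mono) (auto simp: C'_def)
    also have "((real k + 1) * sqrt r) powr s = (real k + 1) powr s * r powr (s / 2)"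
      using r by (simp add: powr_mult powr_powr flip: powr_half_sqrt)
    finally have "ennreal (exp (- (real k)\<^sup>2 / 4)) * emeasure \<mu> (?B k)
      \<le> ennreal (exp (- (real k)\<^sup>2 / 4)) * ennreal (C' * ((real k + 1) powr s * r powr (s / 2)))"
      by (rule mult_left_mono) simp
    also have "\<dots> = ennreal (C' * r powr (s / 2) * a k)"
      by (simp add: a_def C'_def mult_ac flip: ennreal_mult)
    finally show "ennreal (exp (- (real k)\<^sup>2 / 4)) * emeasure \<mu> (?B k) \<le> ennreal (C' * r powr (s / 2) * a k)" .
  qed auto
  also have "\<dots> = ennreal (C' * r powr (s / 2) * suminf a)"
    using sm a0 by (subst suminf_ennreal2) (auto simp: C'_def suminf_mult)
  also have "\<dots> \<le> ennreal (D * r powr (s / 2))"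
    by (rule ennreal_leI) (simp add: D_def algebra_simps)
  finally have le: "(\<integral>\<^sup>+y. ennreal (?E y) \<partial>\<mu>) \<le> ennreal (D * r powr (s / 2))" .
  have "integrable \<mu> ?E" by (rule integrable_const_bound[of _ 1]) (use r in auto)
  then have "(\<integral>\<^sup>+y. ennreal (?E y) \<partial>\<mu>) = ennreal (\<integral>y. ?E y \<partial>\<mu>)"
    by (intro nn_integral_eq_integral) auto
  with le \<open>D > 0\<close> show "(\<integral>y. ?E y \<partial>\<mu>) \<le> D * r powr (s / 2)"
    by (simp add: ennreal_le_iff)
qed

section \<open>Heat regularisation of a measure\<close>

definition heat_conv :: "real \<Rightarrow> 'a::euclidean_space measure \<Rightarrow> 'a \<Rightarrow> real" where
  "heat_conv s \<kappa> x = (\<integral>v. exp (- (norm (x - v))\<^sup>2 / (4 * s)) / sqrt (4 * pi * s) ^ DIM('a) \<partial>\<kappa>)"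

lemma heat_conv_nonneg: "heat_conv s \<kappa> x \<ge> 0" if "s > 0"
  unfolding heat_conv_def using that by (intro Bochner_Integration.integral_nonneg) simp

lemma borel_measurable_heat_conv [measurable]:
  assumes "finite_measure \<kappa>" "sets \<kappa> = sets borel"
  shows "heat_conv s \<kappa> \<in> borel_measurable borel"
proof -
  interpret finite_measure \<kappa> by fact
  note [measurable_cong] = assms(2)
  show ?thesis unfolding heat_conv_def by measurable
qed

lemma heat_conv_le:
  fixes \<kappa> :: "'a::euclidean_space measure"
  assumes "finite_measure \<kappa>" "sets \<kappa> = sets borel" "s > 0"
  shows "heat_conv s \<kappa> x \<le> measure \<kappa> UNIV / sqrt (4 * pi * s) ^ DIM('a)"
proof -
  interpret finite_measure \<kappa> by fact
  note [measurable_cong] = assms(2)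
  have "heat_conv s \<kappa> x \<le> (\<integral>v. 1 / sqrt (4 * pi * s) ^ DIM('a) \<partial>\<kappa>)"
    unfolding heat_conv_def
  proof (rule integral_mono')
    show "exp (- (norm (x - v))\<^sup>2 / (4 * s)) / sqrt (4 * pi * s) ^ DIM('a) \<le> 1 / sqrt (4 * pi * s) ^ DIM('a)" for v
      using assms(3) by (intro divide_right_mono) auto
  qed (use assms(3) in auto)
  also have "space \<kappa> = UNIV" using sets_eq_imp_space_eq[OF assms(2)] by simp
  then have "(\<integral>v. 1 / sqrt (4 * pi * s) ^ DIM('a) \<partial>\<kappa>) = measure \<kappa> UNIV / sqrt (4 * pi * s) ^ DIM('a)"
    by simp
  finally show ?thesis .
qed

text \<open>Convolution with the heat kernel at time s is the Fourier multiplier exp (- s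
  |\<xi>|^2). The Gaussian transform is explicit and integrable, so Fubini alone proves the
  inversion formula, for any finite measure.\<close>

lemma heat_conv_fourier:
  fixes \<kappa> :: "'a::euclidean_space measure"
  assumes \<kappa>: "finite_measure \<kappa>" "sets \<kappa> = sets borel" and s: "s > 0"
  shows "complex_of_real (heat_conv s \<kappa> x)
    = (\<integral>\<xi>. complex_of_real (exp (- s * (norm \<xi>)\<^sup>2) / (2 * pi) ^ DIM('a)) * (\<integral>v. cis (-1 * (\<xi> \<bullet> v)) \<partial>\<kappa>) * cis (\<xi> \<bullet> x) \<partial>lborel)"
proof -
  interpret finite_measure \<kappa> by fact
  let ?c = "complex_of_real (1 / (2 * pi) ^ DIM('a))"
  let ?\<Phi> = "\<lambda>\<xi>. ?c * (complex_of_real (exp (- s * (norm \<xi>)\<^sup>2)) * cis (\<xi> \<bullet> x))"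
  have i: "integrable lborel ?\<Phi>"
    by (intro integrable_mult_right gaussian_fourier(1)[OF s])
  \<comment> \<open>The constant of the Gaussian transform, divided by the inversion factor (2
    pi)^d, is the normalisation of the heat kernel.\<close>
  have q: "sqrt (pi / s) ^ DIM('a) / (2 * pi) ^ DIM('a) = 1 / sqrt (4 * pi * s) ^ DIM('a)"
  proof -
    have "sqrt (pi / s) * sqrt (4 * pi * s) = sqrt ((2 * pi)\<^sup>2)"
      using s by (simp add: real_sqrt_mult[symmetric] power2_eq_square)
    also have "\<dots> = 2 * pi" by (rule real_sqrt_unique) auto
    finally have "sqrt (pi / s) / (2 * pi) = 1 / sqrt (4 * pi * s)" using s by (simp add: field_simps)
    then show ?thesis by (metis power_divide power_one)
  qed
  have "(\<integral>\<xi>. complex_of_real (exp (- s * (norm \<xi>)\<^sup>2) / (2 * pi) ^ DIM('a)) * (\<integral>v. cis (-1 * (\<xi> \<bullet> v)) \<partial>\<kappa>) * cis (\<xi> \<bullet> x) \<partial>lborel)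
     = (\<integral>\<xi>. ?\<Phi> \<xi> * (\<integral>v. cis (-1 * (\<xi> \<bullet> v)) * 1 \<partial>\<kappa>) \<partial>lborel)"
    by (intro Bochner_Integration.integral_cong) (simp_all add: mult_ac)
  also have "\<dots> = (\<integral>v. 1 * (\<integral>\<xi>. ?\<Phi> \<xi> * cis (-1 * (\<xi> \<bullet> v)) \<partial>lborel) \<partial>\<kappa>)"
    by (rule integral_cis_Fubini[OF \<kappa> i integrable_const])
  also have "\<dots> = (\<integral>v. complex_of_real (exp (- (norm (x - v))\<^sup>2 / (4 * s)) / sqrt (4 * pi * s) ^ DIM('a)) \<partial>\<kappa>)"
  proof (rule Bochner_Integration.integral_cong)
    fix v
    have "(\<integral>\<xi>. ?\<Phi> \<xi> * cis (-1 * (\<xi> \<bullet> v)) \<partial>lborel) = (\<integral>\<xi>. ?c * (complex_of_real (exp (- s * (norm \<xi>)\<^sup>2)) * cis (\<xi> \<bullet> (x - v))) \<partial>lborel)"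
      by (simp add: mult.assoc cis_mult inner_diff_right)
    also have "\<dots> = ?c * complex_of_real (sqrt (pi / s) ^ DIM('a) * exp (- (norm (x - v))\<^sup>2 / (4 * s)))"
      by (simp only: integral_mult_right_zero gaussian_fourier(2)[OF s])
    also have "\<dots> = complex_of_real (exp (- (norm (x - v))\<^sup>2 / (4 * s)) * (sqrt (pi / s) ^ DIM('a) / (2 * pi) ^ DIM('a)))"
      by simp
    finally show "1 * (\<integral>\<xi>. ?\<Phi> \<xi> * cis (-1 * (\<xi> \<bullet> v)) \<partial>lborel) = complex_of_real (exp (- (norm (x - v))\<^sup>2 / (4 * s)) / sqrt (4 * pi * s) ^ DIM('a))"
      unfolding q by simp
  qed simp
  finally show ?thesis by (simp only: heat_conv_def integral_complex_of_real)
qed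

text \<open>By Fubini the Gaussian is averaged over \<mu> first, uniformly in its centre x - v, so
  only the total mass of \<kappa> enters.\<close>

lemma integral_heat_conv_le:
  fixes \<mu> \<kappa> :: "'a::euclidean_space measure"
  assumes \<kappa>: "finite_measure \<kappa>" "sets \<kappa> = sets borel" and \<mu>: "finite_measure \<mu>" "sets \<mu> = sets borel"
    and s: "s > 0" and D: "\<And>w. (\<integral>y. exp (- (norm (w - y))\<^sup>2 / (4 * s)) \<partial>\<mu>) \<le> D"
  shows "(\<integral>y. heat_conv s \<kappa> (x - y) \<partial>\<mu>) \<le> measure \<kappa> UNIV * D / sqrt (4 * pi * s) ^ DIM('a)"
proof -
  interpret M: finite_measure \<mu> by fact
  interpret N: finite_measure \<kappa> by fact
  interpret P: pair_sigma_finite \<mu> \<kappa> ..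
  note [measurable_cong] = \<kappa>(2) \<mu>(2)
  let ?q = "sqrt (4 * pi * s) ^ DIM('a)"
  have q: "?q > 0" using s by simp
  have "finite_measure (\<mu> \<Otimes>\<^sub>M \<kappa>)"
    by (intro finite_measure_pair_measure \<mu> \<kappa>)
  then interpret PF: finite_measure "\<mu> \<Otimes>\<^sub>M \<kappa>" .
  have int: "integrable (\<mu> \<Otimes>\<^sub>M \<kappa>) (\<lambda>(y, v). exp (- (norm (x - y - v))\<^sup>2 / (4 * s)) / ?q)"
    by (rule PF.integrable_const_bound[of _ "1 / ?q"]) (use q s in \<open>auto simp: divide_right_mono\<close>)
  have sp: "space \<kappa> = UNIV" using sets_eq_imp_space_eq[OF \<kappa>(2)] by simp
  have "(\<integral>y. heat_conv s \<kappa> (x - y) \<partial>\<mu>) = (\<integral>v. (\<integral>y. exp (- (norm (x - y - v))\<^sup>2 / (4 * s)) / ?q \<partial>\<mu>) \<partial>\<kappa>)"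
    unfolding heat_conv_def by (rule P.Fubini_integral[OF int, symmetric])
  also have "\<dots> \<le> (\<integral>v. D / ?q \<partial>\<kappa>)"
  proof (rule integral_mono')
    fix v
    have "(\<integral>y. exp (- (norm (x - y - v))\<^sup>2 / (4 * s)) \<partial>\<mu>) \<le> D"
      using D[of "x - v"] by (simp add: algebra_simps)
    then show "(\<integral>y. exp (- (norm (x - y - v))\<^sup>2 / (4 * s)) / ?q \<partial>\<mu>) \<le> D / ?q"
      using q by (simp add: divide_right_mono)
    have "0 \<le> D" using D[of 0] order_trans[OF Bochner_Integration.integral_nonneg] by (metis exp_ge_zero)
    then show "0 \<le> D / ?q" using q by simp
  qed simp
  also have "\<dots> = measure \<kappa> UNIV * D / ?q" by (simp add: sp)
  finally show ?thesis .
qed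

section \<open>Dyadic frequency pieces\<close>

text \<open>The multiplier 1 - (1 - exp (- u)) ^ N is a combination of Gaussians in \<xi> when u = s |\<xi>|^2, and is
  flat to order N at u = 0; flatness makes the dyadic differences small at low frequencies.\<close>

definition flat_cutoff :: "nat \<Rightarrow> real \<Rightarrow> real" where
  "flat_cutoff N u = 1 - (1 - exp (- u)) ^ N"

text \<open>Signed binomial coefficients. The term k = 0 of the expansion cancels the leading 1 of
  \<open>flat_cutoff\<close>, which leaves genuine Gaussians with k \<ge> 1 only.\<close>

definition flat_coeff :: "nat \<Rightarrow> nat \<Rightarrow> real" where
  "flat_coeff N k = - ((-1) ^ k * real (N choose k))"

lemma flat_cutoff_eq_sum: "flat_cutoff N u = (\<Sum>k=1..N. flat_coeff N k * exp (- (real k * u)))"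
proof -
  have "(1 - exp (- u)) ^ N = (- exp (- u) + 1) ^ N" by (simp add: add.commute)
  also have "\<dots> = (\<Sum>k\<le>N. real (N choose k) * (- exp (- u)) ^ k)" by (subst binomial_ring) simp
  also have "\<dots> = 1 + (\<Sum>k=1..N. real (N choose k) * (- exp (- u)) ^ k)"
    by (simp add: atMost_atLeast0 sum.atLeast_Suc_atMost)
  also have "(\<Sum>k=1..N. real (N choose k) * (- exp (- u)) ^ k) = - (\<Sum>k=1..N. flat_coeff N k * exp (- (real k * u)))"
    unfolding sum_negf[symmetric]
  proof (rule sum.cong)
    fix k
    have "(- exp (- u)) ^ k = (-1) ^ k * exp (- (real k * u))"
      by (simp add: power_minus[of "exp (- u)"] exp_of_nat_mult[symmetric])
    then show "real (N choose k) * (- exp (- u)) ^ k = - (flat_coeff N k * exp (- (real k * u)))"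
      by (simp add: flat_coeff_def)
  qed simp
  finally show ?thesis by (simp add: flat_cutoff_def)
qed

text \<open>The value of the cutoff at frequency 0. It is the reason why the regularisations
  converge to the kernel itself and not to a multiple of it.\<close>

lemma sum_flat_coeff: "N \<ge> 1 \<Longrightarrow> (\<Sum>k=1..N. flat_coeff N k) = 1"
  using flat_cutoff_eq_sum[of N 0] by (simp add: flat_cutoff_def power_0_left)

lemma sum_abs_flat_coeff_le: "(\<Sum>k=1..N. \<bar>flat_coeff N k\<bar>) \<le> 2 ^ N"
proof -
  have "(\<Sum>k=1..N. \<bar>flat_coeff N k\<bar>) = real (\<Sum>k=1..N. N choose k)"
    by (simp add: flat_coeff_def abs_mult)
  also have "\<dots> \<le> real (\<Sum>k\<le>N. N choose k)"
    by (intro of_nat_mono sum_mono2) auto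
  finally show ?thesis by (simp add: choose_row_sum)
qed

text \<open>The first bound is Bernoulli's inequality. For the second put x = exp (- u): the
  difference factors as (1 - x)^N ((1 + x)^N - 1). The first factor is flat at u = 0 and at most u
  powr a for every a up to N, since 1 - x is at most both u and 1; the second supplies the decay exp
  (- u).\<close>

lemma flat_cutoff_bounds:
  assumes u: "u \<ge> 0"
  shows "\<bar>flat_cutoff N u\<bar> \<le> real N * exp (- u)"
    "N \<ge> 1 \<Longrightarrow> 0 < a \<Longrightarrow> a \<le> real N \<Longrightarrow> \<bar>flat_cutoff N u - flat_cutoff N (2 * u)\<bar> \<le> 2 ^ N * u powr a * exp (- u)"
proof -
  define x where "x = exp (- u)"
  have x: "0 < x" "x \<le> 1" using u by (auto simp: x_def)
  have "1 + real N * (- x) \<le> (1 + (- x)) ^ N" using x by (intro Bernoulli_inequality) auto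
  moreover have "(1 - x) ^ N \<le> 1" using x by (intro power_le_one) auto
  ultimately show "\<bar>flat_cutoff N u\<bar> \<le> real N * exp (- u)"
    by (simp add: flat_cutoff_def x_def[symmetric])
  assume N: "N \<ge> 1" and a: "0 < a" "a \<le> real N"
  \<comment> \<open>Convexity: on [0, 1] the power lies below its chord.\<close>
  have pw: "(1 + x) ^ n \<le> 1 + (2 ^ n - 1) * x" for n
  proof (induction n)
    case (Suc n)
    have "(1 + x) ^ Suc n \<le> (1 + (2 ^ n - 1) * x) * (1 + x)"
      using mult_right_mono[OF Suc, of "1 + x"] x by (simp add: mult.commute)
    also have "\<dots> = 1 + 2 ^ n * x + (2 ^ n - 1) * (x * x)" by (simp add: algebra_simps)
    also have "\<dots> \<le> 1 + 2 ^ n * x + (2 ^ n - 1) * x"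
      using x by (intro add_left_mono mult_left_mono) (auto simp: mult_left_le)
    finally show ?case by (simp add: algebra_simps)
  qed simp
  have "(1 - x) ^ N \<le> u powr a"
  proof (cases "u \<le> 1")
    case True
    have "1 - x \<le> u" using exp_ge_add_one_self[of "- u"] by (simp add: x_def)
    then have "(1 - x) ^ N \<le> u ^ N" using x by (intro power_mono) auto
    also have "\<dots> \<le> u powr a"
    proof (cases "u = 0")
      case False
      then have "u ^ N = u powr real N" using u by (simp add: powr_realpow)
      also have "\<dots> \<le> u powr a" using True False u a by (intro powr_mono') auto
      finally show ?thesis .
    qed (use N in \<open>simp add: power_0_left\<close>)
    finally show ?thesis .
  next
    case False
    have "(1 - x) ^ N \<le> 1" using x by (intro power_le_one) auto
    also have "\<dots> \<le> u powr a" using False a by (intro ge_one_powr_ge_zero) auto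
    finally show ?thesis .
  qed
  moreover have "(1 + x) ^ N - 1 \<le> 2 ^ N * x" using pw[of N] x by (simp add: algebra_simps)
  moreover have "0 \<le> (1 + x) ^ N - 1" using x one_le_power[of "1 + x" N] by simp
  ultimately have "(1 - x) ^ N * ((1 + x) ^ N - 1) \<le> u powr a * (2 ^ N * x)" "0 \<le> (1 - x) ^ N * ((1 + x) ^ N - 1)"
    using x by (auto intro!: mult_mono mult_nonneg_nonneg)
  moreover have "flat_cutoff N u - flat_cutoff N (2 * u) = (1 - x) ^ N * ((1 + x) ^ N - 1)"
  proof -
    have "exp (- (2 * u)) = x * x" by (simp add: x_def flip: exp_add)
    then have "1 - exp (- (2 * u)) = (1 - x) * (1 + x)" by (simp add: algebra_simps)
    then show ?thesis
      by (simp add: flat_cutoff_def x_def[symmetric] power_mult_distrib right_diff_distrib)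
  qed
  ultimately show "\<bar>flat_cutoff N u - flat_cutoff N (2 * u)\<bar> \<le> 2 ^ N * u powr a * exp (- u)"
    by (simp add: x_def mult_ac)
qed

text \<open>The multiplier \<open>flat_cutoff N\<close> at s |\<xi>|^2 applied to \<kappa>, written
  through heat kernels so that ball growth remains applicable.\<close>

definition flat_conv :: "nat \<Rightarrow> real \<Rightarrow> 'a::euclidean_space measure \<Rightarrow> 'a \<Rightarrow> real" where
  "flat_conv N s \<kappa> x = (\<Sum>k=1..N. flat_coeff N k * heat_conv (real k * s) \<kappa> x)"

lemma borel_measurable_flat_conv [measurable]:
  assumes "finite_measure \<kappa>" "sets \<kappa> = sets borel"
  shows "flat_conv N s \<kappa> \<in> borel_measurable borel"
proof -
  note [measurable] = borel_measurable_heat_conv[OF assms]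
  show ?thesis unfolding flat_conv_def by measurable
qed

lemma flat_conv_fourier:
  fixes \<kappa> :: "'a::euclidean_space measure"
  assumes \<kappa>: "finite_measure \<kappa>" "sets \<kappa> = sets borel" and s: "s > 0"
  shows "complex_of_real (flat_conv N s \<kappa> x)
    = (\<integral>\<xi>. complex_of_real (flat_cutoff N (s * (norm \<xi>)\<^sup>2) / (2 * pi) ^ DIM('a)) * (\<integral>v. cis (-1 * (\<xi> \<bullet> v)) \<partial>\<kappa>) * cis (\<xi> \<bullet> x) \<partial>lborel)"
    "integrable lborel (\<lambda>\<xi>. complex_of_real (flat_cutoff N (s * (norm \<xi>)\<^sup>2) / (2 * pi) ^ DIM('a)) * (\<integral>v. cis (-1 * (\<xi> \<bullet> v)) \<partial>\<kappa>) * cis (\<xi> \<bullet> x))"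
proof -
  interpret finite_measure \<kappa> by fact
  note [measurable_cong] = \<kappa>(2)
  have sp: "space \<kappa> = UNIV" using sets_eq_imp_space_eq[OF \<kappa>(2)] by simp
  let ?k = "\<lambda>\<xi>. \<integral>v. cis (-1 * (\<xi> \<bullet> v)) \<partial>\<kappa>"
  let ?F = "\<lambda>\<xi>. complex_of_real (flat_cutoff N (s * (norm \<xi>)\<^sup>2) / (2 * pi) ^ DIM('a)) * ?k \<xi> * cis (\<xi> \<bullet> x)"
  have k: "cmod (?k \<xi>) \<le> measure \<kappa> UNIV" for \<xi>
  proof -
    have "cmod (?k \<xi>) \<le> (\<integral>v. cmod (cis (-1 * (\<xi> \<bullet> v))) \<partial>\<kappa>)" by (rule integral_norm_bound)
    then show ?thesis by (simp add: sp)
  qed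
  let ?h = "\<lambda>s \<xi>. complex_of_real (exp (- s * (norm \<xi>)\<^sup>2) / (2 * pi) ^ DIM('a)) * ?k \<xi> * cis (\<xi> \<bullet> x)"
  have i: "integrable lborel (?h s)" if "s > 0" for s
  proof (rule Bochner_Integration.integrable_bound)
    show "integrable lborel (\<lambda>\<xi>::'a. exp (- s * (norm \<xi>)\<^sup>2) * (measure \<kappa> UNIV / (2 * pi) ^ DIM('a)))"
      by (intro integrable_mult_left integrable_gaussian that)
    show "AE \<xi> in lborel. norm (?h s \<xi>) \<le> norm (exp (- s * (norm \<xi>)\<^sup>2) * (measure \<kappa> UNIV / (2 * pi) ^ DIM('a)))"
      using k by (intro AE_I2) (simp add: norm_mult norm_divide norm_power abs_mult divide_simps)
  qed measurable
  have eq: "?F \<xi>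
      = (\<Sum>k=1..N. complex_of_real (flat_coeff N k) * ?h (real k * s) \<xi>)" for \<xi>
    unfolding flat_cutoff_eq_sum by (simp add: sum_divide_distrib sum_distrib_right sum_distrib_left mult_ac)
  have ik: "integrable lborel (\<lambda>\<xi>. complex_of_real (flat_coeff N k) * ?h (real k * s) \<xi>)" if "k \<in> {1..N}" for k
    by (intro integrable_mult_right i) (use that s in simp)
  show "integrable lborel (\<lambda>\<xi>. ?F \<xi>)"
    unfolding eq by (rule Bochner_Integration.integrable_sum) (rule ik)
  have "(\<integral>\<xi>. ?F \<xi> \<partial>lborel)
     = (\<Sum>k=1..N. complex_of_real (flat_coeff N k) * (\<integral>\<xi>. ?h (real k * s) \<xi> \<partial>lborel))"
    unfolding eq by (subst Bochner_Integration.integral_sum[OF ik]) (simp_all only: integral_mult_right_zero)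
  also have "\<dots> = (\<Sum>k=1..N. complex_of_real (flat_coeff N k * heat_conv (real k * s) \<kappa> x))"
    by (rule sum.cong) (use s in \<open>simp_all add: heat_conv_fourier[OF \<kappa>]\<close>)
  finally show "complex_of_real (flat_conv N s \<kappa> x)
    = (\<integral>\<xi>. ?F \<xi> \<partial>lborel)"
    by (simp add: flat_conv_def)
qed

lemma abs_flat_conv_le:
  fixes \<kappa> :: "'a::euclidean_space measure"
  assumes H: "\<And>k. k \<in> {1..N} \<Longrightarrow> \<bar>heat_conv (real k * s) \<kappa> x\<bar> \<le> H" "0 \<le> H"
  shows "\<bar>flat_conv N s \<kappa> x\<bar> \<le> 2 ^ N * H"
proof -
  have "\<bar>flat_conv N s \<kappa> x\<bar> \<le> (\<Sum>k=1..N. \<bar>flat_coeff N k * heat_conv (real k * s) \<kappa> x\<bar>)"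
    unfolding flat_conv_def by (rule sum_abs)
  also have "\<dots> \<le> (\<Sum>k=1..N. \<bar>flat_coeff N k\<bar> * H)"
    by (intro sum_mono) (auto simp: abs_mult intro!: mult_left_mono H(1))
  also have "\<dots> \<le> 2 ^ N * H"
    unfolding sum_distrib_right[symmetric] by (intro mult_right_mono sum_abs_flat_coeff_le H(2))
  finally show ?thesis .
qed

section \<open>Estimates for the pieces and their summation\<close>

lemma sqrt_power_eq_powr: "sqrt r ^ n = r powr (real n / 2)" if "r > 0"
  using that by (simp add: powr_half_sqrt[symmetric] powr_realpow[symmetric] powr_powr)

text \<open>A heat average at time k s costs (k s) powr ((m - d) / 2). Since m \<le> d this does not
  increase with k, so every term is dominated by its value at time s and only the coefficient sum is
  lost.\<close>

lemma integral_abs_flat_conv_le: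
  fixes \<mu> \<kappa> :: "'a::euclidean_space measure"
  assumes \<kappa>: "finite_measure \<kappa>" "sets \<kappa> = sets borel" and \<mu>: "finite_measure \<mu>" "sets \<mu> = sets borel"
    and D: "D \<ge> 0" "\<And>r w. r > 0 \<Longrightarrow> (\<integral>y. exp (- (norm (w - y))\<^sup>2 / (4 * r)) \<partial>\<mu>) \<le> D * r powr (m / 2)"
    and s: "s > 0" and m: "m \<le> real DIM('a)"
  shows "integrable \<mu> (\<lambda>y. \<bar>flat_conv N s \<kappa> (x - y)\<bar>)"
    "(\<integral>y. \<bar>flat_conv N s \<kappa> (x - y)\<bar> \<partial>\<mu>) \<le> 2 ^ N * (measure \<kappa> UNIV * D) * s powr ((m - real DIM('a)) / 2)"
proof -
  interpret finite_measure \<mu> by fact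
  note [measurable_cong] = \<mu>(2)
  note [measurable] = borel_measurable_heat_conv[OF \<kappa>]
  define M where "M = measure \<kappa> UNIV"
  have M: "M \<ge> 0" by (simp add: M_def)
  have hi: "integrable \<mu> (\<lambda>y. heat_conv r \<kappa> (x - y))" if "r > 0" for r
    by (rule integrable_const_bound[of _ "measure \<kappa> UNIV / sqrt (4 * pi * r) ^ DIM('a)"])
       (use heat_conv_le[OF \<kappa> that] heat_conv_nonneg[OF that, of \<kappa>] in auto)
  have h: "(\<integral>y. heat_conv (real k * s) \<kappa> (x - y) \<partial>\<mu>) \<le> M * D * s powr ((m - real DIM('a)) / 2)" if k: "k \<in> {1..N}" for k
  proof -
    let ?r = "real k * s"
    have r: "?r > 0" "?r \<ge> s" using k s by auto
    have "(\<integral>y. heat_conv ?r \<kappa> (x - y) \<partial>\<mu>) \<le> M * (D * ?r powr (m / 2)) / sqrt (4 * pi * ?r) ^ DIM('a)"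
      unfolding M_def by (rule integral_heat_conv_le[OF \<kappa> \<mu> r(1) D(2)[OF r(1)]])
    also have "\<dots> \<le> M * (D * ?r powr (m / 2)) / sqrt ?r ^ DIM('a)"
    proof (intro divide_left_mono power_mono real_sqrt_le_mono)
      show "?r \<le> 4 * pi * ?r" using mult_right_mono[of 1 "4 * pi" ?r] r(1) pi_gt3 by linarith
    qed (use r M D(1) in auto)
    also have "sqrt ?r ^ DIM('a) = ?r powr (real DIM('a) / 2)"
      by (rule sqrt_power_eq_powr[OF r(1)])
    also have "M * (D * ?r powr (m / 2)) / ?r powr (real DIM('a) / 2) = M * D * ?r powr ((m - real DIM('a)) / 2)"
      by (simp add: diff_divide_distrib powr_diff)
    also have "\<dots> \<le> M * D * s powr ((m - real DIM('a)) / 2)"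
      using M D(1) m r s by (intro mult_left_mono powr_mono2') auto
    finally show ?thesis .
  qed
  have int: "integrable \<mu> (\<lambda>y. \<Sum>k=1..N. \<bar>flat_coeff N k\<bar> * heat_conv (real k * s) \<kappa> (x - y))"
    by (intro Bochner_Integration.integrable_sum integrable_mult_right hi) (use s in auto)
  have le: "\<bar>flat_conv N s \<kappa> (x - y)\<bar> \<le> (\<Sum>k=1..N. \<bar>flat_coeff N k\<bar> * heat_conv (real k * s) \<kappa> (x - y))" for y
    unfolding flat_conv_def
    by (rule order_trans[OF sum_abs sum_mono]) (use s in \<open>auto simp: abs_mult heat_conv_nonneg\<close>)
  show "integrable \<mu> (\<lambda>y. \<bar>flat_conv N s \<kappa> (x - y)\<bar>)"
  proof (rule Bochner_Integration.integrable_bound[OF int])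
    show "(\<lambda>y. \<bar>flat_conv N s \<kappa> (x - y)\<bar>) \<in> borel_measurable \<mu>"
      using borel_measurable_flat_conv[OF \<kappa>] by measurable
  qed (use le order_trans[OF le abs_ge_self] in auto)
  have "(\<integral>y. \<bar>flat_conv N s \<kappa> (x - y)\<bar> \<partial>\<mu>) \<le> (\<integral>y. (\<Sum>k=1..N. \<bar>flat_coeff N k\<bar> * heat_conv (real k * s) \<kappa> (x - y)) \<partial>\<mu>)"
    by (rule integral_mono'[OF int le order_trans[OF abs_ge_zero le]])
  also have "\<dots> = (\<Sum>k=1..N. \<bar>flat_coeff N k\<bar> * (\<integral>y. heat_conv (real k * s) \<kappa> (x - y) \<partial>\<mu>))"
    using hi s by (subst Bochner_Integration.integral_sum) auto
  also have "\<dots> \<le> (\<Sum>k=1..N. \<bar>flat_coeff N k\<bar> * (M * D * s powr ((m - real DIM('a)) / 2)))"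
    by (intro sum_mono mult_left_mono h) auto
  also have "\<dots> \<le> 2 ^ N * (M * D * s powr ((m - real DIM('a)) / 2))"
    unfolding sum_distrib_right[symmetric] using M D(1) by (intro mult_right_mono sum_abs_flat_coeff_le) auto
  finally show "(\<integral>y. \<bar>flat_conv N s \<kappa> (x - y)\<bar> \<partial>\<mu>) \<le> 2 ^ N * (measure \<kappa> UNIV * D) * s powr ((m - real DIM('a)) / 2)"
    by (simp add: M_def mult_ac)
qed

text \<open>A pointwise substitute for Minkowski's inequality: each a_j is at most \<theta>^j times
  the largest a_i / \<theta>^i. The loss \<theta>^(- j p) on the right is paid for later by the
  geometric gain of the pieces.\<close>

lemma sum_powr_le_geometric:
  fixes a :: "nat \<Rightarrow> real"
  assumes \<theta>: "0 < \<theta>" "\<theta> < 1" and a: "\<And>j. a j \<ge> 0" and p: "p \<ge> 0"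
  shows "(\<Sum>j\<le>J. a j) powr p \<le> (1 / (1 - \<theta>)) powr p * (\<Sum>j\<le>J. (a j / \<theta> ^ j) powr p)"
proof -
  define m where "m = Max ((\<lambda>j. a j / \<theta> ^ j) ` {..J})"
  have "m \<in> (\<lambda>j. a j / \<theta> ^ j) ` {..J}" unfolding m_def by (rule Max_in) auto
  then obtain i where i: "i \<le> J" "m = a i / \<theta> ^ i" by auto
  have m0: "m \<ge> 0" using i a \<theta> by simp
  have "a j \<le> m * \<theta> ^ j" if "j \<le> J" for j
  proof -
    have "a j / \<theta> ^ j \<le> m" unfolding m_def by (rule Max_ge) (use that in auto)
    then show ?thesis using \<theta> by (simp add: divide_le_eq)
  qed
  then have "(\<Sum>j\<le>J. a j) \<le> (\<Sum>j\<le>J. m * \<theta> ^ j)" by (intro sum_mono) auto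
  also have "\<dots> = m * (\<Sum>j\<le>J. \<theta> ^ j)" by (simp add: sum_distrib_left)
  also have "\<dots> \<le> m * (1 / (1 - \<theta>))"
  proof (rule mult_left_mono[OF _ m0])
    have "(\<Sum>j\<le>J. \<theta> ^ j) = (1 - \<theta> ^ Suc J) / (1 - \<theta>)"
      using \<theta> by (simp add: sum_gp0)
    also have "\<dots> \<le> 1 / (1 - \<theta>)" using \<theta> by (intro divide_right_mono) auto
    finally show "(\<Sum>j\<le>J. \<theta> ^ j) \<le> 1 / (1 - \<theta>)" .
  qed
  finally have "(\<Sum>j\<le>J. a j) powr p \<le> (m * (1 / (1 - \<theta>))) powr p"
    using p a by (intro powr_mono2 sum_nonneg) auto
  also have "\<dots> = (1 / (1 - \<theta>)) powr p * m powr p"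
    using m0 \<theta> by (simp add: powr_mult powr_divide mult.commute)
  also have "\<dots> \<le> (1 / (1 - \<theta>)) powr p * (\<Sum>j\<le>J. (a j / \<theta> ^ j) powr p)"
  proof (rule mult_left_mono)
    show "m powr p \<le> (\<Sum>j\<le>J. (a j / \<theta> ^ j) powr p)"
      unfolding i(2) by (rule member_le_sum) (use i(1) in auto)
  qed simp
  finally show ?thesis .
qed

text \<open>This bound blows up as s tends to 0. It only guarantees bounded kernels and
  integrability, and enters no constant of the estimates.\<close>

lemma abs_flat_conv_bound:
  fixes \<kappa> :: "'a::euclidean_space measure"
  assumes \<kappa>: "finite_measure \<kappa>" "sets \<kappa> = sets borel" and s: "s > 0"
  shows "\<bar>flat_conv N s \<kappa> x\<bar> \<le> 2 ^ N * (measure \<kappa> UNIV / sqrt s ^ DIM('a))"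
proof (rule abs_flat_conv_le)
  fix k assume k: "k \<in> {1..N}"
  have r: "real k * s > 0" "s \<le> real k * s" using k s by auto
  have "\<bar>heat_conv (real k * s) \<kappa> x\<bar> \<le> measure \<kappa> UNIV / sqrt (4 * pi * (real k * s)) ^ DIM('a)"
    using heat_conv_le[OF \<kappa> r(1), of x] heat_conv_nonneg[OF r(1), of \<kappa> x] by simp
  also have "\<dots> \<le> measure \<kappa> UNIV / sqrt s ^ DIM('a)"
  proof (intro divide_left_mono power_mono real_sqrt_le_mono)
    have "1 * (real k * s) \<le> 4 * pi * (real k * s)"
      using r pi_gt3 by (intro mult_right_mono) linarith+
    then show "s \<le> 4 * pi * (real k * s)" using r by linarith
  qed (use r s in auto)
  finally show "\<bar>heat_conv (real k * s) \<kappa> x\<bar> \<le> measure \<kappa> UNIV / sqrt s ^ DIM('a)" .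
qed (use s in simp)

text \<open>For j > 0 the subtracted scale 2 (1/2)^j is that of index j - 1, so the sums telescope;
  the piece j = 0 keeps all low frequencies.\<close>

definition flat_piece :: "nat \<Rightarrow> nat \<Rightarrow> 'a::euclidean_space measure \<Rightarrow> 'a \<Rightarrow> real" where
  "flat_piece N j \<kappa> x = flat_conv N ((1/2) ^ j) \<kappa> x - (if j = 0 then 0 else flat_conv N (2 * (1/2) ^ j) \<kappa> x)"

lemma sum_flat_piece: "(\<Sum>j\<le>J. flat_piece N j \<kappa> x) = flat_conv N ((1/2) ^ J) \<kappa> x"
  by (induction J) (simp_all add: flat_piece_def)

text \<open>Exactly what the estimates use about the averaging measure. With \<open>M\<close> and
  \<open>A\<close> fixed first, the constants are the same for all mollifications of the
  sphere.\<close>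

definition decaying :: "real \<Rightarrow> real \<Rightarrow> 'a::euclidean_space measure \<Rightarrow> bool" where
  "decaying M A \<kappa> \<longleftrightarrow> finite_measure \<kappa> \<and> sets \<kappa> = sets borel \<and> measure \<kappa> UNIV \<le> M \<and>
     (\<forall>\<xi>. cmod (\<integral>v. cis (\<xi> \<bullet> v) \<partial>\<kappa>) * norm \<xi> powr ((real DIM('a) - 1) / 2) \<le> A)"

text \<open>On the Fourier side the flatness factor (\<sigma> |\<xi>|^2) powr ((d - 1) / 4) meets
  the decay |\<xi>| powr (- (d - 1) / 2) of \<kappa>: the powers of |\<xi>| cancel and \<sigma> powr
  ((d - 1) / 4) remains as the gain. What is left is a Gaussian majorant, as
  \<open>conv_op_L2_bound\<close> requires.\<close>

lemma flat_piece_Lp_bound: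
  fixes \<mu> \<nu> :: "'a::euclidean_space measure"
  assumes d: "DIM('a) \<ge> 2"
    and \<mu>: "finite_measure \<mu>" "sets \<mu> = sets borel" and \<nu>: "finite_measure \<nu>" "sets \<nu> = sets borel"
    and D\<mu>: "D\<mu> > 0" "\<And>r w. r > 0 \<Longrightarrow> (\<integral>y. exp (- (norm (w - y))\<^sup>2 / (4 * r)) \<partial>\<mu>) \<le> D\<mu> * r powr (m\<^sub>\<mu> / 2)"
    and D\<nu>: "D\<nu> > 0" "\<And>r w. r > 0 \<Longrightarrow> (\<integral>y. exp (- (norm (w - y))\<^sup>2 / (4 * r)) \<partial>\<nu>) \<le> D\<nu> * r powr (m\<^sub>\<nu> / 2)"
    and m: "m\<^sub>\<mu> \<le> real DIM('a)" and p: "p \<ge> 2" and M: "M \<ge> 0" and A: "A \<ge> 0"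
  defines "e \<equiv> (real DIM('a) - 1 - p * real DIM('a) + (p - 1) * m\<^sub>\<mu> + m\<^sub>\<nu>) / 2"
  obtains C where "C \<ge> 0"
    "\<And>\<kappa> j. decaying M A \<kappa> \<Longrightarrow>
       conv_bounded p \<mu> \<nu> (\<lambda>z. complex_of_real (flat_piece (DIM('a)) j \<kappa> z)) (C * ((1/2) ^ j) powr e)"
proof
  let ?d = "real DIM('a)" and ?N = "DIM('a)"
  define a where "a = (?d - 1) / 4"
  have a: "0 < a" "a \<le> real ?N" using d by (simp_all add: a_def)
  \<comment> \<open>\<open>M\<close> serves the piece j = 0, \<open>A\<close> the pieces j > 0; the
    1 keeps \<open>S\<close> positive.\<close>
  define S where "S = 2 ^ ?N * (M + A + 1)"
  have S: "S > 0" using M A by (simp add: S_def)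
  \<comment> \<open>The factor 2 counts the two scales of a piece; the 1 again ensures positivity,
    needed because \<open>conv_op_Lp_bound\<close> divides by the bound.\<close>
  define E where "E = 2 * 2 ^ ?N * (M * D\<mu>) + 1"
  have E: "E > 0" using M D\<mu>(1) by (simp add: E_def add_nonneg_pos)
  define C where "C = 2 powr p * (S\<^sup>2 * pi ^ ?N * D\<mu> * D\<nu>) * E powr (p - 2)"
  show "C \<ge> 0" using D\<mu>(1) D\<nu>(1) by (simp add: C_def)
  fix \<kappa> :: "'a measure" and j
  assume "decaying M A \<kappa>"
  then have \<kappa>: "finite_measure \<kappa>" "sets \<kappa> = sets borel" and \<kappa>M: "measure \<kappa> UNIV \<le> M"
    and dec: "\<And>\<xi>::'a. cmod (\<integral>v. cis (\<xi> \<bullet> v) \<partial>\<kappa>) * norm \<xi> powr ((?d - 1) / 2) \<le> A"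
    by (simp_all add: decaying_def)
  interpret KF: finite_measure \<kappa> by fact
  interpret MF: finite_measure \<mu> by fact
  note [measurable_cong] = \<kappa>(2)
  have sp: "space \<kappa> = UNIV" using sets_eq_imp_space_eq[OF \<kappa>(2)] by simp
  define \<sigma> where "\<sigma> = (1/2 :: real) ^ j"
  have \<sigma>: "\<sigma> > 0" by (simp add: \<sigma>_def)
  define K where "K = (\<lambda>z. complex_of_real (flat_piece ?N j \<kappa> z))"
  have Pm[measurable]: "flat_piece ?N j \<kappa> \<in> borel_measurable borel"
    unfolding flat_piece_def using borel_measurable_flat_conv[OF \<kappa>] by measurable
  have Km: "K \<in> borel_measurable borel" unfolding K_def by measurable
  have Kabs: "cmod (K x) = \<bar>flat_piece ?N j \<kappa> x\<bar>" for x by (simp add: K_def)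
  have KB: "cmod (K x) \<le> 2 ^ ?N * (measure \<kappa> UNIV / sqrt \<sigma> ^ ?N) + 2 ^ ?N * (measure \<kappa> UNIV / sqrt (2 * \<sigma>) ^ ?N)" for x
    using abs_flat_conv_bound[OF \<kappa> \<sigma>, of ?N x] abs_flat_conv_bound[OF \<kappa>, of "2 * \<sigma>" ?N x] \<sigma>
    unfolding Kabs flat_piece_def \<sigma>_def[symmetric] by (auto simp: add_increasing2)
  define A' where "A' = E * \<sigma> powr ((m\<^sub>\<mu> - ?d) / 2)"
  have A': "A' > 0" using E \<sigma> by (simp add: A'_def)
  have KA: "(\<integral>y. cmod (K (x - y)) \<partial>\<mu>) \<le> A'" for x
  proof -
    note b = integral_abs_flat_conv_le[OF \<kappa> \<mu> less_imp_le[OF D\<mu>(1)] D\<mu>(2) _ m, of _ ?N x]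
    have b': "(\<integral>y. \<bar>flat_conv ?N s \<kappa> (x - y)\<bar> \<partial>\<mu>) \<le> 2 ^ ?N * (M * D\<mu>) * \<sigma> powr ((m\<^sub>\<mu> - ?d) / 2)"
      if "s \<ge> \<sigma>" for s
    proof -
      have "(\<integral>y. \<bar>flat_conv ?N s \<kappa> (x - y)\<bar> \<partial>\<mu>) \<le> 2 ^ ?N * (measure \<kappa> UNIV * D\<mu>) * s powr ((m\<^sub>\<mu> - ?d) / 2)"
        by (rule b(2)) (use that \<sigma> in auto)
      also have "\<dots> \<le> 2 ^ ?N * (M * D\<mu>) * \<sigma> powr ((m\<^sub>\<mu> - ?d) / 2)"
        using that \<sigma> m \<kappa>M D\<mu>(1) M by (intro mult_mono powr_mono2') auto
      finally show ?thesis .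
    qed
    have i: "integrable \<mu> (\<lambda>y. \<bar>flat_conv ?N s \<kappa> (x - y)\<bar>)" if "s > 0" for s
      by (rule b(1)) (use that in auto)
    have "(\<integral>y. cmod (K (x - y)) \<partial>\<mu>) \<le> (\<integral>y. \<bar>flat_conv ?N \<sigma> \<kappa> (x - y)\<bar> + \<bar>flat_conv ?N (2 * \<sigma>) \<kappa> (x - y)\<bar> \<partial>\<mu>)"
    proof (rule integral_mono')
      show "integrable \<mu> (\<lambda>y. \<bar>flat_conv ?N \<sigma> \<kappa> (x - y)\<bar> + \<bar>flat_conv ?N (2 * \<sigma>) \<kappa> (x - y)\<bar>)"
        by (intro Bochner_Integration.integrable_add i) (use \<sigma> in auto)
      show "cmod (K (x - y)) \<le> \<bar>flat_conv ?N \<sigma> \<kappa> (x - y)\<bar> + \<bar>flat_conv ?N (2 * \<sigma>) \<kappa> (x - y)\<bar>" for y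
        unfolding Kabs flat_piece_def \<sigma>_def[symmetric] by auto
    qed auto
    also have "\<dots> = (\<integral>y. \<bar>flat_conv ?N \<sigma> \<kappa> (x - y)\<bar> \<partial>\<mu>) + (\<integral>y. \<bar>flat_conv ?N (2 * \<sigma>) \<kappa> (x - y)\<bar> \<partial>\<mu>)"
      by (rule Bochner_Integration.integral_add) (rule i, use \<sigma> in simp)+
    also have "\<dots> \<le> 2 * 2 ^ ?N * (M * D\<mu>) * \<sigma> powr ((m\<^sub>\<mu> - ?d) / 2)"
      using b'[of \<sigma>] b'[of "2 * \<sigma>"] \<sigma> by simp
    also have "\<dots> \<le> A'" unfolding A'_def E_def by (intro mult_right_mono) auto
    finally show ?thesis .
  qed
  define k where "k = (\<lambda>\<xi>. \<integral>v. cis (-1 * (\<xi> \<bullet> v)) \<partial>\<kappa>)"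
  have km[measurable]: "k \<in> borel_measurable borel" unfolding k_def by measurable
  have kM: "cmod (k \<xi>) \<le> M" for \<xi>
  proof -
    have "cmod (k \<xi>) \<le> (\<integral>v. cmod (cis (-1 * (\<xi> \<bullet> v))) \<partial>\<kappa>)" unfolding k_def by (rule integral_norm_bound)
    also have "\<dots> = measure \<kappa> UNIV" by (simp add: sp)
    finally show ?thesis using \<kappa>M by linarith
  qed
  \<comment> \<open>The decay hypothesis is used at - \<xi>, which has the same norm, because
    \<open>k\<close> carries the opposite phase.\<close>
  have kA: "cmod (k \<xi>) * norm \<xi> powr ((?d - 1) / 2) \<le> A" for \<xi>
    using dec[of "- \<xi>"] by (simp add: k_def)
  define mult where "mult = (\<lambda>\<xi>::'a. flat_cutoff ?N (\<sigma> * (norm \<xi>)\<^sup>2) - (if j = 0 then 0 else flat_cutoff ?N (2 * \<sigma> * (norm \<xi>)\<^sup>2)))"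
  have cm[measurable]: "flat_cutoff ?N \<in> borel_measurable borel" unfolding flat_cutoff_def by measurable
  have mm[measurable]: "mult \<in> borel_measurable borel" unfolding mult_def by measurable
  define \<Psi> where "\<Psi> = (\<lambda>\<xi>. complex_of_real (mult \<xi> / (2 * pi) ^ ?N) * k \<xi>)"
  have \<Psi>m: "\<Psi> \<in> borel_measurable borel" unfolding \<Psi>_def by measurable
  have K\<Psi>: "K x = (\<integral>\<xi>. \<Psi> \<xi> * cis (\<xi> \<bullet> x) \<partial>lborel)" for x
  proof (cases "j = 0")
    case True
    then show ?thesis
      using flat_conv_fourier(1)[OF \<kappa> \<sigma>, of ?N x] by (simp add: K_def flat_piece_def \<Psi>_def mult_def \<sigma>_def k_def)
  next
    case False
    have 2: "2 * \<sigma> > 0" using \<sigma> by simp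
    have "K x = complex_of_real (flat_conv ?N \<sigma> \<kappa> x) - complex_of_real (flat_conv ?N (2 * \<sigma>) \<kappa> x)"
      using False by (simp add: K_def flat_piece_def \<sigma>_def)
    also have "\<dots> = (\<integral>\<xi>. \<Psi> \<xi> * cis (\<xi> \<bullet> x) \<partial>lborel)"
      unfolding flat_conv_fourier(1)[OF \<kappa> \<sigma>] flat_conv_fourier(1)[OF \<kappa> 2]
      by (subst Bochner_Integration.integral_diff[symmetric, OF flat_conv_fourier(2)[OF \<kappa> \<sigma>] flat_conv_fourier(2)[OF \<kappa> 2]],
          intro Bochner_Integration.integral_cong)
         (use False in \<open>simp_all add: \<Psi>_def mult_def k_def diff_divide_distrib left_diff_distrib\<close>)
    finally show ?thesis .
  qed
  have \<Psi>S: "cmod (\<Psi> \<xi>) \<le> S * \<sigma> powr a * exp (- \<sigma> * (norm \<xi>)\<^sup>2)" for \<xi>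
  proof -
    let ?u = "\<sigma> * (norm \<xi>)\<^sup>2"
    have u: "?u \<ge> 0" using \<sigma> by simp
    have pi1: "(2 * pi) ^ ?N \<ge> 1" using pi_gt3 by (intro one_le_power) linarith
    have "cmod (\<Psi> \<xi>) = \<bar>mult \<xi>\<bar> * cmod (k \<xi>) / (2 * pi) ^ ?N"
      by (simp add: \<Psi>_def norm_mult norm_divide norm_power abs_mult)
    also have "\<dots> \<le> \<bar>mult \<xi>\<bar> * cmod (k \<xi>)"
      using divide_left_mono[OF pi1, of "\<bar>mult \<xi>\<bar> * cmod (k \<xi>)"] by simp
    also have "\<dots> \<le> S * \<sigma> powr a * exp (- ?u)"
    \<comment> \<open>The piece j = 0 is not small at low frequencies, but its scale is \<sigma> =
      1, so no gain is required and the total mass suffices.\<close>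
    proof (cases "j = 0")
      case True
      have "real ?N \<le> 2 ^ ?N" using of_nat_less_two_power[of ?N, where 'a=real] by simp
      then have "real ?N * exp (- ?u) \<le> 2 ^ ?N * exp (- ?u)" by (intro mult_right_mono) auto
      with flat_cutoff_bounds(1)[OF u, of ?N] have "\<bar>flat_cutoff ?N ?u\<bar> \<le> 2 ^ ?N * exp (- ?u)"
        by (rule order_trans)
      then have "\<bar>mult \<xi>\<bar> \<le> 2 ^ ?N * exp (- ?u)" using True by (simp add: mult_def)
      then have "\<bar>mult \<xi>\<bar> * cmod (k \<xi>) \<le> 2 ^ ?N * exp (- ?u) * (M + A + 1)"
        using kM[of \<xi>] A by (intro mult_mono) auto
      then show ?thesis using True by (simp add: S_def \<sigma>_def mult_ac)
    next
      case False
      have "\<bar>mult \<xi>\<bar> \<le> 2 ^ ?N * ?u powr a * exp (- ?u)"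
        using flat_cutoff_bounds(2)[OF u _ a] d False by (simp add: mult_def mult.assoc)
      then have "\<bar>mult \<xi>\<bar> * cmod (k \<xi>) \<le> 2 ^ ?N * ?u powr a * exp (- ?u) * cmod (k \<xi>)"
        by (rule mult_right_mono) simp
      also have "?u powr a = \<sigma> powr a * norm \<xi> powr ((?d - 1) / 2)"
      proof -
        have "((norm \<xi>)\<^sup>2) powr a = norm \<xi> powr ((?d - 1) / 2)"
        proof (cases "\<xi> = 0")
          case True then show ?thesis using a by simp
        next
          case False
          then have "((norm \<xi>)\<^sup>2) powr a = (norm \<xi> powr 2) powr a" by (simp add: powr_numeral)
          also have "\<dots> = norm \<xi> powr (2 * a)" by (rule powr_powr)
          also have "2 * a = (?d - 1) / 2" by (simp add: a_def)
          finally show ?thesis .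
        qed
        then show ?thesis using \<sigma> by (simp add: powr_mult)
      qed
      also have "2 ^ ?N * (\<sigma> powr a * norm \<xi> powr ((?d - 1) / 2)) * exp (- ?u) * cmod (k \<xi>)
          = 2 ^ ?N * \<sigma> powr a * exp (- ?u) * (cmod (k \<xi>) * norm \<xi> powr ((?d - 1) / 2))" by (simp add: mult_ac)
      also have "\<dots> \<le> 2 ^ ?N * \<sigma> powr a * exp (- ?u) * (M + A + 1)"
        using kA[of \<xi>] M by (intro mult_left_mono) auto
      finally show ?thesis by (simp add: S_def mult_ac)
    qed
    finally show ?thesis by simp
  qed
  define B where "B = (S * \<sigma> powr a)\<^sup>2 * (sqrt (pi / \<sigma>) ^ ?N)\<^sup>2 * (D\<mu> * \<sigma> powr (m\<^sub>\<mu> / 2)) * (D\<nu> * \<sigma> powr (m\<^sub>\<nu> / 2))"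
  have B: "B \<ge> 0" using D\<mu>(1) D\<nu>(1) by (simp add: B_def)
  have S\<sigma>: "S * \<sigma> powr a > 0" using S \<sigma> by simp
  have D\<nu>\<sigma>: "D\<nu> * \<sigma> powr (m\<^sub>\<nu> / 2) > 0" using D\<nu>(1) \<sigma> by simp
  have L2: "(\<integral>x. (cmod (conv_op K \<mu> g x))\<^sup>2 \<partial>\<nu>) \<le> B * (\<integral>y. (cmod (g y))\<^sup>2 \<partial>\<mu>)"
    if "g \<in> borel_measurable borel" "integrable \<mu> g" "integrable \<mu> (\<lambda>y. (cmod (g y))\<^sup>2)" for g
    unfolding B_def
    by (rule conv_op_L2_bound(2)[OF \<mu> \<nu> \<sigma> S\<sigma> \<Psi>m \<Psi>S K\<Psi> D\<mu>(2)[OF \<sigma>] D\<nu>\<sigma> D\<nu>(2)[OF \<sigma>] that])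
  note Lp = conv_op_Lp_bound[OF \<mu> \<nu> Km KB A' KA B L2 p]
  \<comment> \<open>Collecting the powers of \<sigma>: 2 a from the decay, - d from the squared
    Gaussian normalisation, half the dimension of each measure from its Gaussian averages, and (p -
    2) (m_\<mu> - d) / 2 from the bound on bounded functions. Their sum is \<open>e\<close>.\<close>
  have "B * A' powr (p - 2) = S\<^sup>2 * pi ^ ?N * D\<mu> * D\<nu> * E powr (p - 2) * \<sigma> powr e"
  proof -
    have "(sqrt (pi / \<sigma>) ^ ?N)\<^sup>2 = pi ^ ?N * \<sigma> powr (- ?d)"
    proof -
      have "(sqrt (pi / \<sigma>) ^ ?N)\<^sup>2 = ((sqrt (pi / \<sigma>))\<^sup>2) ^ ?N"
        by (simp only: power_mult[symmetric] mult.commute)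
      also have "(sqrt (pi / \<sigma>))\<^sup>2 = pi / \<sigma>" using \<sigma> by simp
      finally show ?thesis using \<sigma> by (simp add: power_divide powr_minus_divide powr_realpow)
    qed
    moreover have "A' powr (p - 2) = E powr (p - 2) * \<sigma> powr ((m\<^sub>\<mu> - ?d) / 2 * (p - 2))"
      using E \<sigma> by (simp add: A'_def powr_mult powr_powr)
    moreover have "(\<sigma> powr a)\<^sup>2 = \<sigma> powr (2 * a)" using \<sigma> by (simp add: power2_eq_square flip: powr_add)
    ultimately have "B * A' powr (p - 2) = S\<^sup>2 * pi ^ ?N * D\<mu> * D\<nu> * E powr (p - 2)
        * (\<sigma> powr (2 * a) * \<sigma> powr (- ?d) * \<sigma> powr (m\<^sub>\<mu> / 2) * \<sigma> powr (m\<^sub>\<nu> / 2) * \<sigma> powr ((m\<^sub>\<mu> - ?d) / 2 * (p - 2)))"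
      by (simp add: B_def power_mult_distrib mult_ac)
    also have "\<sigma> powr (2 * a) * \<sigma> powr (- ?d) * \<sigma> powr (m\<^sub>\<mu> / 2) * \<sigma> powr (m\<^sub>\<nu> / 2) * \<sigma> powr ((m\<^sub>\<mu> - ?d) / 2 * (p - 2)) = \<sigma> powr e"
      unfolding powr_add[symmetric] by (rule arg_cong[where f="\<lambda>x. \<sigma> powr x"]) (simp add: a_def e_def field_simps)
    finally show ?thesis .
  qed
  then have "2 powr p * B * A' powr (p - 2) = C * \<sigma> powr e" by (simp add: C_def mult_ac)
  from Lp[unfolded this]
  show "conv_bounded p \<mu> \<nu> (\<lambda>z. complex_of_real (flat_piece ?N j \<kappa> z)) (C * ((1/2) ^ j) powr e)"
    unfolding K_def \<sigma>_def .
qed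

text \<open>The constant is independent of the number J of pieces because the p-th powers of their
  norms decay geometrically when the exponent is positive.\<close>

lemma flat_conv_Lp_bound:
  fixes \<mu> \<nu> :: "'a::euclidean_space measure"
  assumes d: "DIM('a) \<ge> 2"
    and \<mu>: "finite_measure \<mu>" "sets \<mu> = sets borel" and \<nu>: "finite_measure \<nu>" "sets \<nu> = sets borel"
    and g: "ball_growth C\<^sub>1 m\<^sub>\<mu> \<mu>" "ball_growth C\<^sub>1 m\<^sub>\<nu> \<nu>"
    and m: "m\<^sub>\<mu> \<le> real DIM('a)" and p: "p \<ge> 2" and M: "M \<ge> 0" and A: "A \<ge> 0"
    and pos: "real DIM('a) - 1 - p * real DIM('a) + (p - 1) * m\<^sub>\<mu> + m\<^sub>\<nu> > 0"
  obtains C where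
    "\<And>\<kappa> J. decaying M A \<kappa> \<Longrightarrow>
       conv_bounded p \<mu> \<nu> (\<lambda>z. complex_of_real (flat_conv (DIM('a)) ((1/2) ^ J) \<kappa> z)) C"
proof -
  let ?N = "DIM('a)"
  let ?K = "\<lambda>\<kappa> J z. complex_of_real (flat_conv ?N ((1/2) ^ J) \<kappa> z)"
  obtain D\<mu> where D\<mu>: "D\<mu> > 0" "\<And>r w. r > 0 \<Longrightarrow> (\<integral>y. exp (- (norm (w - y))\<^sup>2 / (4 * r)) \<partial>\<mu>) \<le> D\<mu> * r powr (m\<^sub>\<mu> / 2)"
    using gaussian_ball_growth[OF \<mu> g(1)] by metis
  obtain D\<nu> where D\<nu>: "D\<nu> > 0" "\<And>r w. r > 0 \<Longrightarrow> (\<integral>y. exp (- (norm (w - y))\<^sup>2 / (4 * r)) \<partial>\<nu>) \<le> D\<nu> * r powr (m\<^sub>\<nu> / 2)"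
    using gaussian_ball_growth[OF \<nu> g(2)] by metis
  define e where "e = (real DIM('a) - 1 - p * real DIM('a) + (p - 1) * m\<^sub>\<mu> + m\<^sub>\<nu>) / 2"
  have e: "e > 0" using pos by (simp add: e_def)
  obtain C where C: "C \<ge> 0" and piece: "\<And>\<kappa> j. decaying M A \<kappa> \<Longrightarrow>
      conv_bounded p \<mu> \<nu> (\<lambda>z. complex_of_real (flat_piece ?N j \<kappa> z)) (C * ((1/2) ^ j) powr e)"
    using flat_piece_Lp_bound[OF d \<mu> \<nu> D\<mu> D\<nu> m p M A] unfolding e_def by blast
  \<comment> \<open>Half of the gain: the j-th piece carries \<phi>^(2 j). One factor \<phi>^j pays
    for the loss \<theta>^(- j p) of \<open>sum_powr_le_geometric\<close>, since \<theta> is the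
    p-th root of \<phi>; the other makes the series converge.\<close>
  define \<phi> where "\<phi> = (1/2 :: real) powr (e / 2)"
  define \<theta> where "\<theta> = \<phi> powr (1 / p)"
  have \<phi>: "0 < \<phi>" "\<phi> < 1"
    using e powr_less_mono2[of "e / 2" "1/2" 1] by (auto simp: \<phi>_def)
  have \<theta>: "0 < \<theta>" "\<theta> < 1"
    using \<phi> p powr_less_mono2[of "1 / p" \<phi> 1] by (auto simp: \<theta>_def)
  have "conv_bounded p \<mu> \<nu> (?K \<kappa> J) ((1 / (1 - \<theta>)) powr p * C * (1 / (1 - \<phi>)))"
    if dec: "decaying M A \<kappa>" for \<kappa> J
  proof (rule conv_boundedI)
    have \<kappa>: "finite_measure \<kappa>" "sets \<kappa> = sets borel" using dec by (simp_all add: decaying_def)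
    fix f :: "'a \<Rightarrow> complex"
    assume f: "f \<in> borel_measurable borel" "integrable \<mu> (\<lambda>y. cmod (f y) powr p)"
    define T where "T = (\<lambda>j. conv_op (\<lambda>z. complex_of_real (flat_piece ?N j \<kappa> z)) \<mu> f)"
    define X where "X = (\<integral>y. cmod (f y) powr p \<partial>\<mu>)"
    have X: "X \<ge> 0" by (simp add: X_def)
    have f\<mu>: "f \<in> borel_measurable \<mu>" using f(1) \<mu>(2) by (simp cong: measurable_cong_sets)
    have f1: "integrable \<mu> f" by (rule integrable_of_powr[OF \<mu>(1) f\<mu> f(2)]) (use p in simp)
    note [measurable] = borel_measurable_flat_conv[OF \<kappa>]
    have [measurable]: "flat_piece ?N j \<kappa> \<in> borel_measurable borel" for j
      unfolding flat_piece_def by measurable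
    have Kb: "cmod (complex_of_real (flat_piece ?N j \<kappa> x)) \<le> 2 ^ ?N * (measure \<kappa> UNIV / sqrt ((1/2) ^ j) ^ ?N)
        + 2 ^ ?N * (measure \<kappa> UNIV / sqrt (2 * (1/2) ^ j) ^ ?N)" for j x
      using abs_flat_conv_bound[OF \<kappa>, of "(1/2) ^ j" ?N x] abs_flat_conv_bound[OF \<kappa>, of "2 * (1/2) ^ j" ?N x]
      unfolding norm_of_real flat_piece_def by (auto simp: add_increasing2)
    have Ki: "integrable \<mu> (\<lambda>y. complex_of_real (flat_piece ?N j \<kappa> (x - y)) * f y)" for j x
      by (rule integrable_conv_op[OF \<mu>(2) _ Kb f1]) measurable
    have T: "integrable \<nu> (\<lambda>x. cmod (T j x) powr p)" "(\<integral>x. cmod (T j x) powr p \<partial>\<nu>) \<le> C * ((1/2) ^ j) powr e * X" for j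
      unfolding T_def X_def
      by (rule integrable_conv_op_powr[OF \<mu> \<nu> _ Kb f(1) f1], measurable, use p in simp)
         (rule conv_boundedD[OF piece[OF dec] f])
    have sum: "conv_op (?K \<kappa> J) \<mu> f x = (\<Sum>j\<le>J. T j x)" for x
      unfolding T_def conv_op_def sum_flat_piece[symmetric] of_real_sum sum_distrib_right
      by (rule Bochner_Integration.integral_sum) (rule Ki)
    have "(\<integral>x. cmod (conv_op (?K \<kappa> J) \<mu> f x) powr p \<partial>\<nu>)
      \<le> (\<integral>x. (1 / (1 - \<theta>)) powr p * (\<Sum>j\<le>J. cmod (T j x) powr p / (\<theta> ^ j) powr p) \<partial>\<nu>)"
    proof (rule integral_mono')
      show "integrable \<nu> (\<lambda>x. (1 / (1 - \<theta>)) powr p * (\<Sum>j\<le>J. cmod (T j x) powr p / (\<theta> ^ j) powr p))"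
        by (intro integrable_mult_right Bochner_Integration.integrable_sum integrable_divide T)
      fix x
      have "cmod (\<Sum>j\<le>J. T j x) powr p \<le> (\<Sum>j\<le>J. cmod (T j x)) powr p"
        using p by (intro powr_mono2 norm_sum) auto
      also have "\<dots> \<le> (1 / (1 - \<theta>)) powr p * (\<Sum>j\<le>J. (cmod (T j x) / \<theta> ^ j) powr p)"
        by (rule sum_powr_le_geometric[OF \<theta>]) (use p in auto)
      finally show "cmod (conv_op (?K \<kappa> J) \<mu> f x) powr p
          \<le> (1 / (1 - \<theta>)) powr p * (\<Sum>j\<le>J. cmod (T j x) powr p / (\<theta> ^ j) powr p)"
        using \<theta> by (simp add: sum powr_divide)
    qed (auto intro!: mult_nonneg_nonneg sum_nonneg)
    also have "\<dots> = (1 / (1 - \<theta>)) powr p * (\<Sum>j\<le>J. (\<integral>x. cmod (T j x) powr p \<partial>\<nu>) / (\<theta> ^ j) powr p)"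
      using T by (simp add: Bochner_Integration.integral_sum)
    also have "\<dots> \<le> (1 / (1 - \<theta>)) powr p * (\<Sum>j\<le>J. C * X * \<phi> ^ j)"
    proof (intro mult_left_mono sum_mono)
      fix j
      have \<theta>p: "(\<theta> ^ j) powr p = \<phi> ^ j"
      proof -
        have "(\<theta> ^ j) powr p = (\<theta> powr p) ^ j" using \<theta> by (simp add: powr_powr powr_power mult.commute flip: powr_realpow)
        also have "\<theta> powr p = \<phi>" using \<phi> p by (simp add: \<theta>_def powr_powr)
        finally show ?thesis .
      qed
      have "((1/2 :: real) ^ j) powr e = (1/2) powr (e / 2 * real (2 * j))"
        by (simp add: powr_powr mult.commute flip: powr_realpow)
      also have "\<dots> = \<phi> ^ (2 * j)"
        using \<phi>(1) unfolding powr_powr[symmetric] \<phi>_def[symmetric] by (rule powr_realpow)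
      finally have half: "((1/2 :: real) ^ j) powr e = \<phi> ^ j * \<phi> ^ j" by (simp add: mult_2 power_add)
      have "(\<integral>x. cmod (T j x) powr p \<partial>\<nu>) / (\<theta> ^ j) powr p \<le> (C * ((1/2) ^ j) powr e * X) / (\<theta> ^ j) powr p"
        by (intro divide_right_mono T) simp
      also have "\<dots> = C * X * \<phi> ^ j" using \<phi> unfolding \<theta>p half by simp
      finally show "(\<integral>x. cmod (T j x) powr p \<partial>\<nu>) / (\<theta> ^ j) powr p \<le> C * X * \<phi> ^ j" .
    qed simp
    also have "\<dots> \<le> (1 / (1 - \<theta>)) powr p * (C * X * (1 / (1 - \<phi>)))"
    proof (intro mult_left_mono)
      have "(\<Sum>j\<le>J. \<phi> ^ j) = (1 - \<phi> ^ Suc J) / (1 - \<phi>)" using \<phi> by (simp add: sum_gp0)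
      also have "\<dots> \<le> 1 / (1 - \<phi>)" using \<phi> by (intro divide_right_mono) auto
      finally have "C * X * (\<Sum>j\<le>J. \<phi> ^ j) \<le> C * X * (1 / (1 - \<phi>))" using C X by (intro mult_left_mono) auto
      then show "(\<Sum>j\<le>J. C * X * \<phi> ^ j) \<le> C * X * (1 / (1 - \<phi>))" by (simp add: sum_distrib_left)
    qed simp
    also have "\<dots> = ((1 / (1 - \<theta>)) powr p * C * (1 / (1 - \<phi>))) * X" by simp
    finally show "(\<integral>x. cmod (conv_op (?K \<kappa> J) \<mu> f x) powr p \<partial>\<nu>)
      \<le> ((1 / (1 - \<theta>)) powr p * C * (1 / (1 - \<phi>))) * (\<integral>y. cmod (f y) powr p \<partial>\<mu>)"
      by (simp only: X_def)
  qed
  then show ?thesis by (rule that)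
qed

text \<open>Dominated convergence twice, first in \<mu> and then in \<nu>, where a constant majorant
  is integrable. The common bound \<open>B\<close> of the kernels justifies the limits without
  entering the conclusion.\<close>

lemma conv_op_limit_bound:
  fixes f :: "'a::euclidean_space \<Rightarrow> complex" and K :: "nat \<Rightarrow> 'a \<Rightarrow> complex"
  assumes \<mu>: "finite_measure \<mu>" "sets \<mu> = sets borel" and \<nu>: "finite_measure \<nu>" "sets \<nu> = sets borel"
    and K: "\<And>n. K n \<in> borel_measurable borel" "\<And>n x. cmod (K n x) \<le> B"
    and L: "\<And>x. (\<lambda>n. K n x) \<longlonglongrightarrow> L x"
    and f: "f \<in> borel_measurable borel" "integrable \<mu> f" and p: "p > 0"
    and X: "\<And>n. (\<integral>x. cmod (conv_op (K n) \<mu> f x) powr p \<partial>\<nu>) \<le> X"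
  shows "(\<integral>x. cmod (conv_op L \<mu> f x) powr p \<partial>\<nu>) \<le> X"
proof -
  interpret N: finite_measure \<nu> by fact
  note [measurable_cong] = \<mu>(2) \<nu>(2)
  note [measurable] = K(1) f(1)
  have Lm[measurable]: "L \<in> borel_measurable borel"
    by (rule borel_measurable_LIMSEQ_metric[OF K(1) L])
  have lim: "(\<lambda>n. conv_op (K n) \<mu> f x) \<longlonglongrightarrow> conv_op L \<mu> f x" for x
    unfolding conv_op_def
  proof (rule integral_dominated_convergence)
    show "integrable \<mu> (\<lambda>y. B * cmod (f y))" using f(2) by simp
    show "AE y in \<mu>. (\<lambda>n. K n (x - y) * f y) \<longlonglongrightarrow> L (x - y) * f y"
      using L by (intro AE_I2 tendsto_mult tendsto_const)
    show "AE y in \<mu>. norm (K n (x - y) * f y) \<le> B * cmod (f y)" for n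
      using K(2) by (intro AE_I2) (simp add: norm_mult mult_right_mono)
    show "(\<lambda>y. L (x - y) * f y) \<in> borel_measurable \<mu>" by measurable
    show "(\<lambda>y. K n (x - y) * f y) \<in> borel_measurable \<mu>" for n by measurable
  qed
  have m: "conv_op (K n) \<mu> f \<in> borel_measurable \<nu>" for n
    using borel_measurable_conv_op[OF \<mu> K(1) f(1)] by measurable
  have mL: "conv_op L \<mu> f \<in> borel_measurable \<nu>"
    using borel_measurable_conv_op[OF \<mu> Lm f(1)] by measurable
  have "(\<lambda>n. \<integral>x. cmod (conv_op (K n) \<mu> f x) powr p \<partial>\<nu>) \<longlonglongrightarrow> (\<integral>x. cmod (conv_op L \<mu> f x) powr p \<partial>\<nu>)"
  proof (rule integral_dominated_convergence)
    show "integrable \<nu> (\<lambda>_. (B * (\<integral>y. cmod (f y) \<partial>\<mu>)) powr p)" by simp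
    show "AE x in \<nu>. (\<lambda>n. cmod (conv_op (K n) \<mu> f x) powr p) \<longlonglongrightarrow> cmod (conv_op L \<mu> f x) powr p"
      using p by (intro AE_I2 tendsto_powr' tendsto_norm lim tendsto_const) auto
    show "AE x in \<nu>. norm (cmod (conv_op (K n) \<mu> f x) powr p) \<le> (B * (\<integral>y. cmod (f y) \<partial>\<mu>)) powr p" for n
      using p by (intro AE_I2) (auto intro!: powr_mono2 cmod_conv_op_le[OF \<mu>(2) K f(2)])
    show "(\<lambda>x. cmod (conv_op L \<mu> f x) powr p) \<in> borel_measurable \<nu>" using mL by measurable
    show "(\<lambda>x. cmod (conv_op (K n) \<mu> f x) powr p) \<in> borel_measurable \<nu>" for n using m[of n] by measurable
  qed
  then show ?thesis using X by (intro LIMSEQ_le_const2) auto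
qed

section \<open>Removing the Gaussian regularisation\<close>

text \<open>The complement of the support is a union of open null sets, and by Lindelof countably
  many suffice, so it is null. The support lies in one ball, whose measure is finite by ball
  growth.\<close>

lemma finite_measure_compact_support:
  fixes M :: "'a::euclidean_space measure"
  assumes c: "compactly_supported_borel M" and g: "ball_growth C s M"
  shows "finite_measure M"
proof
  have sets: "sets M = sets borel" and K: "compact (measure_support M)"
    using c by (auto simp: compactly_supported_borel_def)
  have sp: "space M = UNIV" using sets_eq_imp_space_eq[OF sets] by simp
  define \<F> where "\<F> = {U. open U \<and> emeasure M U = 0}"
  obtain \<F>' where \<F>': "\<F>' \<subseteq> \<F>" "countable \<F>'" "\<Union>\<F>' = \<Union>\<F>"
    using Lindelof[of \<F>] by (auto simp: \<F>_def)
  have "(\<Union>U\<in>\<F>'. U) \<in> null_sets M"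
    by (rule null_sets_UN') (use \<F>' in \<open>auto simp: \<F>_def null_sets_def sets\<close>)
  moreover have "- measure_support M = \<Union>\<F>'"
    unfolding \<F>'(3) by (auto simp: measure_support_def \<F>_def zero_less_iff_neq_zero)
  ultimately have null: "- measure_support M \<in> null_sets M" by simp
  obtain r where r: "r > 0" "measure_support M \<subseteq> ball 0 r"
    using bounded_subset_ballD[OF compact_imp_bounded[OF K], of 0] by auto
  have "emeasure M UNIV \<le> emeasure M (ball 0 r \<union> (- measure_support M))"
    using r(2) null by (intro emeasure_mono) (auto simp: sets)
  also have "\<dots> = emeasure M (ball 0 r)"
    by (rule emeasure_Un_null_set) (use null sets in auto)
  also have "\<dots> \<le> ennreal (C * r powr s)" using g r(1) by (auto simp: ball_growth_def)
  finally show "emeasure M (space M) \<noteq> \<infinity>" using sp by (auto simp: top_unique)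
qed

section \<open>Convolved measures and approximate identities\<close>

lemma integral_distr_add:
  fixes h :: "'a::euclidean_space \<Rightarrow> 'b::{banach, second_countable_topology}"
  assumes M: "finite_measure M" "sets M = sets borel" and N: "finite_measure N" "sets N = sets borel"
    and h[measurable]: "h \<in> borel_measurable borel" "\<And>x. norm (h x) \<le> B"
  shows "(\<integral>v. h v \<partial>distr (M \<Otimes>\<^sub>M N) borel (\<lambda>(y, z). y + z)) = (\<integral>y. (\<integral>z. h (y + z) \<partial>N) \<partial>M)"
proof -
  interpret M: finite_measure M by fact
  interpret N: finite_measure N by fact
  interpret P: pair_sigma_finite M N ..
  interpret PF: finite_measure "M \<Otimes>\<^sub>M N" by (intro finite_measure_pair_measure M N)
  note [measurable_cong] = M(2) N(2)
  have i: "integrable (M \<Otimes>\<^sub>M N) (\<lambda>(y, z). h (y + z))"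
    by (rule PF.integrable_const_bound[of _ B]) (use h(2) in auto)
  have "(\<integral>v. h v \<partial>distr (M \<Otimes>\<^sub>M N) borel (\<lambda>(y, z). y + z)) = (\<integral>(y, z). h (y + z) \<partial>(M \<Otimes>\<^sub>M N))"
    by (subst integral_distr) (simp_all add: case_prod_beta')
  also have "\<dots> = (\<integral>y. (\<integral>z. h (y + z) \<partial>N) \<partial>M)"
    using P.integral_fst[OF i] by simp
  finally show ?thesis .
qed

lemma integral_lborel_affine:
  fixes h :: "'a::euclidean_space \<Rightarrow> real" and t :: 'a
  assumes c: "c \<noteq> 0" and [measurable]: "h \<in> borel_measurable borel"
  shows "(\<integral>x. h x \<partial>lborel) = \<bar>c\<bar> ^ DIM('a) * (\<integral>u. h (t + c *\<^sub>R u) \<partial>lborel)"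
    "integrable lborel h \<longleftrightarrow> integrable lborel (\<lambda>u. h (t + c *\<^sub>R u))"
proof -
  show "(\<integral>x. h x \<partial>lborel) = \<bar>c\<bar> ^ DIM('a) * (\<integral>u. h (t + c *\<^sub>R u) \<partial>lborel)"
    by (subst lborel_affine[OF c, of t]) (simp add: integral_density integral_distr)
  show "integrable lborel h \<longleftrightarrow> integrable lborel (\<lambda>u. h (t + c *\<^sub>R u))"
    by (subst lborel_affine[OF c, of t]) (use c in \<open>simp add: integrable_density integrable_distr_eq\<close>)
qed

text \<open>The substitution z = v - sqrt s u moves s from the Gaussian into the argument of \<rho>,
  so that a majorant independent of s is available as s tends to 0.\<close>

lemma gaussian_average_eq:
  fixes \<rho> :: "'a::euclidean_space \<Rightarrow> real"
  assumes s: "s > 0" and [measurable]: "\<rho> \<in> borel_measurable borel"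
  shows "(\<integral>z. exp (- (norm (v - z))\<^sup>2 / (4 * s)) / sqrt (4 * pi * s) ^ DIM('a) * \<rho> z \<partial>lborel)
    = (\<integral>u. exp (- (norm u)\<^sup>2 / 4) / sqrt (4 * pi) ^ DIM('a) * \<rho> (v - sqrt s *\<^sub>R u) \<partial>lborel)"
proof -
  have "(\<integral>z. exp (- (norm (v - z))\<^sup>2 / (4 * s)) / sqrt (4 * pi * s) ^ DIM('a) * \<rho> z \<partial>lborel)
    = \<bar>- sqrt s\<bar> ^ DIM('a) * (\<integral>u. exp (- (norm (v - (v + (- sqrt s) *\<^sub>R u)))\<^sup>2 / (4 * s)) / sqrt (4 * pi * s) ^ DIM('a) * \<rho> (v + (- sqrt s) *\<^sub>R u) \<partial>lborel)"
    by (rule integral_lborel_affine) (use s in \<open>simp_all\<close>)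
  also have "\<dots> = (\<integral>u. sqrt s ^ DIM('a) * (exp (- (norm (v - (v + (- sqrt s) *\<^sub>R u)))\<^sup>2 / (4 * s)) / sqrt (4 * pi * s) ^ DIM('a) * \<rho> (v + (- sqrt s) *\<^sub>R u)) \<partial>lborel)"
    using s by (subst integral_mult_right_zero) simp
  also have "\<dots> = (\<integral>u. exp (- (norm u)\<^sup>2 / 4) / sqrt (4 * pi) ^ DIM('a) * \<rho> (v - sqrt s *\<^sub>R u) \<partial>lborel)"
    using s by (intro Bochner_Integration.integral_cong)
      (simp_all add: real_sqrt_mult power_mult_distrib)
  finally show ?thesis .
qed

lemma integrable_std_gaussian:
  "integrable lborel (\<lambda>u::'a::euclidean_space. exp (- (norm u)\<^sup>2 / 4) / sqrt (4 * pi) ^ DIM('a))"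
  "(\<integral>u. exp (- (norm (u::'a))\<^sup>2 / 4) / sqrt (4 * pi) ^ DIM('a) \<partial>lborel) = 1"
proof -
  have e: "(\<lambda>u::'a. exp (- (norm u)\<^sup>2 / 4)) = (\<lambda>u. exp (- (1/4) * (norm u)\<^sup>2))" by (simp add: fun_eq_iff)
  show "integrable lborel (\<lambda>u::'a. exp (- (norm u)\<^sup>2 / 4) / sqrt (4 * pi) ^ DIM('a))"
    using integrable_gaussian(1)[of "1/4", where 'a='a] by (intro integrable_divide) (simp add: e)
  show "(\<integral>u. exp (- (norm (u::'a))\<^sup>2 / 4) / sqrt (4 * pi) ^ DIM('a) \<partial>lborel) = 1"
    using integrable_gaussian(2)[of "1/4", where 'a='a] unfolding e by (simp add: mult.commute)
qed

text \<open>The convolution of S with \<rho> has a bounded continuous density, which heat flow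
  approximates pointwise. The first bound does not deteriorate as s tends to 0, in contrast to
  \<open>heat_conv_le\<close>; this is what dominated convergence requires.\<close>

lemma heat_conv_distr_add:
  fixes \<rho> :: "'a::euclidean_space \<Rightarrow> real"
  assumes S: "finite_measure S" "sets S = sets borel"
    and \<rho>: "continuous_on UNIV \<rho>" "\<And>x. 0 \<le> \<rho> x" "\<And>x. \<rho> x \<le> R" "integrable lborel \<rho>"
  defines "\<kappa> \<equiv> distr (S \<Otimes>\<^sub>M density lborel (\<lambda>z. ennreal (\<rho> z))) borel (\<lambda>(y, z). y + z)"
  shows "\<And>s x. s > 0 \<Longrightarrow> \<bar>heat_conv s \<kappa> x\<bar> \<le> R * measure S UNIV"
    "\<And>r x. (\<And>n. r n > 0) \<Longrightarrow> r \<longlonglongrightarrow> 0 \<Longrightarrow> (\<lambda>n. heat_conv (r n) \<kappa> x) \<longlonglongrightarrow> (\<integral>y. \<rho> (x - y) \<partial>S)"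
proof -
  interpret S: finite_measure S by fact
  note [measurable_cong] = S(2)
  have [measurable]: "\<rho> \<in> borel_measurable borel" using \<rho>(1) by (rule borel_measurable_continuous_onI)
  have spS: "space S = UNIV" using sets_eq_imp_space_eq[OF S(2)] by simp
  have N: "finite_measure (density lborel (\<lambda>z. ennreal (\<rho> z)))"
    by (rule finite_measureI) (use \<rho> in \<open>simp add: emeasure_density nn_integral_eq_integral\<close>)
  let ?g = "\<lambda>u::'a. exp (- (norm u)\<^sup>2 / 4) / sqrt (4 * pi) ^ DIM('a)"
  define I where "I = (\<lambda>s v. \<integral>u. ?g u * \<rho> (v - sqrt s *\<^sub>R u) \<partial>lborel)"
  have R: "R \<ge> 0" using \<rho>(2,3)[of 0] by linarith
  have gi: "integrable lborel (\<lambda>u::'a. ?g u * R)" using integrable_std_gaussian(1) by (rule integrable_mult_left)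
  have IR: "\<bar>I s v\<bar> \<le> R" for s v
  proof -
    have "\<bar>I s v\<bar> \<le> (\<integral>u. \<bar>?g u * \<rho> (v - sqrt s *\<^sub>R u)\<bar> \<partial>lborel)"
      unfolding I_def by (rule integral_abs_bound)
    also have "\<dots> \<le> (\<integral>u. ?g u * R \<partial>lborel)"
      by (rule integral_mono'[OF gi]) (use \<rho>(2,3) R in \<open>auto simp: abs_mult intro!: mult_left_mono divide_right_mono\<close>)
    also have "\<dots> = R" unfolding integral_mult_left_zero integrable_std_gaussian(2) by simp
    finally show ?thesis .
  qed
  have Im: "I s \<in> borel_measurable borel" for s unfolding I_def by measurable
  have heat: "heat_conv s \<kappa> x = (\<integral>y. I s (x - y) \<partial>S)" if s: "s > 0" for s x
  proof -
    have "heat_conv s \<kappa> x = (\<integral>y. (\<integral>z. exp (- (norm (x - (y + z)))\<^sup>2 / (4 * s)) / sqrt (4 * pi * s) ^ DIM('a) \<partial>density lborel (\<lambda>z. ennreal (\<rho> z))) \<partial>S)"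
      unfolding heat_conv_def \<kappa>_def
      by (rule integral_distr_add[OF S N, where B="1 / sqrt (4 * pi * s) ^ DIM('a)"])
         (use s in \<open>auto intro!: divide_right_mono\<close>)
    also have "\<dots> = (\<integral>y. (\<integral>z. exp (- (norm ((x - y) - z))\<^sup>2 / (4 * s)) / sqrt (4 * pi * s) ^ DIM('a) * \<rho> z \<partial>lborel) \<partial>S)"
      using \<rho>(2) by (subst integral_density) (auto simp: mult.commute diff_diff_eq)
    also have "\<dots> = (\<integral>y. I s (x - y) \<partial>S)"
      unfolding I_def by (subst gaussian_average_eq[OF s]) simp_all
    finally show ?thesis .
  qed
  show "\<bar>heat_conv s \<kappa> x\<bar> \<le> R * measure S UNIV" if s: "s > 0" for s x
  proof -
    have "\<bar>heat_conv s \<kappa> x\<bar> \<le> (\<integral>y. \<bar>I s (x - y)\<bar> \<partial>S)" unfolding heat[OF s] by (rule integral_abs_bound)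
    also have "\<dots> \<le> (\<integral>y. R \<partial>S)" by (rule integral_mono') (use IR R in auto)
    finally show ?thesis by (simp add: spS mult.commute)
  qed
  fix r :: "nat \<Rightarrow> real" and x assume r: "\<And>n. r n > 0" "r \<longlonglongrightarrow> 0"
  have Ilim: "(\<lambda>n. I (r n) v) \<longlonglongrightarrow> \<rho> v" for v
  proof -
    have "(\<lambda>n. I (r n) v) \<longlonglongrightarrow> (\<integral>u. ?g u * \<rho> v \<partial>lborel)"
      unfolding I_def
    proof (rule integral_dominated_convergence[OF _ _ gi])
      have "isCont \<rho> v" using \<rho>(1) by (simp add: continuous_on_eq_continuous_at)
      moreover have "(\<lambda>n. v - sqrt (r n) *\<^sub>R u) \<longlonglongrightarrow> v" for u
        using tendsto_diff[OF tendsto_const[of v] tendsto_scaleR[OF tendsto_real_sqrt[OF r(2)] tendsto_const[of u]]] by simp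
      ultimately show "AE u in lborel. (\<lambda>n. ?g u * \<rho> (v - sqrt (r n) *\<^sub>R u)) \<longlonglongrightarrow> ?g u * \<rho> v"
        by (intro AE_I2 tendsto_mult tendsto_const isCont_tendsto_compose[of v \<rho>])
      show "AE u in lborel. norm (?g u * \<rho> (v - sqrt (r n) *\<^sub>R u)) \<le> ?g u * R" for n
        using \<rho>(2,3) by (intro AE_I2) (auto simp: abs_mult intro!: mult_left_mono divide_right_mono)
    qed measurable
    then show ?thesis unfolding integral_mult_left_zero integrable_std_gaussian(2) by simp
  qed
  show "(\<lambda>n. heat_conv (r n) \<kappa> x) \<longlonglongrightarrow> (\<integral>y. \<rho> (x - y) \<partial>S)"
    unfolding heat[OF r(1)]
  proof (rule integral_dominated_convergence[where w="\<lambda>_. R"])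
    show "(\<lambda>y. I (r n) (x - y)) \<in> borel_measurable S" for n using Im[of "r n"] by measurable
  qed (use Ilim IR in auto)
qed

text \<open>The transform of a convolution is a product, and a measure of mass at most 1 contributes
  a factor of modulus at most 1. Mollifying therefore never worsens the decay constant.\<close>

lemma fourier_distr_add_le:
  fixes \<xi> :: "'a::euclidean_space"
  assumes S: "finite_measure S" "sets S = sets borel" and N: "finite_measure N" "sets N = sets borel" "measure N UNIV \<le> 1"
  shows "cmod (\<integral>v. cis (\<xi> \<bullet> v) \<partial>distr (S \<Otimes>\<^sub>M N) borel (\<lambda>(y, z). y + z)) \<le> cmod (\<integral>v. cis (\<xi> \<bullet> v) \<partial>S)"
proof -
  have sp: "space N = UNIV" using sets_eq_imp_space_eq[OF N(2)] by simp
  have "(\<integral>v. cis (\<xi> \<bullet> v) \<partial>distr (S \<Otimes>\<^sub>M N) borel (\<lambda>(y, z). y + z)) = (\<integral>y. (\<integral>z. cis (\<xi> \<bullet> (y + z)) \<partial>N) \<partial>S)"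
    by (rule integral_distr_add[OF S N(1,2), where B=1]) auto
  also have "\<dots> = (\<integral>y. cis (\<xi> \<bullet> y) \<partial>S) * (\<integral>z. cis (\<xi> \<bullet> z) \<partial>N)"
    by (simp add: inner_add_right flip: cis_mult)
  finally have eq: "(\<integral>v. cis (\<xi> \<bullet> v) \<partial>distr (S \<Otimes>\<^sub>M N) borel (\<lambda>(y, z). y + z)) = (\<integral>y. cis (\<xi> \<bullet> y) \<partial>S) * (\<integral>z. cis (\<xi> \<bullet> z) \<partial>N)" .
  have "cmod (\<integral>z. cis (\<xi> \<bullet> z) \<partial>N) \<le> (\<integral>z. cmod (cis (\<xi> \<bullet> z)) \<partial>N)" by (rule integral_norm_bound)
  also have "\<dots> \<le> 1" using N(3) by (simp add: sp)
  finally show ?thesis unfolding eq norm_mult by (simp add: mult_left_le)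
qed

section \<open>Mollifiers and the mollified spherical kernel\<close>

lemma radial_mollifierD:
  fixes \<rho> :: "'a::euclidean_space \<Rightarrow> real"
  assumes "radial_mollifier \<rho>"
  shows "continuous_on UNIV \<rho>" "\<And>x. 0 \<le> \<rho> x" "\<And>x. \<rho> (- x) = \<rho> x" "integrable lborel \<rho>" "(\<integral>x. \<rho> x \<partial>lborel) = 1"
    "\<exists>R. \<forall>x. \<rho> x \<le> R"
proof -
  note R = assms[unfolded radial_mollifier_def]
  have C: "\<forall>k. Ck k \<rho>" using R by (elim conjE)
  have supp: "compact (closure {x. \<rho> x \<noteq> 0})" using R by (elim conjE)
  have nonneg: "\<forall>x. 0 \<le> \<rho> x" using R by (elim conjE)
  have rad: "\<forall>x y. norm x = norm y \<longrightarrow> \<rho> x = \<rho> y" using R by (elim conjE)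
  have one: "(\<integral>x. \<rho> x \<partial>lborel) = 1" using R by (elim conjE)
  show cont: "continuous_on UNIV \<rho>" using C[rule_format, of 0] by simp
  show "0 \<le> \<rho> x" for x by (rule nonneg[rule_format])
  show "\<rho> (- x) = \<rho> x" for x by (rule rad[rule_format]) simp
  show "(\<integral>x. \<rho> x \<partial>lborel) = 1" by (rule one)
  show "integrable lborel \<rho>"
  proof (rule ccontr)
    assume "\<not> integrable lborel \<rho>"
    \<comment> \<open>A non-integrable function has integral 0 by convention, which contradicts the
      value 1.\<close>
    from not_integrable_integral_eq[OF this] one show False by simp
  qed
  have "compact (\<rho> ` closure {x. \<rho> x \<noteq> 0})"
    by (rule compact_continuous_image[OF continuous_on_subset[OF cont subset_UNIV] supp])
  from compact_imp_bounded[OF this] obtain b where "\<forall>y\<in>\<rho> ` closure {x. \<rho> x \<noteq> 0}. norm y \<le> b"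
    unfolding bounded_iff by (elim exE)
  then have b: "norm (\<rho> x) \<le> b" if "x \<in> closure {x. \<rho> x \<noteq> 0}" for x
    using that by (rule bspec[OF _ imageI])
  have "\<rho> x \<le> max b 0" for x
  proof (cases "\<rho> x = 0")
    case False
    then have "x \<in> closure {x. \<rho> x \<noteq> 0}" by (intro subsetD[OF closure_subset]) simp
    from b[OF this] show ?thesis by simp
  qed simp
  then show "\<exists>R. \<forall>x. \<rho> x \<le> R" by blast
qed

lemma dilate_mollifier:
  fixes \<rho> :: "'a::euclidean_space \<Rightarrow> real"
  assumes \<rho>: "radial_mollifier \<rho>" and \<epsilon>: "\<epsilon> > 0"
  shows "continuous_on UNIV (dilate \<rho> \<epsilon>)" "\<And>x. 0 \<le> dilate \<rho> \<epsilon> x" "\<And>x. dilate \<rho> \<epsilon> (- x) = dilate \<rho> \<epsilon> x"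
    "integrable lborel (dilate \<rho> \<epsilon>)" "(\<integral>x. dilate \<rho> \<epsilon> x \<partial>lborel) = 1" "\<exists>R. \<forall>x. dilate \<rho> \<epsilon> x \<le> R"
proof -
  note R = radial_mollifierD[OF \<rho>]
  have e: "dilate \<rho> \<epsilon> = (\<lambda>x. \<rho> (0 + (1 / \<epsilon>) *\<^sub>R x) / \<epsilon> ^ DIM('a))"
    by (simp add: dilate_def fun_eq_iff divide_inverse)
  have m: "\<rho> \<in> borel_measurable borel" using R(1) by (rule borel_measurable_continuous_onI)
  have c: "continuous_on UNIV (\<lambda>x. \<rho> (0 + (1 / \<epsilon>) *\<^sub>R x))"
    by (rule continuous_on_compose2[OF R(1)]) (auto intro!: continuous_intros)
  show "continuous_on UNIV (dilate \<rho> \<epsilon>)"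
    unfolding e using \<epsilon> c by (intro continuous_on_divide continuous_on_const) auto
  show "0 \<le> dilate \<rho> \<epsilon> x" "dilate \<rho> \<epsilon> (- x) = dilate \<rho> \<epsilon> x" for x
    using \<epsilon> R(2,3) by (simp_all add: dilate_def)
  have \<epsilon>': "1 / \<epsilon> \<noteq> 0" using \<epsilon> by simp
  have i: "integrable lborel (\<lambda>x. \<rho> (0 + (1 / \<epsilon>) *\<^sub>R x))"
    using R(4) integral_lborel_affine(2)[OF \<epsilon>' m, of 0] by simp
  show "integrable lborel (dilate \<rho> \<epsilon>)"
    unfolding e using i by (rule integrable_divide)
  show "(\<integral>x. dilate \<rho> \<epsilon> x \<partial>lborel) = 1"
  proof -
    define I where "I = (\<integral>x. \<rho> (0 + (1 / \<epsilon>) *\<^sub>R x) \<partial>lborel)"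
    have "\<bar>1 / \<epsilon>\<bar> ^ DIM('a) * I = 1"
      unfolding I_def using R(5) by (simp only: integral_lborel_affine(1)[OF \<epsilon>' m, of 0, symmetric])
    moreover have "(\<integral>x. dilate \<rho> \<epsilon> x \<partial>lborel) = I / \<epsilon> ^ DIM('a)"
      unfolding e I_def by (rule integral_divide_zero)
    ultimately show ?thesis using \<epsilon> by (auto simp: power_divide)
  qed
  obtain R' where "\<forall>x. \<rho> x \<le> R'" using R(6) by blast
  then show "\<exists>R. \<forall>x. dilate \<rho> \<epsilon> x \<le> R"
    using \<epsilon> by (intro exI[of _ "R' / \<epsilon> ^ DIM('a)"]) (auto simp: dilate_def intro!: divide_right_mono)
qed

text \<open>The density of \<rho>_\<epsilon> * \<sigma>_t with respect to Lebesgue measure.\<close>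

definition sphere_kernel :: "('a::euclidean_space \<Rightarrow> real) \<Rightarrow> real \<Rightarrow> real \<Rightarrow> 'a \<Rightarrow> real" where
  "sphere_kernel \<rho> \<epsilon> t x = (\<integral>y. dilate \<rho> \<epsilon> (x - y) \<partial>sphere_measure_at t)"

lemma sets_sphere_measure_at [simp]: "sets (sphere_measure_at t) = sets borel"
  by (simp add: sphere_measure_at_def)

text \<open>Evenness joins the antipodal symmetry of the sphere with that of the radial mollifier;
  the duality argument rests on it. The sup bound depends on \<epsilon> and is used only for
  integrability.\<close>

lemma sphere_kernel_props:
  fixes \<rho> :: "'a::euclidean_space \<Rightarrow> real"
  assumes \<rho>: "radial_mollifier \<rho>" and \<epsilon>: "\<epsilon> > 0"
  shows "sphere_kernel \<rho> \<epsilon> t \<in> borel_measurable borel" "\<exists>B. \<forall>x. \<bar>sphere_kernel \<rho> \<epsilon> t x\<bar> \<le> B"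
    "sphere_kernel \<rho> \<epsilon> t (- x) = sphere_kernel \<rho> \<epsilon> t x"
proof -
  let ?S = "sphere_measure_at t :: 'a measure"
  note D = dilate_mollifier[OF \<rho> \<epsilon>]
  interpret S: finite_measure ?S by (rule finite_sphere_measure_at)
  note [measurable_cong] = sets_sphere_measure_at[of t, where 'a='a]
  have m[measurable]: "dilate \<rho> \<epsilon> \<in> borel_measurable borel" using D(1) by (rule borel_measurable_continuous_onI)
  show "sphere_kernel \<rho> \<epsilon> t \<in> borel_measurable borel" unfolding sphere_kernel_def by measurable
  obtain R where R: "\<And>x. dilate \<rho> \<epsilon> x \<le> R" using D(6) by blast
  have R0: "R \<ge> 0" using D(2)[of 0] R[of 0] by linarith
  have "\<bar>sphere_kernel \<rho> \<epsilon> t x\<bar> \<le> (\<integral>y. R \<partial>?S)" for x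
  proof -
    have "\<bar>sphere_kernel \<rho> \<epsilon> t x\<bar> \<le> (\<integral>y. \<bar>dilate \<rho> \<epsilon> (x - y)\<bar> \<partial>?S)"
      unfolding sphere_kernel_def by (rule integral_abs_bound)
    also have "\<dots> \<le> (\<integral>y. R \<partial>?S)" by (rule integral_mono') (use R D(2) R0 in auto)
    finally show ?thesis .
  qed
  then show "\<exists>B. \<forall>x. \<bar>sphere_kernel \<rho> \<epsilon> t x\<bar> \<le> B" by blast
  have refl: "(\<integral>y. h y \<partial>?S) = (\<integral>y. h (- y) \<partial>?S)" if [measurable]: "h \<in> borel_measurable borel" for h :: "'a \<Rightarrow> real"
  proof -
    have "(\<integral>y. h y \<partial>?S) = (\<integral>y. h (t *\<^sub>R y) \<partial>sphere_measure)"
      unfolding sphere_measure_at_def by (subst integral_distr) simp_all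
    also have "\<dots> = (\<integral>y. h (t *\<^sub>R (- y)) \<partial>sphere_measure)"
      by (rule integral_sphere_measure_orthogonal[symmetric]) (simp_all add: orthogonal_transformation_neg)
    also have "\<dots> = (\<integral>y. h (- y) \<partial>?S)"
      unfolding sphere_measure_at_def by (subst integral_distr) simp_all
    finally show ?thesis .
  qed
  have "sphere_kernel \<rho> \<epsilon> t (- x) = (\<integral>y. dilate \<rho> \<epsilon> (- x - (- y)) \<partial>?S)"
    unfolding sphere_kernel_def by (rule refl) measurable
  also have "\<dots> = (\<integral>y. dilate \<rho> \<epsilon> (- (x - y)) \<partial>?S)" by simp
  also have "\<dots> = sphere_kernel \<rho> \<epsilon> t x" unfolding D(3) sphere_kernel_def ..
  finally show "sphere_kernel \<rho> \<epsilon> t (- x) = sphere_kernel \<rho> \<epsilon> t x" .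
qed

lemma mollified_conv_eq_conv_op:
  fixes \<rho> :: "'a::euclidean_space \<Rightarrow> real"
  assumes \<rho>: "radial_mollifier \<rho>" and \<epsilon>: "\<epsilon> > 0"
    and \<mu>: "finite_measure \<mu>" "sets \<mu> = sets borel" and f: "integrable \<mu> f"
  shows "mollified_conv \<rho> \<epsilon> t \<mu> f = conv_op (\<lambda>z. complex_of_real (sphere_kernel \<rho> \<epsilon> t z)) \<mu> f"
proof
  fix x
  let ?S = "sphere_measure_at t :: 'a measure"
  let ?h = "\<lambda>y z. complex_of_real (dilate \<rho> \<epsilon> (x - (y + z))) * f z"
  note D = dilate_mollifier[OF \<rho> \<epsilon>]
  interpret S: finite_measure ?S by (rule finite_sphere_measure_at)
  interpret M: finite_measure \<mu> by fact
  interpret P: pair_sigma_finite ?S \<mu> ..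
  note [measurable_cong] = sets_sphere_measure_at[of t, where 'a='a] \<mu>(2)
  have [measurable]: "dilate \<rho> \<epsilon> \<in> borel_measurable borel" using D(1) by (rule borel_measurable_continuous_onI)
  have [measurable]: "f \<in> borel_measurable borel" using f \<mu>(2) by (simp cong: measurable_cong_sets add: borel_measurable_integrable)
  obtain R where R: "\<And>x. dilate \<rho> \<epsilon> x \<le> R" using D(6) by blast
  have le: "cmod (complex_of_real (dilate \<rho> \<epsilon> w) * f z) \<le> R * cmod (f z)" for w z
    using R[of w] D(2)[of w] by (auto simp: norm_mult intro!: mult_right_mono)
  have i1: "integrable \<mu> (\<lambda>z. ?h y z)" for y
  proof (rule Bochner_Integration.integrable_bound)
    show "integrable \<mu> (\<lambda>z. R * cmod (f z))" using f by simp
    show "AE z in \<mu>. norm (?h y z) \<le> norm (R * cmod (f z))"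
      using le order_trans[OF le abs_ge_self] by auto
  qed measurable
  have int: "integrable (?S \<Otimes>\<^sub>M \<mu>) (\<lambda>(y, z). ?h y z)"
  proof (rule P.Fubini_integrable)
    show "integrable ?S (\<lambda>y. \<integral>z. norm (case (y, z) of (y, z) \<Rightarrow> ?h y z) \<partial>\<mu>)"
    proof (rule S.integrable_const_bound)
      show "AE y in ?S. norm (\<integral>z. norm (case (y, z) of (y, z) \<Rightarrow> ?h y z) \<partial>\<mu>) \<le> (\<integral>z. R * cmod (f z) \<partial>\<mu>)"
      proof (rule AE_I2)
        fix y
        have "(\<integral>z. norm (?h y z) \<partial>\<mu>) \<le> (\<integral>z. R * cmod (f z) \<partial>\<mu>)"
          by (rule integral_mono[OF integrable_norm[OF i1]]) (use f le in auto)
        then show "norm (\<integral>z. norm (case (y, z) of (y, z) \<Rightarrow> ?h y z) \<partial>\<mu>) \<le> (\<integral>z. R * cmod (f z) \<partial>\<mu>)"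
          by simp
      qed
    qed measurable
    show "AE y in ?S. integrable \<mu> (\<lambda>z. case (y, z) of (y, z) \<Rightarrow> ?h y z)"
      using i1 by simp
  qed measurable
  have "mollified_conv \<rho> \<epsilon> t \<mu> f x = (\<integral>(y, z). ?h y z \<partial>(?S \<Otimes>\<^sub>M \<mu>))"
    by (simp add: mollified_conv_def spherical_conv_def)
  also have "\<dots> = (\<integral>z. (\<integral>y. ?h y z \<partial>?S) \<partial>\<mu>)"
    using P.integral_snd[OF int] by simp
  also have "\<dots> = (\<integral>z. (\<integral>y. complex_of_real (dilate \<rho> \<epsilon> ((x - z) - y)) \<partial>?S) * f z \<partial>\<mu>)"
    by (simp add: algebra_simps)
  also have "\<dots> = conv_op (\<lambda>z. complex_of_real (sphere_kernel \<rho> \<epsilon> t z)) \<mu> f x"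
    by (simp only: conv_op_def sphere_kernel_def integral_complex_of_real)
  finally show "mollified_conv \<rho> \<epsilon> t \<mu> f x = conv_op (\<lambda>z. complex_of_real (sphere_kernel \<rho> \<epsilon> t z)) \<mu> f x" .
qed

text \<open>\<open>M\<close> and \<open>A\<close> are the mass and decay constant of \<sigma>_t
  alone. Convolution with \<rho>_\<epsilon> preserves both bounds, so the constant of
  \<open>flat_conv_Lp_bound\<close> is obtained before \<epsilon> is fixed.\<close>

lemma sphere_kernel_Lp_bound:
  fixes \<mu> \<nu> :: "'a::euclidean_space measure"
  assumes d: "DIM('a) \<ge> 2"
    and \<mu>: "finite_measure \<mu>" "sets \<mu> = sets borel" and \<nu>: "finite_measure \<nu>" "sets \<nu> = sets borel"
    and g: "ball_growth C\<^sub>1 m\<^sub>\<mu> \<mu>" "ball_growth C\<^sub>1 m\<^sub>\<nu> \<nu>"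
    and m: "m\<^sub>\<mu> \<le> real DIM('a)" and p: "p \<ge> 2"
    and pos: "real DIM('a) - 1 - p * real DIM('a) + (p - 1) * m\<^sub>\<mu> + m\<^sub>\<nu> > 0"
    and \<rho>: "radial_mollifier \<rho>" and t: "t > 0"
  obtains C where
    "\<And>\<epsilon>. \<epsilon> > 0 \<Longrightarrow> conv_bounded p \<mu> \<nu> (\<lambda>z. complex_of_real (sphere_kernel \<rho> \<epsilon> t z)) C"
proof -
  let ?N = "DIM('a)"
  let ?K = "\<lambda>\<kappa> J z. complex_of_real (flat_conv ?N ((1/2) ^ J) \<kappa> z)"
  let ?S = "sphere_measure_at t :: 'a measure"
  note Sf = finite_sphere_measure_at[of t, where 'a='a]
  note Ss = sets_sphere_measure_at[of t, where 'a='a]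
  obtain A where A: "A \<ge> 0" "\<And>\<xi>::'a. cmod (\<integral>w. cis (\<xi> \<bullet> w) \<partial>?S) * norm \<xi> powr ((real ?N - 1) / 2) \<le> A"
    using sphere_measure_at_fourier_decay[OF d t] by metis
  define M where "M = measure ?S UNIV"
  have M0: "M \<ge> 0" by (simp add: M_def)
  obtain C where C: "\<And>\<kappa> J. decaying M A \<kappa> \<Longrightarrow>
      conv_bounded p \<mu> \<nu> (?K \<kappa> J) C"
    using flat_conv_Lp_bound[OF d \<mu> \<nu> g m p M0 A(1) pos] by blast
  have "conv_bounded p \<mu> \<nu> (\<lambda>z. complex_of_real (sphere_kernel \<rho> \<epsilon> t z)) C" if \<epsilon>: "\<epsilon> > 0" for \<epsilon>
  proof (rule conv_boundedI)
    fix f :: "'a \<Rightarrow> complex"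
    assume f: "f \<in> borel_measurable borel" "integrable \<mu> (\<lambda>y. cmod (f y) powr p)"
    note D = dilate_mollifier[OF \<rho> \<epsilon>]
    obtain R where R: "\<And>x. dilate \<rho> \<epsilon> x \<le> R" using D(6) by blast
    have R0: "R \<ge> 0" using D(2)[of 0] R[of 0] by linarith
    define N where "N = density lborel (\<lambda>z. ennreal (dilate \<rho> \<epsilon> z))"
    have dm[measurable]: "dilate \<rho> \<epsilon> \<in> borel_measurable borel" using D(1) by (rule borel_measurable_continuous_onI)
    have N1: "emeasure N UNIV = 1"
      unfolding N_def using D(2,4,5) by (simp add: emeasure_density nn_integral_eq_integral)
    have N: "finite_measure N" "sets N = sets borel" "measure N UNIV \<le> 1"
    proof -
      show "finite_measure N" by (rule finite_measureI) (use N1 in \<open>simp add: N_def\<close>)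
      show "sets N = sets borel" by (simp add: N_def)
      show "measure N UNIV \<le> 1" using N1 by (simp add: measure_def)
    qed
    define \<kappa> where "\<kappa> = distr (?S \<Otimes>\<^sub>M N) borel (\<lambda>(y, z). y + z)"
    have "finite_measure (?S \<Otimes>\<^sub>M N)" by (intro finite_measure_pair_measure Sf N)
    moreover have add: "(\<lambda>(y, z). y + z) \<in> measurable (?S \<Otimes>\<^sub>M N) borel"
    proof -
      note [measurable_cong] = Ss N(2)
      show ?thesis by measurable
    qed
    ultimately have \<kappa>: "finite_measure \<kappa>" "sets \<kappa> = sets borel"
      unfolding \<kappa>_def by (auto intro: finite_measure.finite_measure_distr)
    have \<kappa>M: "measure \<kappa> UNIV \<le> M"
    proof -
      interpret NF: finite_measure N by (rule N)
      have spS: "space ?S = UNIV" "space N = UNIV"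
        using sets_eq_imp_space_eq[OF Ss] sets_eq_imp_space_eq[OF N(2)] by simp_all
      have 1: "emeasure \<kappa> UNIV = emeasure (?S \<Otimes>\<^sub>M N) (space ?S \<times> space N)"
        unfolding \<kappa>_def by (subst emeasure_distr[OF add]) (simp_all add: space_pair_measure)
      have 2: "emeasure (?S \<Otimes>\<^sub>M N) (space ?S \<times> space N) = emeasure ?S (space ?S) * emeasure N (space N)"
        by (rule NF.emeasure_pair_measure_Times[OF sets.top sets.top])
      have "emeasure \<kappa> UNIV = emeasure ?S UNIV"
        unfolding 1 unfolding 2 unfolding spS N1 by (rule mult_1_right)
      then show ?thesis by (simp add: M_def measure_def)
    qed
    have dec: "cmod (\<integral>v. cis (\<xi> \<bullet> v) \<partial>\<kappa>) * norm \<xi> powr ((real ?N - 1) / 2) \<le> A" for \<xi>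
    proof -
      have "cmod (\<integral>v. cis (\<xi> \<bullet> v) \<partial>\<kappa>) * norm \<xi> powr ((real ?N - 1) / 2)
          \<le> cmod (\<integral>v. cis (\<xi> \<bullet> v) \<partial>?S) * norm \<xi> powr ((real ?N - 1) / 2)"
        unfolding \<kappa>_def by (intro mult_right_mono fourier_distr_add_le[OF Sf Ss N]) auto
      then show ?thesis using A(2)[of \<xi>] by linarith
    qed
    note H = heat_conv_distr_add[OF Sf Ss D(1,2) R D(4), folded N_def, folded \<kappa>_def]
    have f\<mu>: "f \<in> borel_measurable \<mu>" using f(1) \<mu>(2) by (simp cong: measurable_cong_sets)
    have f1: "integrable \<mu> f" by (rule integrable_of_powr[OF \<mu>(1) f\<mu> f(2)]) (use p in simp)
    show "(\<integral>x. cmod (conv_op (\<lambda>z. complex_of_real (sphere_kernel \<rho> \<epsilon> t z)) \<mu> f x) powr p \<partial>\<nu>)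
          \<le> C * (\<integral>y. cmod (f y) powr p \<partial>\<mu>)"
    proof (rule conv_op_limit_bound[OF \<mu> \<nu>])
      show "(?K \<kappa> J) \<in> borel_measurable borel" for J
        using borel_measurable_flat_conv[OF \<kappa>] by measurable
      \<comment> \<open>This bound depends on \<epsilon> through \<open>R\<close> but not on J,
        which is enough for the passage to the limit.\<close>
      show "cmod (complex_of_real (flat_conv ?N ((1/2) ^ J) \<kappa> x)) \<le> 2 ^ ?N * (R * M)" for J x
        unfolding norm_of_real M_def
        by (rule abs_flat_conv_le) (use H(1) R0 in \<open>auto intro!: mult_nonneg_nonneg\<close>)
      show "(\<lambda>J. complex_of_real (flat_conv ?N ((1/2) ^ J) \<kappa> x)) \<longlonglongrightarrow> complex_of_real (sphere_kernel \<rho> \<epsilon> t x)" for x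
      proof (rule tendsto_of_real)
        \<comment> \<open>Each heat time k (1/2)^J tends to 0, so every heat term has the same
          limit, and the coefficients add up to 1.\<close>
        have "(\<lambda>J. flat_conv ?N ((1/2) ^ J) \<kappa> x) \<longlonglongrightarrow> (\<Sum>k=1..?N. flat_coeff ?N k * sphere_kernel \<rho> \<epsilon> t x)"
          unfolding flat_conv_def
        proof (intro tendsto_sum tendsto_mult tendsto_const)
          fix k assume k: "k \<in> {1..?N}"
          show "(\<lambda>J. heat_conv (real k * (1/2) ^ J) \<kappa> x) \<longlonglongrightarrow> sphere_kernel \<rho> \<epsilon> t x"
            unfolding sphere_kernel_def
          proof (rule H(2))
            show "(\<lambda>J. real k * (1/2) ^ J) \<longlonglongrightarrow> 0"
              using tendsto_mult[OF tendsto_const[of "real k"] LIMSEQ_power_zero[of "1/2 :: real"]] by simp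
          qed (use k in simp)
        qed
        also have "(\<Sum>k=1..?N. flat_coeff ?N k * sphere_kernel \<rho> \<epsilon> t x) = sphere_kernel \<rho> \<epsilon> t x"
          unfolding sum_distrib_right[symmetric] using d by (subst sum_flat_coeff) auto
        finally show "(\<lambda>J. flat_conv ?N ((1/2) ^ J) \<kappa> x) \<longlonglongrightarrow> sphere_kernel \<rho> \<epsilon> t x" .
      qed
      show "(\<integral>x. cmod (conv_op (?K \<kappa> J) \<mu> f x) powr p \<partial>\<nu>)
          \<le> C * (\<integral>y. cmod (f y) powr p \<partial>\<mu>)" for J
        by (rule conv_boundedD[OF C f]) (simp add: decaying_def \<kappa> \<kappa>M dec)
    qed (use f f1 p in auto)
  qed
  then show ?thesis by (rule that)
qed

text \<open>For an even kernel the operator from \<mu> to \<nu> and the one from \<nu> to \<mu> are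
  transposes under the bilinear pairing, without complex conjugation.\<close>

lemma conv_op_transpose:
  fixes f h :: "'a::euclidean_space \<Rightarrow> complex"
  assumes \<mu>: "finite_measure \<mu>" "sets \<mu> = sets borel" and \<nu>: "finite_measure \<nu>" "sets \<nu> = sets borel"
    and K[measurable]: "K \<in> borel_measurable borel" and B: "\<And>x. cmod (K x) \<le> B" and even: "\<And>x. K (- x) = K x"
    and f: "integrable \<mu> f" and h: "integrable \<nu> h"
  shows "(\<integral>x. conv_op K \<mu> f x * h x \<partial>\<nu>) = (\<integral>y. f y * conv_op K \<nu> h y \<partial>\<mu>)"
proof -
  interpret M: finite_measure \<mu> by fact
  interpret N: finite_measure \<nu> by fact
  interpret P: pair_sigma_finite \<nu> \<mu> ..
  note [measurable_cong] = \<mu>(2) \<nu>(2)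
  have [measurable]: "f \<in> borel_measurable borel" "h \<in> borel_measurable borel"
    using f h \<mu>(2) \<nu>(2) by (simp_all cong: measurable_cong_sets add: borel_measurable_integrable)
  have le: "cmod (K (x - y) * f y * h x) \<le> B * cmod (f y) * cmod (h x)" for x y
    unfolding norm_mult by (intro mult_right_mono B) auto
  have i: "integrable \<mu> (\<lambda>y. K (x - y) * f y * h x)" for x
    by (intro integrable_mult_left integrable_conv_op[OF \<mu>(2) K B f])
  have int: "integrable (\<nu> \<Otimes>\<^sub>M \<mu>) (\<lambda>(x, y). K (x - y) * f y * h x)"
  proof (rule P.Fubini_integrable)
    show "integrable \<nu> (\<lambda>x. \<integral>y. norm (case (x, y) of (x, y) \<Rightarrow> K (x - y) * f y * h x) \<partial>\<mu>)"
    proof (rule Bochner_Integration.integrable_bound)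
      show "integrable \<nu> (\<lambda>x. \<integral>y. B * cmod (f y) * cmod (h x) \<partial>\<mu>)" using h by simp
      show "AE x in \<nu>. norm (\<integral>y. norm (case (x, y) of (x, y) \<Rightarrow> K (x - y) * f y * h x) \<partial>\<mu>) \<le> norm (\<integral>y. B * cmod (f y) * cmod (h x) \<partial>\<mu>)"
      proof (rule AE_I2)
        fix x
        have "(\<integral>y. norm (K (x - y) * f y * h x) \<partial>\<mu>) \<le> (\<integral>y. B * cmod (f y) * cmod (h x) \<partial>\<mu>)"
          by (rule integral_mono[OF integrable_norm[OF i] _ le]) (use f in simp)
        moreover have "0 \<le> (\<integral>y. norm (K (x - y) * f y * h x) \<partial>\<mu>)" by (rule Bochner_Integration.integral_nonneg) simp
        ultimately show "norm (\<integral>y. norm (case (x, y) of (x, y) \<Rightarrow> K (x - y) * f y * h x) \<partial>\<mu>) \<le> norm (\<integral>y. B * cmod (f y) * cmod (h x) \<partial>\<mu>)"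
          unfolding real_norm_def prod.case by linarith
      qed
    qed measurable
    show "AE x in \<nu>. integrable \<mu> (\<lambda>y. case (x, y) of (x, y) \<Rightarrow> K (x - y) * f y * h x)" using i by simp
  qed measurable
  have "(\<integral>x. conv_op K \<mu> f x * h x \<partial>\<nu>) = (\<integral>x. (\<integral>y. K (x - y) * f y * h x \<partial>\<mu>) \<partial>\<nu>)"
    by (simp add: conv_op_def)
  also have "\<dots> = (\<integral>y. (\<integral>x. K (x - y) * f y * h x \<partial>\<nu>) \<partial>\<mu>)"
    by (rule P.Fubini_integral[OF int, symmetric])
  also have "\<dots> = (\<integral>y. (\<integral>x. f y * (K (y - x) * h x) \<partial>\<nu>) \<partial>\<mu>)"
  proof (intro Bochner_Integration.integral_cong refl)
    fix x y
    show "K (x - y) * f y * h x = f y * (K (y - x) * h x)" using even[of "x - y"] by (simp add: mult_ac)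
  qed
  also have "\<dots> = (\<integral>y. f y * conv_op K \<nu> h y \<partial>\<mu>)" by (simp add: conv_op_def)
  finally show ?thesis .
qed

section \<open>Duality and the main theorem\<close>

text \<open>Testing T against its own dual function and moving K to the other side reduces the bound
  to exponent q. Young's inequality with a weight takes the place of Hoelder, and half of the
  quantity to be bounded is absorbed; it is finite because the kernel is bounded.\<close>

lemma conv_op_dual_bound:
  fixes K :: "'a::euclidean_space \<Rightarrow> complex"
  assumes \<mu>: "finite_measure \<mu>" "sets \<mu> = sets borel" and \<nu>: "finite_measure \<nu>" "sets \<nu> = sets borel"
    and K: "K \<in> borel_measurable borel" "\<And>x. cmod (K x) \<le> B" "\<And>x. K (- x) = K x"
    and p: "p > 1" and q: "q = p / (p - 1)" and C: "C > 0"
    and dual: "conv_bounded q \<nu> \<mu> K C"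
  shows "conv_bounded p \<mu> \<nu> K (2 * (2 * C) powr (p / q))"
proof (rule conv_boundedI)
  fix f :: "'a \<Rightarrow> complex"
  assume f: "f \<in> borel_measurable borel" "integrable \<mu> (\<lambda>y. cmod (f y) powr p)"
  interpret M: finite_measure \<mu> by fact
  interpret N: finite_measure \<nu> by fact
  note [measurable_cong] = \<mu>(2) \<nu>(2)
  note [measurable] = K(1) f(1)
  have q1: "q > 1" using p by (simp add: q field_simps)
  have pq: "1 / p + 1 / q = 1" using p by (simp add: q field_simps)
  have pq': "(p - 1) * q = p" using p by (simp add: q)
  have f\<mu>: "f \<in> borel_measurable \<mu>" by measurable
  have f1: "integrable \<mu> f" by (rule integrable_of_powr[OF \<mu>(1) f\<mu> f(2)]) (use p in simp)
  define T where "T = conv_op K \<mu> f"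
  have [measurable]: "T \<in> borel_measurable borel"
    unfolding T_def by (rule borel_measurable_conv_op[OF \<mu> K(1) f(1)])
  define L where "L = B * (\<integral>y. cmod (f y) \<partial>\<mu>)"
  have TL: "cmod (T x) \<le> L" for x
    unfolding T_def L_def by (rule cmod_conv_op_le[OF \<mu>(2) K(1,2) f1])
  \<comment> \<open>The extremal function for duality: T h = |T|^p and |h|^q = |T|^p. Where T
    vanishes, so does h, even for p < 2, since \<open>0 powr\<close> is 0.\<close>
  define h where "h = (\<lambda>x. complex_of_real (cmod (T x) powr (p - 2)) * cnj (T x))"
  have hm[measurable]: "h \<in> borel_measurable borel" unfolding h_def by measurable
  have hn: "cmod (h x) = cmod (T x) powr (p - 1)" for x
  proof (cases "T x = 0")
    case False
    then have "cmod (h x) = cmod (T x) powr (p - 2) * cmod (T x) powr 1" by (simp add: h_def norm_mult)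
    also have "\<dots> = cmod (T x) powr (p - 1)" by (simp only: powr_add[symmetric]) simp
    finally show ?thesis .
  qed (simp add: h_def)
  have hq: "cmod (h x) powr q = cmod (T x) powr p" for x
    by (simp add: hn powr_powr pq')
  have Th: "T x * h x = complex_of_real (cmod (T x) powr p)" for x
  proof (cases "T x = 0")
    case False
    have "T x * h x = complex_of_real (cmod (T x) powr (p - 2)) * (T x * cnj (T x))" by (simp add: h_def mult_ac)
    also have "\<dots> = complex_of_real (cmod (T x) powr (p - 2) * (cmod (T x))\<^sup>2)"
      by (simp only: complex_norm_square of_real_mult)
    also have "cmod (T x) powr (p - 2) * (cmod (T x))\<^sup>2 = cmod (T x) powr (p - 2) * cmod (T x) powr 2"
      using False by (simp add: powr_numeral)
    also have "\<dots> = cmod (T x) powr p" by (simp only: powr_add[symmetric]) simp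
    finally show ?thesis .
  qed (use p in simp)
  have hL: "cmod (h x) \<le> L powr (p - 1)" for x
    unfolding hn using TL p by (intro powr_mono2) auto
  have h1: "integrable \<nu> h" by (rule N.integrable_const_bound[of _ "L powr (p - 1)"]) (use hL in auto)
  have Tp: "integrable \<nu> (\<lambda>x. cmod (T x) powr p)"
    unfolding T_def by (rule integrable_conv_op_powr[OF \<mu> \<nu> K(1,2) f(1) f1]) (use p in simp)
  define Q where "Q = (\<integral>x. cmod (T x) powr p \<partial>\<nu>)"
  define X where "X = (\<integral>y. cmod (f y) powr p \<partial>\<mu>)"
  define U where "U = conv_op K \<nu> h"
  have Uq: "integrable \<mu> (\<lambda>y. cmod (U y) powr q)"
    unfolding U_def by (rule integrable_conv_op_powr[OF \<nu> \<mu> K(1,2) hm h1]) (use q1 in simp)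
  have dualQ: "(\<integral>y. cmod (U y) powr q \<partial>\<mu>) \<le> C * Q"
    using conv_boundedD[OF dual hm] Tp unfolding hq by (simp add: U_def Q_def)
  \<comment> \<open>Chosen so that a^q = 2 C: the dual term is then at most C Q / (2 C) = Q /
    2.\<close>
  define a where "a = (2 * C) powr (1 / q)"
  have a: "a > 0" using C by (simp add: a_def)
  have aq: "a powr q = 2 * C" using C q1 by (simp add: a_def powr_powr)
  have ap: "a powr p = (2 * C) powr (p / q)" by (simp add: a_def powr_powr)
  have Q0: "Q \<ge> 0" and X0: "X \<ge> 0" by (simp_all add: Q_def X_def)
  have "complex_of_real Q = (\<integral>x. T x * h x \<partial>\<nu>)" unfolding Th Q_def by simp
  also have "\<dots> = (\<integral>y. f y * U y \<partial>\<mu>)"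
    unfolding T_def U_def by (rule conv_op_transpose[OF \<mu> \<nu> K f1 h1])
  finally have "Q = cmod (\<integral>y. f y * U y \<partial>\<mu>)" using Q0 by (metis norm_of_real abs_of_nonneg)
  also have "\<dots> \<le> (\<integral>y. cmod (f y * U y) \<partial>\<mu>)" by (rule integral_norm_bound)
  also have "\<dots> \<le> (\<integral>y. a powr p * cmod (f y) powr p + cmod (U y) powr q / (2 * C) \<partial>\<mu>)"
  proof (rule integral_mono')
    show "integrable \<mu> (\<lambda>y. a powr p * cmod (f y) powr p + cmod (U y) powr q / (2 * C))"
      using f(2) Uq by (intro Bochner_Integration.integrable_add integrable_mult_right integrable_divide)
    fix y
    have "(a * cmod (f y)) * (cmod (U y) / a) \<le> (a * cmod (f y)) powr p / p + (cmod (U y) / a) powr q / q"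
      using a by (intro Youngs_inequality p q1 pq) auto
    also have "\<dots> \<le> (a * cmod (f y)) powr p + (cmod (U y) / a) powr q"
    proof (rule add_mono)
      show "(a * cmod (f y)) powr p / p \<le> (a * cmod (f y)) powr p"
        using divide_left_mono[of 1 p "(a * cmod (f y)) powr p"] p by simp
      show "(cmod (U y) / a) powr q / q \<le> (cmod (U y) / a) powr q"
        using divide_left_mono[of 1 q "(cmod (U y) / a) powr q"] q1 by simp
    qed
    also have "\<dots> = a powr p * cmod (f y) powr p + cmod (U y) powr q / (2 * C)"
      using a aq by (simp add: powr_mult powr_divide)
    finally show "cmod (f y * U y) \<le> a powr p * cmod (f y) powr p + cmod (U y) powr q / (2 * C)"
      using a by (simp add: norm_mult)
    show "0 \<le> a powr p * cmod (f y) powr p + cmod (U y) powr q / (2 * C)" using C by simp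
  qed
  also have "\<dots> = a powr p * X + (\<integral>y. cmod (U y) powr q \<partial>\<mu>) / (2 * C)"
    using f(2) Uq by (simp add: X_def)
  also have "\<dots> \<le> a powr p * X + C * Q / (2 * C)"
    using C by (intro add_left_mono divide_right_mono dualQ) auto
  also have "C * Q / (2 * C) = Q / 2" using C by simp
  finally have "Q \<le> 2 * (a powr p * X)" by simp
  then show "(\<integral>x. cmod (conv_op K \<mu> f x) powr p \<partial>\<nu>) \<le> 2 * (2 * C) powr (p / q) * (\<integral>y. cmod (f y) powr p \<partial>\<mu>)"
    unfolding ap by (simp add: Q_def X_def T_def mult.assoc)
qed

text \<open>Here the p-th root is taken. The absolute value is needed because
  \<open>conv_bounded\<close> does not force its constant to be nonnegative.\<close>

lemma spherical_Lp_boundI: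
  fixes \<mu> \<nu> :: "'a::euclidean_space measure"
  assumes \<mu>: "finite_measure \<mu>" "sets \<mu> = sets borel" and \<nu>: "finite_measure \<nu>" "sets \<nu> = sets borel"
    and \<rho>: "radial_mollifier \<rho>" and p: "p \<ge> 1"
    and bd: "\<And>\<epsilon>. \<epsilon> > 0 \<Longrightarrow> conv_bounded p \<mu> \<nu> (\<lambda>z. complex_of_real (sphere_kernel \<rho> \<epsilon> t z)) C"
  shows "spherical_Lp_bound \<rho> p t \<mu> \<nu> (\<bar>C\<bar> powr (1 / p))"
  unfolding spherical_Lp_bound_def
proof (intro ballI allI impI)
  fix \<epsilon> :: real and f :: "'a \<Rightarrow> complex"
  assume \<epsilon>: "\<epsilon> \<in> {0<..<1}" and "in_Lp p \<mu> f"
  then have f\<mu>: "f \<in> borel_measurable \<mu>" and fp: "integrable \<mu> (\<lambda>y. cmod (f y) powr p)"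
    by (simp_all add: in_Lp_def)
  note [measurable_cong] = \<nu>(2)
  have \<epsilon>0: "\<epsilon> > 0" using \<epsilon> by simp
  have f: "f \<in> borel_measurable borel" using f\<mu> \<mu>(2) by (simp cong: measurable_cong_sets)
  have f1: "integrable \<mu> f" by (rule integrable_of_powr[OF \<mu>(1) f\<mu> fp]) (use p in simp)
  let ?K = "\<lambda>z. complex_of_real (sphere_kernel \<rho> \<epsilon> t z)"
  note P = sphere_kernel_props[OF \<rho> \<epsilon>0, of t]
  note [measurable] = P(1)
  obtain B where "\<forall>x. \<bar>sphere_kernel \<rho> \<epsilon> t x\<bar> \<le> B" using P(2) ..
  then have KB: "cmod (?K x) \<le> B" for x by simp
  have Km: "?K \<in> borel_measurable borel" by measurable
  have Tm: "conv_op ?K \<mu> f \<in> borel_measurable borel" by (rule borel_measurable_conv_op[OF \<mu> Km f])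
  have Tm': "conv_op ?K \<mu> f \<in> borel_measurable \<nu>" using Tm by measurable
  have "integrable \<nu> (\<lambda>x. cmod (conv_op ?K \<mu> f x) powr p)"
    by (rule integrable_conv_op_powr[OF \<mu> \<nu> Km KB f f1]) (use p in simp)
  with Tm' have "in_Lp p \<nu> (conv_op ?K \<mu> f)" by (simp add: in_Lp_def)
  moreover have "Lp_norm p \<nu> (conv_op ?K \<mu> f) \<le> \<bar>C\<bar> powr (1 / p) * Lp_norm p \<mu> f"
  proof -
    have "(\<integral>x. cmod (conv_op ?K \<mu> f x) powr p \<partial>\<nu>) \<le> C * (\<integral>y. cmod (f y) powr p \<partial>\<mu>)"
      by (rule conv_boundedD[OF bd[OF \<epsilon>0] f fp])
    also have "\<dots> \<le> \<bar>C\<bar> * (\<integral>y. cmod (f y) powr p \<partial>\<mu>)" by (intro mult_right_mono) auto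
    finally have "Lp_norm p \<nu> (conv_op ?K \<mu> f) \<le> (\<bar>C\<bar> * (\<integral>y. cmod (f y) powr p \<partial>\<mu>)) powr (1 / p)"
      unfolding Lp_norm_def using p by (intro powr_mono2) auto
    also have "\<dots> = \<bar>C\<bar> powr (1 / p) * Lp_norm p \<mu> f"
      unfolding Lp_norm_def by (simp add: powr_mult)
    finally show ?thesis .
  qed
  ultimately show "in_Lp p \<nu> (mollified_conv \<rho> \<epsilon> t \<mu> f) \<and> Lp_norm p \<nu> (mollified_conv \<rho> \<epsilon> t \<mu> f) \<le> \<bar>C\<bar> powr (1 / p) * Lp_norm p \<mu> f"
    unfolding mollified_conv_eq_conv_op[OF \<rho> \<epsilon>0 \<mu> f1] by simp
qed

text \<open>The factor 1 / p' is written as \<open>1 - 1 / p\<close>, so that p = 1 with p' infinite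
  stays within real arithmetic.\<close>

theorem theorem4p2:
  fixes \<mu> \<nu> :: "'a::euclidean_space measure"
    and \<rho> :: "'a \<Rightarrow> real"
    and s\<^sub>\<mu> s\<^sub>\<nu> C\<^sub>1 p :: real
  assumes "DIM('a) \<ge> 2"
    and "s\<^sub>\<mu> \<in> {0<..real DIM('a)}" and "s\<^sub>\<nu> \<in> {0<..real DIM('a)}"
    and "compactly_supported_borel \<mu>" and "compactly_supported_borel \<nu>"
    and "ball_growth C\<^sub>1 s\<^sub>\<mu> \<mu>" and "ball_growth C\<^sub>1 s\<^sub>\<nu> \<nu>"
    and "radial_mollifier \<rho>"
  shows "(2 \<le> p \<longrightarrow>
           s\<^sub>\<mu> * (1 - 1 / p) + s\<^sub>\<nu> / p > real DIM('a) - (real DIM('a) - 1) / p \<longrightarrow>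
           (\<forall>t>0. \<exists>C. spherical_Lp_bound \<rho> p t \<mu> \<nu> C)) \<and>
         (1 \<le> p \<longrightarrow> p \<le> 2 \<longrightarrow>
           s\<^sub>\<mu> * (1 - 1 / p) + s\<^sub>\<nu> / p > 1 + (real DIM('a) - 1) / p \<longrightarrow>
           (\<forall>t>0. \<exists>C. spherical_Lp_bound \<rho> p t \<mu> \<nu> C))"
proof -
  let ?d = "real DIM('a)"
  have \<mu>: "finite_measure \<mu>" "sets \<mu> = sets borel"
    using finite_measure_compact_support[OF assms(4,6)] assms(4) by (simp_all add: compactly_supported_borel_def)
  have \<nu>: "finite_measure \<nu>" "sets \<nu> = sets borel"
    using finite_measure_compact_support[OF assms(5,7)] assms(5) by (simp_all add: compactly_supported_borel_def)
  show ?thesis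
  proof (intro conjI impI allI)
    fix t :: real
    assume p: "2 \<le> p" and c: "s\<^sub>\<mu> * (1 - 1 / p) + s\<^sub>\<nu> / p > ?d - (?d - 1) / p" and t: "0 < t"
    have "p * (?d - (?d - 1) / p) < p * (s\<^sub>\<mu> * (1 - 1 / p) + s\<^sub>\<nu> / p)"
      using c p by (intro mult_strict_left_mono) auto
    moreover have "p * (?d - (?d - 1) / p) = p * ?d - (?d - 1)"
      "p * (s\<^sub>\<mu> * (1 - 1 / p) + s\<^sub>\<nu> / p) = (p - 1) * s\<^sub>\<mu> + s\<^sub>\<nu>"
      using p by (simp_all add: field_simps)
    ultimately have pos: "?d - 1 - p * ?d + (p - 1) * s\<^sub>\<mu> + s\<^sub>\<nu> > 0" by linarith
    have m: "s\<^sub>\<mu> \<le> ?d" using assms(2) by simp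
    obtain C where "\<And>\<epsilon>. \<epsilon> > 0 \<Longrightarrow> conv_bounded p \<mu> \<nu> (\<lambda>z. complex_of_real (sphere_kernel \<rho> \<epsilon> t z)) C"
      using sphere_kernel_Lp_bound[OF assms(1) \<mu> \<nu> assms(6,7) m p pos assms(8) t] by blast
    then have "spherical_Lp_bound \<rho> p t \<mu> \<nu> (\<bar>C\<bar> powr (1 / p))"
      by (rule spherical_Lp_boundI[OF \<mu> \<nu> assms(8) order_trans[OF one_le_numeral p]])
    then show "\<exists>C. spherical_Lp_bound \<rho> p t \<mu> \<nu> C" by blast
  next
    fix t :: real
    assume p: "1 \<le> p" "p \<le> 2" and c: "s\<^sub>\<mu> * (1 - 1 / p) + s\<^sub>\<nu> / p > 1 + (?d - 1) / p" and t: "0 < t"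
    \<comment> \<open>At p = 1 the hypothesis reads s_\<nu> > d.\<close>
    have "p \<noteq> 1" using c assms(3) by auto
    then have p1: "p > 1" using p by simp
    define q where "q = p / (p - 1)"
    have q: "q \<ge> 2" using p p1 by (simp add: q_def field_simps)
    have "p * (1 + (?d - 1) / p) < p * (s\<^sub>\<mu> * (1 - 1 / p) + s\<^sub>\<nu> / p)"
      using c p1 by (intro mult_strict_left_mono) auto
    moreover have "p * (1 + (?d - 1) / p) = p + ?d - 1"
      "p * (s\<^sub>\<mu> * (1 - 1 / p) + s\<^sub>\<nu> / p) = (p - 1) * s\<^sub>\<mu> + s\<^sub>\<nu>"
      using p1 by (simp_all add: field_simps)
    ultimately have "p + ?d - 1 < (p - 1) * s\<^sub>\<mu> + s\<^sub>\<nu>" by simp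
    \<comment> \<open>With \<mu> and \<nu> exchanged and p replaced by its conjugate q, the
      condition for exponents above 2 is, after multiplication by p - 1, the present hypothesis
      multiplied by p.\<close>
    moreover have "(?d - 1 - q * ?d + (q - 1) * s\<^sub>\<nu> + s\<^sub>\<mu>) * (p - 1) = (p - 1) * s\<^sub>\<mu> + s\<^sub>\<nu> - (p + ?d - 1)"
    proof -
      have "(?d - 1 - q * ?d + (q - 1) * s\<^sub>\<nu> + s\<^sub>\<mu>) * (p - 1)
          = (?d - 1) * (p - 1) - q * (p - 1) * ?d + (q * (p - 1) - (p - 1)) * s\<^sub>\<nu> + (p - 1) * s\<^sub>\<mu>"
        by (simp add: algebra_simps)
      also have "q * (p - 1) = p" using p1 by (simp add: q_def)
      finally show ?thesis by (simp add: algebra_simps)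
    qed
    ultimately have "0 < (?d - 1 - q * ?d + (q - 1) * s\<^sub>\<nu> + s\<^sub>\<mu>) * (p - 1)" by linarith
    then have pos: "?d - 1 - q * ?d + (q - 1) * s\<^sub>\<nu> + s\<^sub>\<mu> > 0"
      by (rule zero_less_mult_pos2) (use p1 in simp)
    have m: "s\<^sub>\<nu> \<le> ?d" using assms(3) by simp
    obtain C where C: "\<And>\<epsilon>. \<epsilon> > 0 \<Longrightarrow> conv_bounded q \<nu> \<mu> (\<lambda>z. complex_of_real (sphere_kernel \<rho> \<epsilon> t z)) C"
      using sphere_kernel_Lp_bound[OF assms(1) \<nu> \<mu> assms(7,6) m q pos assms(8) t] by blast
    \<comment> \<open>Strictly positive, as required for the division by 2 C in
      \<open>conv_op_dual_bound\<close>.\<close>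
    define C' where "C' = \<bar>C\<bar> + 1"
    have "conv_bounded p \<mu> \<nu> (\<lambda>z. complex_of_real (sphere_kernel \<rho> \<epsilon> t z)) (2 * (2 * C') powr (p / q))"
      if \<epsilon>: "\<epsilon> > 0" for \<epsilon>
    proof -
      let ?K = "\<lambda>z. complex_of_real (sphere_kernel \<rho> \<epsilon> t z)"
      note P = sphere_kernel_props[OF assms(8) \<epsilon>, of t]
      note [measurable] = P(1)
      obtain B where "\<forall>x. \<bar>sphere_kernel \<rho> \<epsilon> t x\<bar> \<le> B" using P(2) ..
      then have KB: "cmod (?K x) \<le> B" for x by simp
      have "conv_bounded q \<nu> \<mu> ?K C'"
      proof (rule conv_boundedI)
        fix h :: "'a \<Rightarrow> complex" assume h: "h \<in> borel_measurable borel" "integrable \<nu> (\<lambda>x. cmod (h x) powr q)"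
        note conv_boundedD[OF C[OF \<epsilon>] h]
        also have "C * (\<integral>y. cmod (h y) powr q \<partial>\<nu>) \<le> C' * (\<integral>y. cmod (h y) powr q \<partial>\<nu>)"
          by (intro mult_right_mono) (auto simp: C'_def)
        finally show "(\<integral>y. cmod (conv_op ?K \<nu> h y) powr q \<partial>\<mu>) \<le> C' * (\<integral>x. cmod (h x) powr q \<partial>\<nu>)" .
      qed
      then show ?thesis
        by (intro conv_op_dual_bound[OF \<mu> \<nu> _ KB _ p1 q_def]) (simp_all add: P(1,3) C'_def)
    qed
    then have "spherical_Lp_bound \<rho> p t \<mu> \<nu> (\<bar>2 * (2 * C') powr (p / q)\<bar> powr (1 / p))"
      by (rule spherical_Lp_boundI[OF \<mu> \<nu> assms(8) p(1)])
    then show "\<exists>C. spherical_Lp_bound \<rho> p t \<mu> \<nu> C" by blast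
  qed
qed

end
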